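(* Let $\varphi(z_1,z_2)=(\alpha z_1,\psi(z_2))$, where $\alpha$ is a primitive $p$-th root of unity and $\psi$ is a parabolic Möbius transformation of $\mathbb{U}$. Let $\zeta$ be the fixed point of $\psi$. Let $w\in\mathbb{A}^2$ and let $T:\mathbb{A}^2\to\mathbb{A}^2$ be the operator $(Tf)(z)=w(z)f(\varphi(z))$. Let $r=\min_{\varsigma\in\mathbb{T}}|w_p(\varsigma,\zeta)|^{1/p}$ and $R=\max_{\varsigma\in\mathbb{T}}|w_p(\varsigma,\zeta)|^{1/p}$. (1) If $w$ is invertible in $\mathbb{A}^2$, then $\sigma(T)=\sigma_{sf}(T)=\mathbb{AN}(r,R)$. (2) If $w$ is not invertible in $C(\mathbb{T}^2)$, then $\sigma(T)=\sigma_{sf}(T)=R\mathbb{D}$. (3) If $w$ is not invertible in $\mathbb{A}^2$ but invertible in $C(\mathbb{T}^2)$, then $\sigma_{a.p.}(T)=\sigma_{sf}(T)=\mathbb{AN}(r,R)$ and $\sigma(T)=\sigma_{lsf}(T)=R\mathbb{D}$.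
   Context: $\mathbb{D}$, $\mathbb{U}$ and $\mathbb{T}$ are the closed unit disc, the open unit disc and the unit circle in $\mathbb{C}$. For $c\in\mathbb{C}$ and $S\subseteq\mathbb{C}$, $cS=\{cs:s\in S\}$. $\mathbb{AN}(r,R)=\{\lambda\in\mathbb{C}:r\le|\lambda|\le R\}$. A Möbius transformation of $\mathbb{U}$ is a conformal automorphism of $\mathbb{U}$, extended to $\mathbb{D}$; it is parabolic if it is not the identity and has exactly one fixed point in $\mathbb{D}$, lying on $\mathbb{T}$. $\mathbb{A}^2$ is the bidisc algebra: all functions continuous on $\mathbb{D}^2$ and analytic in $\mathbb{U}^2$, with the sup norm. Invertibility of $w$ in $C(\mathbb{T}^2)$ refers to the restriction of $w$ to $\mathbb{T}^2$. $w_1=w$, $w_n=w_{n-1}\,(w\circ\varphi^{n-1})$ for $n\ge2$, where $\varphi^{k}$ is the $k$-th iterate. For a bounded linear operator $T$ on a Banach space $X$: $T$ is upper semi-Fredholm if its range is closed and $\dim\ker T<\infty$; lower semi-Fredholm if its range has finite codimension; semi-Fredholm if it is upper or lower semi-Fredholm. $\sigma(T)$ is the spectrum; $\sigma_{a.p.}(T)$ is the approximate point spectrum (the set of $\lambda$ for which there are $x_n\in X$, $\|x_n\|=1$, with $Tx_n-\lambda x_n\to0$); $\sigma_{sf}(T)$ and $\sigma_{lsf}(T)$ are the sets of $\lambda\in\mathbb{C}$ such that $\lambda I-T$ is not semi-Fredholm, respectively not lower semi-Fredholm. *)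

theory Defs
  imports "HOL-Complex_Analysis.Complex_Analysis"
begin

section \<open>Complex normed spaces and parts of the spectrum\<close>

class complex_normed_vector = real_normed_vector +
  fixes scaleC :: "complex \<Rightarrow> 'a \<Rightarrow> 'a" (infixr \<open>*\<^sub>C\<close> 75)
  assumes scaleC_add_right: "c *\<^sub>C (x + y) = c *\<^sub>C x + c *\<^sub>C y"
    and scaleC_add_left: "(c + d) *\<^sub>C x = c *\<^sub>C x + d *\<^sub>C x"
    and scaleC_scaleC: "c *\<^sub>C d *\<^sub>C x = (c * d) *\<^sub>C x"
    and scaleC_one: "1 *\<^sub>C x = x"
    and scaleR_scaleC: "r *\<^sub>R x = complex_of_real r *\<^sub>C x"
    and norm_scaleC: "norm (c *\<^sub>C x) = cmod c * norm x"

class complex_banach = complex_normed_vector + banach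

global_interpretation complex_vector:
  vector_space "scaleC :: complex \<Rightarrow> 'a \<Rightarrow> 'a::complex_normed_vector"
  by unfold_locales (simp_all add: scaleC_add_right scaleC_add_left scaleC_scaleC scaleC_one)

definition bounded_clinear :: "('a::complex_normed_vector \<Rightarrow> 'a) \<Rightarrow> bool" where
  "bounded_clinear T \<longleftrightarrow> bounded_linear T \<and> (\<forall>c x. T (c *\<^sub>C x) = c *\<^sub>C T x)"

definition finite_cdim :: "'a::complex_normed_vector set \<Rightarrow> bool" where
  "finite_cdim V \<longleftrightarrow> (\<exists>B. finite B \<and> V \<subseteq> complex_vector.span B)"

definition finite_ccodim :: "'a::complex_normed_vector set \<Rightarrow> bool" where
  "finite_ccodim V \<longleftrightarrow> (\<exists>B. finite B \<and> complex_vector.span (V \<union> B) = UNIV)"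

definition upper_semi_Fredholm :: "('a::complex_banach \<Rightarrow> 'a) \<Rightarrow> bool" where
  "upper_semi_Fredholm T \<longleftrightarrow> closed (range T) \<and> finite_cdim {x. T x = 0}"

definition lower_semi_Fredholm :: "('a::complex_banach \<Rightarrow> 'a) \<Rightarrow> bool" where
  "lower_semi_Fredholm T \<longleftrightarrow> finite_ccodim (range T)"

definition semi_Fredholm :: "('a::complex_banach \<Rightarrow> 'a) \<Rightarrow> bool" where
  "semi_Fredholm T \<longleftrightarrow> upper_semi_Fredholm T \<or> lower_semi_Fredholm T"

definition shifted :: "complex \<Rightarrow> ('a::complex_banach \<Rightarrow> 'a) \<Rightarrow> 'a \<Rightarrow> 'a" where
  "shifted \<mu> T x = \<mu> *\<^sub>C x - T x"

definition spectrum :: "('a::complex_banach \<Rightarrow> 'a) \<Rightarrow> complex set" where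
  "spectrum T = {\<mu>. \<not> (\<exists>S. bounded_clinear S \<and> S \<circ> shifted \<mu> T = id \<and> shifted \<mu> T \<circ> S = id)}"

definition approx_point_spectrum :: "('a::complex_banach \<Rightarrow> 'a) \<Rightarrow> complex set" where
  "approx_point_spectrum T =
    {\<mu>. \<exists>x :: nat \<Rightarrow> 'a. (\<forall>n. norm (x n) = 1) \<and> (\<lambda>n. T (x n) - \<mu> *\<^sub>C x n) \<longlonglongrightarrow> 0}"

definition semi_Fredholm_spectrum :: "('a::complex_banach \<Rightarrow> 'a) \<Rightarrow> complex set" where
  "semi_Fredholm_spectrum T = {\<mu>. \<not> semi_Fredholm (shifted \<mu> T)}"

definition lower_semi_Fredholm_spectrum :: "('a::complex_banach \<Rightarrow> 'a) \<Rightarrow> complex set" where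
  "lower_semi_Fredholm_spectrum T = {\<mu>. \<not> lower_semi_Fredholm (shifted \<mu> T)}"


section \<open>The bidisc algebra\<close>

abbreviation closed_bidisc :: "(complex \<times> complex) set" where
  "closed_bidisc \<equiv> cball 0 1 \<times> cball 0 1"

abbreviation open_bidisc :: "(complex \<times> complex) set" where
  "open_bidisc \<equiv> ball 0 1 \<times> ball 0 1"

abbreviation torus :: "(complex \<times> complex) set" where
  "torus \<equiv> sphere 0 1 \<times> sphere 0 1"

text \<open>Analyticity in two variables is complex differentiability at each point: the Frechet
  derivative exists and is complex-linear.\<close>

definition analytic_open_bidisc :: "(complex \<times> complex \<Rightarrow> complex) \<Rightarrow> bool" where
  "analytic_open_bidisc f \<longleftrightarrow>
    (\<forall>z \<in> open_bidisc. \<exists>a b. (f has_derivative (\<lambda>h. a * fst h + b * snd h)) (at z))"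

text \<open>Elements are functions on the closed bidisc; the value \<^term>\<open>0\<close> outside is only a
  normalisation making equality of elements coincide with equality on the closed bidisc.\<close>

typedef bidisc_algebra =
  "{f :: complex \<times> complex \<Rightarrow> complex. continuous_on closed_bidisc f \<and> analytic_open_bidisc f
      \<and> (\<forall>z. z \<notin> closed_bidisc \<longrightarrow> f z = 0)}"
  morphisms apply_bidisc Abs_bidisc
  by (rule exI[of _ "\<lambda>_. 0"]) (auto simp: analytic_open_bidisc_def intro!: exI[of _ 0])

declare [[coercion apply_bidisc]]

setup_lifting type_definition_bidisc_algebra

lemma bidisc_eqI: "(\<And>z. z \<in> closed_bidisc \<Longrightarrow> apply_bidisc f z = apply_bidisc g z) \<Longrightarrow> f = g"
  by transfer (rule ext, metis)

lemma continuous_on_apply_bidisc: "continuous_on closed_bidisc (apply_bidisc f)"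
  using apply_bidisc[of f] by simp

lemma bounded_apply_bidisc: "bounded (apply_bidisc f ` closed_bidisc)"
  by (intro compact_imp_bounded compact_continuous_image continuous_on_apply_bidisc compact_Times) auto

instantiation bidisc_algebra :: complex_normed_vector
begin

lift_definition zero_bidisc_algebra :: bidisc_algebra is "\<lambda>_. 0"
  by (auto simp: analytic_open_bidisc_def intro!: exI[of _ 0])

lemma analytic_add:
  assumes "analytic_open_bidisc f" "analytic_open_bidisc g"
  shows "analytic_open_bidisc (\<lambda>z. f z + g z)"
  unfolding analytic_open_bidisc_def
proof
  fix z assume "z \<in> open_bidisc"
  then obtain a b c d where
    "(f has_derivative (\<lambda>h. a * fst h + b * snd h)) (at z)"
    "(g has_derivative (\<lambda>h. c * fst h + d * snd h)) (at z)"
    using assms unfolding analytic_open_bidisc_def by blast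
  from has_derivative_add[OF this]
  have "((\<lambda>z. f z + g z) has_derivative (\<lambda>h. (a + c) * fst h + (b + d) * snd h)) (at z)"
    by (simp add: algebra_simps)
  then show "\<exists>a b. ((\<lambda>z. f z + g z) has_derivative (\<lambda>h. a * fst h + b * snd h)) (at z)"
    by blast
qed

lemma analytic_cmult:
  assumes "analytic_open_bidisc f"
  shows "analytic_open_bidisc (\<lambda>z. c * f z)"
  unfolding analytic_open_bidisc_def
proof
  fix z assume "z \<in> open_bidisc"
  then obtain a b where "(f has_derivative (\<lambda>h. a * fst h + b * snd h)) (at z)"
    using assms unfolding analytic_open_bidisc_def by blast
  from has_derivative_mult_right[OF this, of c]
  have "((\<lambda>z. c * f z) has_derivative (\<lambda>h. (c * a) * fst h + (c * b) * snd h)) (at z)"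
    by (simp add: algebra_simps)
  then show "\<exists>a b. ((\<lambda>z. c * f z) has_derivative (\<lambda>h. a * fst h + b * snd h)) (at z)"
    by blast
qed

lift_definition plus_bidisc_algebra :: "bidisc_algebra \<Rightarrow> bidisc_algebra \<Rightarrow> bidisc_algebra"
  is "\<lambda>f g z. f z + g z"
  by (auto simp del: mem_Times_iff intro!: continuous_on_add analytic_add)

lift_definition scaleC_bidisc_algebra :: "complex \<Rightarrow> bidisc_algebra \<Rightarrow> bidisc_algebra"
  is "\<lambda>c f z. c * f z"
  by (auto simp del: mem_Times_iff intro!: continuous_on_mult_left analytic_cmult)

definition uminus_bidisc_algebra :: "bidisc_algebra \<Rightarrow> bidisc_algebra"
  where "- f = (- 1) *\<^sub>C f" for f :: bidisc_algebra

definition minus_bidisc_algebra :: "bidisc_algebra \<Rightarrow> bidisc_algebra \<Rightarrow> bidisc_algebra"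
  where "f - g = f + (- 1) *\<^sub>C g" for f g :: bidisc_algebra

definition scaleR_bidisc_algebra :: "real \<Rightarrow> bidisc_algebra \<Rightarrow> bidisc_algebra"
  where "r *\<^sub>R f = complex_of_real r *\<^sub>C f" for f :: bidisc_algebra

definition norm_bidisc_algebra :: "bidisc_algebra \<Rightarrow> real"
  where "norm f = (SUP z\<in>closed_bidisc. cmod (f z))" for f :: bidisc_algebra

definition dist_bidisc_algebra :: "bidisc_algebra \<Rightarrow> bidisc_algebra \<Rightarrow> real"
  where "dist f g = norm (f - g)" for f g :: bidisc_algebra

definition sgn_bidisc_algebra :: "bidisc_algebra \<Rightarrow> bidisc_algebra"
  where "sgn f = inverse (norm f) *\<^sub>R f" for f :: bidisc_algebra

definition uniformity_bidisc_algebra :: "(bidisc_algebra \<times> bidisc_algebra) filter"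
  where "uniformity_bidisc_algebra = (INF e\<in>{0 <..}. principal {(x, y). dist x y < e})"

definition open_bidisc_algebra :: "bidisc_algebra set \<Rightarrow> bool"
  where "open_bidisc_algebra S = (\<forall>x\<in>S. \<forall>\<^sub>F (x', y) in uniformity. x' = x \<longrightarrow> y \<in> S)"

lemma apply_zero: "apply_bidisc 0 z = 0"
  and apply_plus: "apply_bidisc (f + g) z = f z + g z"
  and apply_scaleC: "apply_bidisc (c *\<^sub>C f) z = c * f z"
  by (transfer, simp)+

lemma apply_uminus: "apply_bidisc (- f) z = - f z"
  and apply_minus: "apply_bidisc (f - g) z = f z - g z"
  and apply_scaleR: "apply_bidisc (r *\<^sub>R f) z = complex_of_real r * f z"
  by (simp_all add: uminus_bidisc_algebra_def minus_bidisc_algebra_def scaleR_bidisc_algebra_def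
      apply_plus apply_scaleC)

lemmas apply_simps =
  apply_zero apply_plus apply_scaleC apply_uminus apply_minus apply_scaleR

lemma norm_apply_le:
  assumes "z \<in> closed_bidisc"
  shows "cmod (apply_bidisc f z) \<le> norm f"
proof -
  obtain B where "\<forall>x\<in>apply_bidisc f ` closed_bidisc. norm x \<le> B"
    using bounded_apply_bidisc[of f] unfolding bounded_iff by blast
  then have "bdd_above ((\<lambda>z. cmod (f z)) ` closed_bidisc)"
    by (intro bdd_aboveI[of _ B]) blast
  then show ?thesis
    unfolding norm_bidisc_algebra_def using assms by (rule cSUP_upper2) simp
qed

lemma norm_bidisc_le:
  assumes "\<And>z. z \<in> closed_bidisc \<Longrightarrow> cmod (apply_bidisc f z) \<le> B"
  shows "norm f \<le> B"
  unfolding norm_bidisc_algebra_def by (rule cSUP_least) (use assms in auto)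

lemma norm_bidisc_ge_0: "norm (f :: bidisc_algebra) \<ge> 0"
  using order_trans[OF norm_ge_zero norm_apply_le[of "(0, 0)" f]] by simp

lemma norm_bidisc_scaleC_le: "norm (c *\<^sub>C f) \<le> cmod c * norm (f :: bidisc_algebra)"
  by (rule norm_bidisc_le) (auto simp: apply_simps norm_mult intro!: mult_left_mono norm_apply_le)

lemma norm_bidisc_scaleC: "norm (c *\<^sub>C f) = cmod c * norm (f :: bidisc_algebra)"
proof (cases "c = 0")
  case True
  then show ?thesis
    using norm_bidisc_scaleC_le[of c f] norm_bidisc_ge_0[of "c *\<^sub>C f"] by simp
next
  case False
  have "inverse c *\<^sub>C c *\<^sub>C f = f"
    using False by (intro bidisc_eqI) (simp add: apply_simps)
  then have "norm f \<le> inverse (cmod c) * norm (c *\<^sub>C f)"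
    using norm_bidisc_scaleC_le[of "inverse c" "c *\<^sub>C f"] by (simp add: norm_inverse)
  then have "cmod c * norm f \<le> norm (c *\<^sub>C f)"
    using False by (simp add: field_simps)
  then show ?thesis
    using norm_bidisc_scaleC_le[of c f] by linarith
qed

instance
proof
  fix f g :: bidisc_algebra and r :: real and c :: complex
  show "norm f = 0 \<longleftrightarrow> f = 0"
  proof
    assume "norm f = 0"
    then have "cmod (f z) \<le> 0" if "z \<in> closed_bidisc" for z
      using norm_apply_le[OF that, of f] by simp
    then show "f = 0"
      by (intro bidisc_eqI) (simp add: apply_simps)
  next
    assume "f = 0"
    then have "norm f \<le> 0"
      by (intro norm_bidisc_le) (simp add: apply_simps)
    then show "norm f = 0"
      using norm_bidisc_ge_0[of f] by simp
  qed
  show "norm (f + g) \<le> norm f + norm g"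
    by (rule norm_bidisc_le)
      (auto simp del: mem_Times_iff simp: apply_simps intro!: norm_triangle_le add_mono norm_apply_le)
  show "norm (c *\<^sub>C f) = cmod c * norm f"
    by (rule norm_bidisc_scaleC)
  show "norm (r *\<^sub>R f) = \<bar>r\<bar> * norm f"
    by (simp add: scaleR_bidisc_algebra_def norm_bidisc_scaleC)
qed (rule bidisc_eqI dist_bidisc_algebra_def sgn_bidisc_algebra_def uniformity_bidisc_algebra_def
      open_bidisc_algebra_def scaleR_bidisc_algebra_def; simp add: apply_simps algebra_simps)+

end


subsection \<open>Completeness\<close>

lemma analytic_slices:
  assumes "analytic_open_bidisc f"
  shows "y \<in> ball 0 1 \<Longrightarrow> (\<lambda>x. f (x, y)) holomorphic_on ball 0 1"
    and "x \<in> ball 0 1 \<Longrightarrow> (\<lambda>y. f (x, y)) holomorphic_on ball 0 1"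
proof -
  have *: "((\<lambda>x. f (x, y)) has_field_derivative a) (at x)"
       "((\<lambda>y. f (x, y)) has_field_derivative b) (at y)"
    if d: "(f has_derivative (\<lambda>h. a * fst h + b * snd h)) (at (x, y))" for x y a b
  proof -
    have "((\<lambda>x. (x, y)) has_derivative (\<lambda>h. (h, 0))) (at x)"
      "((\<lambda>y. (x, y)) has_derivative (\<lambda>h. (0, h))) (at y)"
      by (auto intro!: derivative_eq_intros)
    from this[THEN has_derivative_compose, of f "\<lambda>h. a * fst h + b * snd h"] d
    show "((\<lambda>x. f (x, y)) has_field_derivative a) (at x)"
       "((\<lambda>y. f (x, y)) has_field_derivative b) (at y)"
      by (simp_all add: has_field_derivative_def)
  qed
  show "(\<lambda>x. f (x, y)) holomorphic_on ball 0 1" if "y \<in> ball 0 1"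
    unfolding holomorphic_on_open[OF open_ball]
  proof
    fix x :: complex assume "x \<in> ball 0 1"
    with that have "(x, y) \<in> open_bidisc" by simp
    with assms obtain a b where "(f has_derivative (\<lambda>h. a * fst h + b * snd h)) (at (x, y))"
      unfolding analytic_open_bidisc_def by blast
    from *(1)[OF this] show "\<exists>d. ((\<lambda>x. f (x, y)) has_field_derivative d) (at x)" by blast
  qed
  show "(\<lambda>y. f (x, y)) holomorphic_on ball 0 1" if "x \<in> ball 0 1"
    unfolding holomorphic_on_open[OF open_ball]
  proof
    fix y :: complex assume "y \<in> ball 0 1"
    with that have "(x, y) \<in> open_bidisc" by simp
    with assms obtain a b where "(f has_derivative (\<lambda>h. a * fst h + b * snd h)) (at (x, y))"
      unfolding analytic_open_bidisc_def by blast
    from *(2)[OF this] show "\<exists>d. ((\<lambda>y. f (x, y)) has_field_derivative d) (at y)" by blast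
  qed
qed

lemma separately_holomorphic_imp_analytic:
  assumes cont: "continuous_on closed_bidisc f"
    and hol1: "\<And>y. y \<in> ball 0 1 \<Longrightarrow> (\<lambda>x. f (x, y)) holomorphic_on ball 0 1"
    and hol2: "\<And>x. x \<in> ball 0 1 \<Longrightarrow> (\<lambda>y. f (x, y)) holomorphic_on ball 0 1"
  shows "analytic_open_bidisc f"
  unfolding analytic_open_bidisc_def
proof
  fix z assume "z \<in> open_bidisc"
  then obtain x0 y0 where z: "z = (x0, y0)" and x0: "x0 \<in> ball 0 1" and y0: "y0 \<in> ball 0 1"
    by auto
  define D where "D x y = deriv (\<lambda>y. f (x, y)) y" for x y
  define a where "a = deriv (\<lambda>x. f (x, y0)) x0"
  define r where "r = (1 - cmod y0) / 2"
  have r: "r > 0" using y0 by (simp add: r_def)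
  have sub: "cball y r \<subseteq> ball 0 1" if "dist y y0 < r" for y
  proof
    fix u assume "u \<in> cball y r"
    then have "cmod (u - y) \<le> r" "cmod (y - y0) < r"
      using that by (auto simp: dist_norm norm_minus_commute)
    moreover have "cmod u \<le> cmod (u - y) + cmod (y - y0) + cmod y0"
      by (smt (verit) norm_triangle_sub)
    ultimately show "u \<in> ball 0 1" by (simp add: r_def)
  qed
  have uc: "uniformly_continuous_on closed_bidisc f"
    by (intro compact_uniformly_continuous cont compact_Times) auto
  have slice_close: "\<exists>d>0. \<forall>x y. x \<in> ball 0 1 \<and> dist x x0 < d \<and> dist y y0 < r \<longrightarrow>
      cmod (D x y - D x0 y) \<le> e" if e: "e > 0" for e
  proof -
    obtain d where d: "d > 0" and
      close: "\<And>p q. p \<in> closed_bidisc \<Longrightarrow> q \<in> closed_bidisc \<Longrightarrow> dist p q < d \<Longrightarrow> dist (f p) (f q) < e * r"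
      using uc e r unfolding uniformly_continuous_on_def by (metis mult_pos_pos)
    have "cmod (D x y - D x0 y) \<le> e" if x: "x \<in> ball 0 1" "dist x x0 < d" and y: "dist y y0 < r" for x y
    proof -
      let ?g = "\<lambda>u. f (x, u) - f (x0, u)"
      have hol: "?g holomorphic_on ball 0 1"
        using hol2[OF x(1)] hol2[OF x0] by (rule holomorphic_on_diff)
      have yb: "y \<in> ball 0 1" using subsetD[OF sub[OF y], of y] r by simp
      have "cmod ((deriv ^^ 1) ?g y) \<le> fact 1 * (e * r) / r ^ 1"
      proof (rule Cauchy_higher_deriv_bound)
        show "?g holomorphic_on ball y r"
          using hol sub[OF y] ball_subset_cball by (meson holomorphic_on_subset subset_trans)
        show "continuous_on (cball y r) ?g"
          using hol sub[OF y] by (meson holomorphic_on_imp_continuous_on continuous_on_subset)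
        fix u assume "u \<in> ball y r"
        then have "u \<in> ball 0 1" using subsetD[OF sub[OF y], of u] by simp
        then have "dist (f (x, u)) (f (x0, u)) < e * r"
          using x x0 by (intro close) (auto simp: dist_Pair_Pair)
        then show "?g u \<in> ball 0 (e * r)" by (simp add: dist_norm norm_minus_commute)
      qed (use r in auto)
      moreover have "deriv ?g y = D x y - D x0 y"
        unfolding D_def using hol2[OF x(1)] hol2[OF x0] yb
        by (intro deriv_diff) (auto simp: holomorphic_on_imp_differentiable_at)
      ultimately show ?thesis using r by simp
    qed
    then show ?thesis using d by blast
  qed
  have D0: "isCont (D x0) y0"
    unfolding D_def using holomorphic_deriv[OF hol2[OF x0] open_ball] y0
    by (metis (no_types, lifting) continuous_on_eq_continuous_at eta_contract_eq
        holomorphic_on_imp_continuous_on open_ball)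
  have Dcont: "((\<lambda>(x, y). D x y) \<longlongrightarrow> D x0 y0) (at (x0, y0) within open_bidisc)"
  proof (rule tendstoI)
    fix e :: real assume e: "e > 0"
    obtain d where d: "d > 0" and
      A: "\<And>x y. x \<in> ball 0 1 \<Longrightarrow> dist x x0 < d \<Longrightarrow> dist y y0 < r \<Longrightarrow> cmod (D x y - D x0 y) \<le> e / 2"
      using slice_close[of "e / 2"] e by auto
    obtain d' where d': "d' > 0" and B: "\<And>y. dist y y0 < d' \<Longrightarrow> dist (D x0 y) (D x0 y0) < e / 2"
      using D0 e unfolding continuous_at_eps_delta by (metis half_gt_zero)
    let ?m = "min d (min d' r)"
    have "dist (D x y) (D x0 y0) < e" if "x \<in> ball 0 1" "dist (x, y) (x0, y0) < ?m" for x y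
    proof -
      have "dist x x0 < ?m" "dist y y0 < ?m"
        using that(2) dist_fst_le[of "(x, y)" "(x0, y0)"] dist_snd_le[of "(x, y)" "(x0, y0)"]
        by (simp_all only: fst_conv snd_conv)
      then show ?thesis
        using A[of x y] B[of y] that(1) dist_triangle[of "D x y" "D x0 y0" "D x0 y"]
        by (simp add: dist_norm)
    qed
    moreover have "?m > 0" using d d' r by simp
    ultimately show "\<forall>\<^sub>F p in at (x0, y0) within open_bidisc. dist (case p of (x, y) \<Rightarrow> D x y) (D x0 y0) < e"
      unfolding eventually_at by (intro exI[of _ ?m]) auto
  qed
  have "((\<lambda>(x, y). f (x, y)) has_derivative
      (\<lambda>(tx, ty). (*) a tx + blinfun_apply (blinfun_mult_right (D x0 y0)) ty))
      (at (x0, y0) within open_bidisc)"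
  proof (rule has_derivative_partialsI)
    show "((\<lambda>x. f (x, y0)) has_derivative (*) a) (at x0 within ball 0 1)"
      using holomorphic_derivI[OF hol1[OF y0] open_ball x0]
      unfolding a_def has_field_derivative_def by (rule has_derivative_at_withinI)
    show "((\<lambda>y. f (x, y)) has_derivative blinfun_apply (blinfun_mult_right (D x y))) (at y within ball 0 1)"
      if "x \<in> ball 0 1" "y \<in> ball 0 1" for x y
      using holomorphic_derivI[OF hol2[OF that(1)] open_ball that(2)]
      unfolding D_def has_field_derivative_def
      by (simp add: has_derivative_at_withinI)
    show "continuous (at (x0, y0) within open_bidisc) (\<lambda>(x, y). blinfun_mult_right (D x y))"
      using bounded_linear.tendsto[OF bounded_linear_blinfun_mult_right Dcont]
      unfolding continuous_within by (simp add: case_prod_unfold)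
  qed (use y0 in auto)
  moreover have "at (x0, y0) within open_bidisc = at (x0, y0)"
    using x0 y0 by (intro at_within_open open_Times) auto
  ultimately have "(f has_derivative (\<lambda>h. a * fst h + D x0 y0 * snd h)) (at z)"
    by (simp add: z case_prod_unfold)
  then show "\<exists>a b. (f has_derivative (\<lambda>h. a * fst h + b * snd h)) (at z)"
    by blast
qed

instance bidisc_algebra :: complex_banach
proof
  fix X :: "nat \<Rightarrow> bidisc_algebra"
  assume X: "Cauchy X"
  have d: "dist (apply_bidisc f z) (apply_bidisc g z) \<le> dist f g" if "z \<in> closed_bidisc" for f g z
    using norm_apply_le[OF that, of "f - g"] by (simp add: apply_simps dist_norm)
  have "uniformly_Cauchy_on closed_bidisc (\<lambda>n. apply_bidisc (X n))"
    using X d unfolding uniformly_Cauchy_on_def Cauchy_def by (meson order.strict_trans1)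
  then obtain g where g: "uniform_limit closed_bidisc (\<lambda>n. apply_bidisc (X n)) g sequentially"
    using Cauchy_uniformly_convergent uniformly_convergent_on_def by blast
  have ana: "analytic_open_bidisc (apply_bidisc (X n))" for n
    using apply_bidisc[of "X n"] by simp
  have cont: "continuous_on closed_bidisc g"
    by (rule uniform_limit_theorem[OF _ g]) (simp_all add: continuous_on_apply_bidisc)
  have hol1: "(\<lambda>x. g (x, y)) holomorphic_on ball 0 1" if y: "y \<in> ball 0 1" for y
  proof (rule holomorphic_uniform_limit[of 0 1 "\<lambda>n x. X n (x, y)" sequentially "\<lambda>x. g (x, y)"])
    show "\<forall>\<^sub>F n in sequentially. continuous_on (cball 0 1) (\<lambda>x. X n (x, y))
        \<and> (\<lambda>x. X n (x, y)) holomorphic_on ball 0 1"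
      using y by (intro always_eventually allI conjI analytic_slices ana
          continuous_on_compose2[OF continuous_on_apply_bidisc]) (auto intro!: continuous_intros)
    show "uniform_limit (cball 0 1) (\<lambda>n x. X n (x, y)) (\<lambda>x. g (x, y)) sequentially"
      by (rule uniform_limit_compose'[OF g]) (use y in auto)
  qed auto
  have hol2: "(\<lambda>y. g (x, y)) holomorphic_on ball 0 1" if x: "x \<in> ball 0 1" for x
  proof (rule holomorphic_uniform_limit[of 0 1 "\<lambda>n y. X n (x, y)" sequentially "\<lambda>y. g (x, y)"])
    show "\<forall>\<^sub>F n in sequentially. continuous_on (cball 0 1) (\<lambda>y. X n (x, y))
        \<and> (\<lambda>y. X n (x, y)) holomorphic_on ball 0 1"
      using x by (intro always_eventually allI conjI analytic_slices ana
          continuous_on_compose2[OF continuous_on_apply_bidisc]) (auto intro!: continuous_intros)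
    show "uniform_limit (cball 0 1) (\<lambda>n y. X n (x, y)) (\<lambda>y. g (x, y)) sequentially"
      by (rule uniform_limit_compose'[OF g]) (use x in auto)
  qed auto
  define l where "l z = (if z \<in> closed_bidisc then g z else 0)" for z
  have cl: "continuous_on closed_bidisc l"
    using cont by (rule continuous_on_eq) (simp add: l_def)
  have "analytic_open_bidisc l"
  proof (rule separately_holomorphic_imp_analytic[OF cl])
    show "(\<lambda>x. l (x, y)) holomorphic_on ball 0 1" if "y \<in> ball 0 1" for y
      using hol1[OF that] by (rule holomorphic_transform) (use that in \<open>auto simp: l_def\<close>)
    show "(\<lambda>y. l (x, y)) holomorphic_on ball 0 1" if "x \<in> ball 0 1" for x
      using hol2[OF that] by (rule holomorphic_transform) (use that in \<open>auto simp: l_def\<close>)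
  qed
  then have L: "apply_bidisc (Abs_bidisc l) = l"
    using cl by (intro Abs_bidisc_inverse) (auto simp: l_def)
  have "X \<longlonglongrightarrow> Abs_bidisc l"
  proof (rule tendstoI)
    fix e :: real assume "e > 0"
    then have "\<forall>\<^sub>F n in sequentially. \<forall>z\<in>closed_bidisc. dist (X n z) (g z) < e / 2"
      using uniform_limitD[OF g, of "e / 2"] by simp
    then show "\<forall>\<^sub>F n in sequentially. dist (X n) (Abs_bidisc l) < e"
    proof eventually_elim
      case (elim n)
      have "norm (X n - Abs_bidisc l) \<le> e / 2"
      proof (rule norm_bidisc_le)
        fix z assume z: "z \<in> closed_bidisc"
        then show "cmod (apply_bidisc (X n - Abs_bidisc l) z) \<le> e / 2"
          using elim[rule_format, OF z] by (simp add: apply_simps L l_def dist_norm)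
      qed
      then show ?case using \<open>e > 0\<close> by (simp add: dist_norm)
    qed
  qed
  then show "convergent X" by (rule convergentI)
qed


section \<open>Weights, automorphisms, annuli\<close>

definition invertible_bidisc :: "bidisc_algebra \<Rightarrow> bool" where
  "invertible_bidisc w \<longleftrightarrow> (\<exists>v :: bidisc_algebra. \<forall>z \<in> closed_bidisc. w z * v z = 1)"

definition invertible_torus :: "bidisc_algebra \<Rightarrow> bool" where
  "invertible_torus w \<longleftrightarrow>
    (\<exists>v :: complex \<times> complex \<Rightarrow> complex. continuous_on torus v \<and> (\<forall>z \<in> torus. w z * v z = 1))"

text \<open>\<open>weight_iter w \<phi> n\<close> is the weight \<open>w\<^sub>n\<close> of the \<open>n\<close>-th power of \<open>f \<mapsto> w \<cdot> (f \<circ> \<phi>)\<close>; the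
  convention \<open>w\<^sub>0 = 1\<close> yields \<open>w\<^sub>1 = w\<close>.\<close>

primrec weight_iter ::
  "('a \<Rightarrow> complex) \<Rightarrow> ('a \<Rightarrow> 'a) \<Rightarrow> nat \<Rightarrow> 'a \<Rightarrow> complex" where
  "weight_iter w \<phi> 0 z = 1"
| "weight_iter w \<phi> (Suc n) z = weight_iter w \<phi> n z * w ((\<phi> ^^ n) z)"

text \<open>Only the values of \<open>\<psi>\<close> on the closed unit disc are relevant; there \<open>\<psi>\<close> is the continuous
  extension of a conformal automorphism of the open disc.\<close>

definition disc_moebius :: "(complex \<Rightarrow> complex) \<Rightarrow> bool" where
  "disc_moebius \<psi> \<longleftrightarrow>
    \<psi> holomorphic_on ball 0 1 \<and> bij_betw \<psi> (ball 0 1) (ball 0 1) \<and> continuous_on (cball 0 1) \<psi>"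

definition parabolic_disc_moebius :: "(complex \<Rightarrow> complex) \<Rightarrow> bool" where
  "parabolic_disc_moebius \<psi> \<longleftrightarrow>
    disc_moebius \<psi> \<and> (\<exists>z \<in> cball 0 1. \<psi> z \<noteq> z) \<and>
    (\<exists>\<zeta> \<in> sphere 0 1. {z \<in> cball 0 1. \<psi> z = z} = {\<zeta>})"

definition primitive_root_of_unity :: "nat \<Rightarrow> complex \<Rightarrow> bool" where
  "primitive_root_of_unity p \<alpha> \<longleftrightarrow> p > 0 \<and> \<alpha> ^ p = 1 \<and> (\<forall>k. 0 < k \<and> k < p \<longrightarrow> \<alpha> ^ k \<noteq> 1)"

definition annulus :: "real \<Rightarrow> real \<Rightarrow> complex set" where
  "annulus r R = {\<mu>. r \<le> cmod \<mu> \<and> cmod \<mu> \<le> R}"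

end

theory Submission
  imports Defs
begin

text \<open>
  Why the spectra are what they are.  In the coordinate \<open>height_coord\<close> the parabolic map \<open>\<psi>\<close> is a
  translation of a half plane, so every orbit of \<open>\<phi>\<close> spends all but a bounded number of steps near
  the cycles \<open>{(\<alpha>\<^sup>n x, \<zeta>)}\<close>.  The growth of the cocycle \<open>w\<^sub>n\<close> on the torus is therefore
  that of \<open>w\<^sub>p(\<cdot>, \<zeta>)\<close> on the circle.  As the torus is a norming set, this gives the spectral radius \<open>R\<close>
  (\<open>norm_T_power_le\<close>) and, if \<open>w\<close> has no zero on the torus, the lower bound \<open>|T\<^sup>n f| \<ge> c \<rho>\<^sup>n |f|\<close>
  for every \<open>\<rho> < r\<close> (\<open>norm_T_power_ge\<close>).  A Neumann series yields the resolvent for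
  \<open>|\<mu>| > R\<close>, and for \<open>|\<mu>| < r\<close> if \<open>w\<close> is invertible; if \<open>w\<close> is only invertible on the torus,
  \<open>\<mu> - T\<close> is still bounded below for \<open>|\<mu>| < r\<close>.

  To show that \<open>\<mu> - T\<close> is not semi-Fredholm, \<open>T\<close> is compared with a weighted shift along a finite
  orbit segment \<open>z\<^sub>0, \<dots>, z\<^sub>N\<close> in the torus.  High powers of a function peaking at \<open>z\<^sub>N\<close>, composed with
  powers of \<open>\<phi>\<close>, span a copy of \<open>\<ell>\<^sup>\<infinity>\<close> on which \<open>T\<close> is almost a backward shift, and the point
  evaluations at the \<open>z\<^sub>n\<close> span a copy of \<open>\<ell>\<^sup>1\<close> on which the transpose of \<open>T\<close> is the forward shift.
  Almost eigenvectors of these shifts on pairwise disjoint segments refute upper and lower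
  semi-Fredholmness, respectively.  They exist in two situations.  If \<open>|\<mu>|\<^sup>p = |w\<^sub>p(x, \<zeta>)|\<close> with
  \<open>|x| = 1\<close> and \<open>\<mu> \<noteq> 0\<close>, the shift along an orbit near the cycle of \<open>(x, \<zeta>)\<close> has almost periodic
  weights of geometric mean \<open>|\<mu>|\<close>; by the intermediate value theorem this covers the annulus.
  If \<open>w\<close> vanishes at a point of the torus and \<open>|\<mu>| < r\<close>, the solutions of the shift recursion that
  start at the last zero on the orbit, or end at the first one, decay geometrically.

  There remains a weight that has zeros, but none on the torus, and \<open>|\<mu>| < r\<close>: the range of
  \<open>\<mu> - T\<close> has to have infinite codimension.  By Hurwitz' theorem and connectedness, \<open>w\<close> has
  a zero \<open>(x, y)\<close> with \<open>|y| < 1\<close> for every \<open>x\<close> on the circle, or a zero with the two coordinates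
  exchanged (\<open>interior_zero_on_cylinder\<close>).  Each of these zeros gives a functional that annihilates the
  range of \<open>T\<close> and has preimages of all orders under the transpose of \<open>T\<close>, and the power series of
  these preimages annihilates the range of \<open>\<mu> - T\<close> (\<open>bounded_cfunctional_backward_chain\<close>).
  Functionals from different zeros are separated by peak functions.
\<close>

section \<open>Semi-Fredholm operators on complex Banach spaces\<close>

text \<open>Each equation allows one unknown to be eliminated.\<close>

lemma homogeneous_system_nontrivial:
  fixes M :: "'i \<Rightarrow> 'l \<Rightarrow> 'k::field"
  assumes "finite L" "finite I" "card L < card I"
  shows "\<exists>a. (\<exists>i\<in>I. a i \<noteq> 0) \<and> (\<forall>l\<in>L. (\<Sum>i\<in>I. a i * M i l) = 0)"
  using assms
proof (induction L arbitrary: I M rule: finite_induct)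
  case empty
  then show ?case
    by (intro exI[of _ "\<lambda>_. 1"]) (auto simp: card_gt_0_iff)
next
  case (insert l L)
  show ?case
  proof (cases "\<forall>i\<in>I. M i l = 0")
    case True
    obtain a where "\<exists>i\<in>I. a i \<noteq> 0" "\<forall>l\<in>L. (\<Sum>i\<in>I. a i * M i l) = 0"
      using insert.IH[of I M] insert.prems insert.hyps by auto
    with True show ?thesis by (intro exI[of _ a]) auto
  next
    case False
    then obtain j where j: "j \<in> I" "M j l \<noteq> 0" by blast
    let ?I = "I - {j}"
    have "finite ?I" "card L < card ?I" using insert.prems insert.hyps j by auto
    from insert.IH[OF this, of "\<lambda>i m. M i m - M i l / M j l * M j m"]
    obtain a where a: "\<exists>i\<in>?I. a i \<noteq> 0"
      "\<forall>m\<in>L. (\<Sum>i\<in>?I. a i * (M i m - M i l / M j l * M j m)) = 0"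
      by blast
    define t where "t = - (\<Sum>i\<in>?I. a i * M i l) / M j l"
    define a' where "a' = a(j := t)"
    have split: "(\<Sum>i\<in>I. a' i * M i m) = t * M j m + (\<Sum>i\<in>?I. a i * M i m)" for m
      using insert.prems j unfolding a'_def
      by (subst sum.remove[of I j]) (auto intro!: arg_cong2[of _ _ _ _ "(+)"] sum.cong)
    have "(\<Sum>i\<in>I. a' i * M i m) = 0" if "m \<in> insert l L" for m
    proof (cases "m = l")
      case True
      then show ?thesis using split[of l] j by (simp add: t_def)
    next
      case False
      with that a(2) have "(\<Sum>i\<in>?I. a i * M i m) = (\<Sum>i\<in>?I. a i * M i l / M j l * M j m)"
        by (simp add: algebra_simps sum_subtractf)
      then show ?thesis
        by (simp add: split t_def sum_distrib_right sum_divide_distrib)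
    qed
    moreover have "\<exists>i\<in>I. a' i \<noteq> 0"
      using a(1) by (auto simp: a'_def)
    ultimately show ?thesis by blast
  qed
qed

lemma homogeneous_system_normalised:
  fixes M :: "nat \<Rightarrow> 'l \<Rightarrow> complex"
  assumes "finite L" "card L \<le> k"
  obtains a where "\<And>i. i \<le> k \<Longrightarrow> cmod (a i) \<le> 1" "\<exists>i\<le>k. cmod (a i) = 1"
    "\<And>l. l \<in> L \<Longrightarrow> (\<Sum>i\<le>k. a i * M i l) = 0"
proof -
  obtain a where a: "\<exists>i\<in>{..k}. a i \<noteq> 0" "\<forall>l\<in>L. (\<Sum>i\<le>k. a i * M i l) = 0"
    using homogeneous_system_nontrivial[of L "{..k}" M] assms by auto
  define m where "m = Max ((\<lambda>i. cmod (a i)) ` {..k})"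
  have "m \<in> (\<lambda>i. cmod (a i)) ` {..k}"
    unfolding m_def by (rule Max_in) auto
  then obtain j where j: "j \<le> k" "m = cmod (a j)" by auto
  have le: "cmod (a i) \<le> m" if "i \<le> k" for i
    unfolding m_def using that by (intro Max_ge) auto
  have m: "m > 0"
    using a(1) le by (metis atMost_iff order_less_le_trans zero_less_norm_iff)
  define c where "c i = a i / complex_of_real m" for i
  have "cmod (c i) \<le> 1" if "i \<le> k" for i
    using le[OF that] m by (simp add: c_def norm_divide)
  moreover have "cmod (c j) = 1"
    using j m by (simp add: c_def norm_divide)
  moreover have "(\<Sum>i\<le>k. c i * M i l) = 0" if "l \<in> L" for l
  proof -
    have "(\<Sum>i\<le>k. c i * M i l) = (\<Sum>i\<le>k. a i * M i l) / complex_of_real m"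
      by (simp add: c_def sum_divide_distrib)
    with a(2) that show ?thesis by simp
  qed
  ultimately show ?thesis using that j by blast
qed

text \<open>The form of Baire's theorem behind open mapping arguments. It is used for a whole space and for a
  closed range.\<close>

lemma Baire_ball_subset_closure:
  fixes Y :: "'a::{complete_space} set" and D :: "nat \<Rightarrow> 'a set"
  assumes "closed Y" "Y \<noteq> {}" "Y = (\<Union>n. D n)"
  obtains n y d where "y \<in> Y" "d > 0" "ball y d \<inter> Y \<subseteq> closure (D n)"
proof -
  let ?T = "top_of_set Y"
  have sub: "closure (D n) \<subseteq> Y" for n
    using assms by (intro closure_minimal) auto
  have cm: "completely_metrizable_space ?T"
    using assms(1) by (simp add: completely_metrizable_space_closedin completely_metrizable_space_euclidean)
  have "\<exists>n. ?T interior_of (closure (D n)) \<noteq> {}"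
  proof (rule ccontr)
    assume "\<not> ?thesis"
    then have "?T interior_of (\<Union>(range (\<lambda>n. closure (D n)))) = {}"
      using sub cm by (intro Baire_category_alt) (auto intro!: closed_subset)
    moreover have "\<Union>(range (\<lambda>n. closure (D n))) = Y"
    proof (intro equalityI)
      show "Y \<subseteq> (\<Union>n. closure (D n))"
        using closure_subset[of "D _"] by (subst assms(3)) blast
    qed (use sub in blast)
    ultimately show False
      using assms(2) interior_of_topspace[of ?T] by simp
  qed
  then obtain n y where y: "y \<in> ?T interior_of (closure (D n))" by blast
  then obtain U where "openin ?T U" "y \<in> U" "U \<subseteq> closure (D n)"
    by (auto simp: interior_of_def)
  moreover from this obtain V where "open V" "U = Y \<inter> V"
    by (auto simp: openin_open)
  moreover from this \<open>y \<in> U\<close> obtain d where "d > 0" "ball y d \<subseteq> V"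
    by (metis IntD2 open_contains_ball)
  ultimately show ?thesis using that[of y d n] by blast
qed

definition bounded_cfunctional :: "('a::complex_normed_vector \<Rightarrow> complex) \<Rightarrow> bool" where
  "bounded_cfunctional \<mu> \<longleftrightarrow> bounded_linear \<mu> \<and> (\<forall>c x. \<mu> (c *\<^sub>C x) = c * \<mu> x)"

lemma bounded_cfunctionalI:
  assumes "\<And>x y. \<mu> (x + y) = \<mu> x + \<mu> y" "\<And>c x. \<mu> (c *\<^sub>C x) = c * \<mu> x"
    and "\<And>x. cmod (\<mu> x) \<le> norm x * K"
  shows "bounded_cfunctional \<mu>"
  unfolding bounded_cfunctional_def
proof (intro conjI allI bounded_linear_intro[where K=K])
  show "\<mu> (r *\<^sub>R x) = r *\<^sub>R \<mu> x" for r x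
    using assms(2)[of "complex_of_real r" x] by (simp add: scaleR_scaleC scaleR_conv_of_real)
qed (rule assms)+

lemma bounded_cfunctional_sum:
  assumes "\<And>i. i \<in> I \<Longrightarrow> bounded_cfunctional (\<mu> i)"
  shows "bounded_cfunctional (\<lambda>x. \<Sum>i\<in>I. a i * \<mu> i x)"
  unfolding bounded_cfunctional_def
proof (intro conjI allI bounded_linear_sum bounded_linear_const_mult)
  show "(\<Sum>i\<in>I. a i * \<mu> i (c *\<^sub>C x)) = c * (\<Sum>i\<in>I. a i * \<mu> i x)" for c x
    unfolding sum_distrib_left using assms
    by (intro sum.cong) (simp_all add: bounded_cfunctional_def)
qed (use assms in \<open>simp add: bounded_cfunctional_def\<close>)

lemma bounded_clinearI:
  assumes "\<And>x y. T (x + y) = T x + T y" "\<And>c x. T (c *\<^sub>C x) = c *\<^sub>C T x"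
    and "\<And>x. norm (T x) \<le> norm x * K"
  shows "bounded_clinear T"
  unfolding bounded_clinear_def
  using assms by (auto intro!: bounded_linear_intro[where K=K] simp: scaleR_scaleC)

lemma range_clinear_span:
  assumes "bounded_clinear S"
  shows "complex_vector.span (range S) = range S"
proof -
  have "complex_vector.subspace (range S)"
    unfolding complex_vector.subspace_def
  proof (intro conjI ballI allI)
    interpret bounded_linear S using assms by (simp add: bounded_clinear_def)
    show "0 \<in> range S" using zero by (metis rangeI)
    show "x + y \<in> range S" if "x \<in> range S" "y \<in> range S" for x y
      using that add by (metis (no_types, lifting) imageE rangeI)
    show "c *\<^sub>C x \<in> range S" if "x \<in> range S" for c x
      using that assms by (metis (no_types, lifting) bounded_clinear_def imageE rangeI)
  qed
  then show ?thesis by (simp add: complex_vector.span_eq_iff)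
qed

text \<open>If the range of \<open>S\<close> together with a finite set \<open>B\<close> spans, then by Baire's theorem the vectors
  \<open>S x + \<Sum>b. c\<^sub>b b\<close> with bounded \<open>x\<close> and \<open>c\<close> are dense in some ball. Among \<open>card B + 1\<close> functionals
  there is a combination that vanishes on \<open>B\<close>; its norm is then controlled by its values on the
  range of \<open>S\<close>. So linearly independent functionals that almost annihilate the range disprove finite
  codimension.\<close>

lemma lower_semi_Fredholm_functional_bound:
  fixes S :: "'a::complex_banach \<Rightarrow> 'a"
  assumes S: "bounded_clinear S" and lsf: "lower_semi_Fredholm S"
  shows "\<exists>C\<ge>0. \<exists>k::nat. \<forall>\<mu> \<epsilon>. (\<forall>i\<le>k. bounded_cfunctional (\<mu> i)) \<longrightarrow>
       (\<forall>i\<le>k. \<forall>x. cmod (\<mu> i (S x)) \<le> \<epsilon> * norm x) \<longrightarrow>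
       (\<exists>a. (\<forall>i\<le>k. cmod (a i) \<le> 1) \<and> (\<exists>i\<le>k. cmod (a i) = 1) \<and>
         (\<forall>x. cmod (\<Sum>i\<le>k. a i * \<mu> i x) \<le> C * \<epsilon> * norm x))"
proof -
  obtain B where B: "finite B" "complex_vector.span (range S \<union> B) = UNIV"
    using lsf unfolding lower_semi_Fredholm_def finite_ccodim_def by blast
  interpret S: bounded_linear S using S by (simp add: bounded_clinear_def)
  define k where "k = card B"
  \<comment> \<open>The bounded parts of the sum of the range and the complement; Baire applies to them.\<close>
  define D where "D n = {S x + (\<Sum>b\<in>B. c b *\<^sub>C b) | x c.
      norm x \<le> real n \<and> (\<forall>b\<in>B. cmod (c b) \<le> real n)}" for n
  have "y \<in> (\<Union>n. D n)" for y
  proof -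
    have "y \<in> complex_vector.span (range S \<union> B)" using B by simp
    then obtain u v where y: "y = u + v" "u \<in> range S" "v \<in> complex_vector.span B"
      unfolding complex_vector.span_Un range_clinear_span[OF S] by blast
    then obtain x c where xc: "u = S x" "v = (\<Sum>b\<in>B. c b *\<^sub>C b)"
      by (auto simp: complex_vector.span_finite[OF B(1)])
    obtain n where n: "norm x + (\<Sum>b\<in>B. cmod (c b)) \<le> real n"
      using real_arch_simple by blast
    have "cmod (c b) \<le> (\<Sum>b\<in>B. cmod (c b))" if "b \<in> B" for b
      by (rule member_le_sum) (use that B in auto)
    moreover have "(\<Sum>b\<in>B. cmod (c b)) \<ge> 0" by (simp add: sum_nonneg)
    ultimately have "norm x \<le> real n \<and> (\<forall>b\<in>B. cmod (c b) \<le> real n)"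
      using n norm_ge_zero[of x] by (smt (verit))
    then show ?thesis unfolding D_def y xc by blast
  qed
  then have "UNIV = (\<Union>n. D n)" by blast
  then obtain n y d where d: "d > 0" "ball y d \<subseteq> closure (D n)"
    using Baire_ball_subset_closure[of UNIV D] by (metis Int_UNIV_right closed_UNIV empty_not_UNIV)
  define C where "C = 4 * real (Suc k) * real n / d"
  show ?thesis
  proof (intro exI[of _ C] exI[of _ k] conjI allI impI)
    show "C \<ge> 0" using d by (simp add: C_def)
    fix \<mu> :: "nat \<Rightarrow> 'a \<Rightarrow> complex" and \<epsilon> :: real
    assume "\<forall>i\<le>k. bounded_cfunctional (\<mu> i)" "\<forall>i\<le>k. \<forall>x. cmod (\<mu> i (S x)) \<le> \<epsilon> * norm x"
    then have \<mu>: "\<And>i. i \<le> k \<Longrightarrow> bounded_cfunctional (\<mu> i)"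
      and le: "\<And>i x. i \<le> k \<Longrightarrow> cmod (\<mu> i (S x)) \<le> \<epsilon> * norm x" by blast+
    obtain a where a: "\<And>i. i \<le> k \<Longrightarrow> cmod (a i) \<le> 1" "\<exists>i\<le>k. cmod (a i) = 1"
      "\<And>b. b \<in> B \<Longrightarrow> (\<Sum>i\<le>k. a i * \<mu> i b) = 0"
      using homogeneous_system_normalised[of B k \<mu>] B k_def by blast
    define \<nu> where "\<nu> x = (\<Sum>i\<le>k. a i * \<mu> i x)" for x
    have \<nu>f: "bounded_cfunctional \<nu>"
      unfolding \<nu>_def by (rule bounded_cfunctional_sum) (use \<mu> in auto)
    then interpret N: bounded_linear \<nu> by (simp add: bounded_cfunctional_def)
    have hom: "\<nu> (c *\<^sub>C x) = c * \<nu> x" for c x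
      using \<nu>f unfolding bounded_cfunctional_def by blast
    have \<nu>S: "cmod (\<nu> (S x)) \<le> real (Suc k) * \<epsilon> * norm x" for x
    proof -
      have "cmod (\<nu> (S x)) \<le> (\<Sum>i\<le>k. cmod (a i) * cmod (\<mu> i (S x)))"
        unfolding \<nu>_def by (rule order_trans[OF norm_sum]) (simp add: norm_mult)
      also have "\<dots> \<le> (\<Sum>i\<le>k. 1 * (\<epsilon> * norm x))"
        using a(1) le by (intro sum_mono mult_mono) auto
      finally show ?thesis by simp
    qed
    have eps: "\<epsilon> * norm x \<ge> 0" for x :: 'a
      using le[of 0 x] norm_ge_zero order_trans by blast
    have onD: "cmod (\<nu> v) \<le> real (Suc k) * (\<bar>\<epsilon>\<bar> * real n)" if v: "v \<in> D n" for v
    proof -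
      obtain x c where xc: "v = S x + (\<Sum>b\<in>B. c b *\<^sub>C b)" "norm x \<le> real n"
        using v unfolding D_def by blast
      have "\<nu> (\<Sum>b\<in>B. c b *\<^sub>C b) = (\<Sum>b\<in>B. c b * \<nu> b)"
        by (simp only: N.sum hom)
      also have "\<dots> = 0" using a(3) by (simp add: \<nu>_def)
      finally have "\<nu> v = \<nu> (S x)" by (simp add: xc N.add)
      moreover have "\<epsilon> * norm x \<le> \<bar>\<epsilon>\<bar> * real n"
        using xc(2) by (intro mult_mono) auto
      ultimately show ?thesis
        using \<nu>S[of x] by (smt (verit) mult.assoc mult_left_mono of_nat_0_le_iff)
    qed
    have onball: "cmod (\<nu> v) \<le> real (Suc k) * (\<bar>\<epsilon>\<bar> * real n)" if "v \<in> ball y d" for v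
    proof -
      have "v \<in> closure (D n)" using that d by blast
      then show ?thesis
        by (rule continuous_le_on_closure[where f="\<lambda>v. cmod (\<nu> v)", rotated])
          (use onD in \<open>auto intro!: continuous_intros N.continuous_on\<close>)
    qed
    have "cmod (\<nu> x) \<le> C * \<epsilon> * norm x" for x
    proof (cases "x = 0")
      case True
      then show ?thesis by simp
    next
      case False
      then have nx: "norm x > 0" by simp
      have e0: "\<epsilon> \<ge> 0" using eps[of x] nx by (simp add: zero_le_mult_iff)
      define s where "s = d / (2 * norm x)"
      have s: "s > 0" using d nx by (simp add: s_def)
      have "norm (s *\<^sub>R x) < d" using d nx s by (simp add: s_def)
      then have "y + s *\<^sub>R x \<in> ball y d" "y \<in> ball y d" using d by (auto simp: dist_norm)
      from onball[OF this(1)] onball[OF this(2)]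
      have "cmod (\<nu> (y + s *\<^sub>R x) - \<nu> y) \<le> 2 * (real (Suc k) * (\<epsilon> * real n))"
        using e0 norm_triangle_ineq4[of "\<nu> (y + s *\<^sub>R x)" "\<nu> y"] by simp
      then have "s * cmod (\<nu> x) \<le> 2 * (real (Suc k) * (\<epsilon> * real n))"
        using s by (simp add: N.add N.scaleR)
      then have "cmod (\<nu> x) \<le> 2 * (real (Suc k) * (\<epsilon> * real n)) / s"
        using s by (simp add: field_simps)
      also have "\<dots> = C * \<epsilon> * norm x"
        using nx d by (simp add: C_def s_def field_simps)
      finally show ?thesis .
    qed
    then show "\<exists>a. (\<forall>i\<le>k. cmod (a i) \<le> 1) \<and> (\<exists>i\<le>k. cmod (a i) = 1) \<and>
         (\<forall>x. cmod (\<Sum>i\<le>k. a i * \<mu> i x) \<le> C * \<epsilon> * norm x)"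
      using a(1,2) unfolding \<nu>_def by blast
  qed
qed

text \<open>The open mapping theorem for a map onto its closed range: Baire's theorem gives preimages up to
  half of the norm, and the successive corrections form a convergent series.\<close>

lemma closed_range_imp_preimage_bound:
  fixes S :: "'a::banach \<Rightarrow> 'b::banach"
  assumes "bounded_linear S" "closed (range S)"
  obtains C where "C \<ge> 0" "\<And>v. v \<in> range S \<Longrightarrow> \<exists>x. S x = v \<and> norm x \<le> C * norm v"
proof -
  interpret S: bounded_linear S by fact
  have ne: "range S \<noteq> {}" by simp
  have eq: "range S = (\<Union>n. S ` cball 0 (real n))"
  proof (intro equalityI subsetI)
    fix v assume "v \<in> range S"
    then obtain x where "v = S x" by blast
    moreover obtain n where "norm x \<le> real n" using real_arch_simple by blast
    ultimately show "v \<in> (\<Union>n. S ` cball 0 (real n))" by force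
  qed auto
  obtain n y d where y: "y \<in> range S" "d > 0" "ball y d \<inter> range S \<subseteq> closure (S ` cball 0 (real n))"
    by (rule Baire_ball_subset_closure[OF assms(2) ne eq])
  define M where "M = 4 * real n / d"
  \<comment> \<open>A small multiple of the vector is a difference of two elements of the closure.\<close>
  have half: "\<exists>x. norm x \<le> M * norm v \<and> norm (v - S x) \<le> norm v / 2" if v: "v \<in> range S" for v
  proof (cases "v = 0")
    case True
    then show ?thesis by (intro exI[of _ 0]) (simp add: S.zero)
  next
    case False
    then have nv: "norm v > 0" by simp
    define s where "s = d / (2 * norm v)"
    have s: "s > 0" using y nv by (simp add: s_def)
    have "norm (s *\<^sub>R v) < d" using y nv s by (simp add: s_def)
    then have "y + s *\<^sub>R v \<in> ball y d" "y \<in> ball y d"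
      using y by (auto simp: dist_norm)
    moreover have "y + s *\<^sub>R v \<in> range S"
    proof -
      obtain a b where "y = S a" "v = S b" using y(1) v by blast
      then have "y + s *\<^sub>R v = S (a + s *\<^sub>R b)" by (simp add: S.add S.scaleR)
      then show ?thesis by simp
    qed
    ultimately have cl: "y + s *\<^sub>R v \<in> closure (S ` cball 0 (real n))" "y \<in> closure (S ` cball 0 (real n))"
      using y by blast+
    define e where "e = s * norm v / 4"
    have e: "e > 0" using s nv by (simp add: e_def)
    obtain x1 x2 where x: "norm x1 \<le> real n" "dist (S x1) (y + s *\<^sub>R v) < e"
      "norm x2 \<le> real n" "dist (S x2) y < e"
      using cl e unfolding closure_approachable by (auto dest!: spec[of _ e])
    define x where "x = (1 / s) *\<^sub>R (x1 - x2)"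
    have "norm (x1 - x2) \<le> 2 * real n"
      using x norm_triangle_ineq4[of x1 x2] by linarith
    then have "norm (x1 - x2) / s \<le> 2 * real n / s"
      using s by (intro divide_right_mono) auto
    moreover have "2 * real n / s = M * norm v"
      using nv y by (simp add: M_def s_def field_simps)
    moreover have "norm x = norm (x1 - x2) / s" using s by (simp add: x_def)
    ultimately have "norm x \<le> M * norm v" by simp
    moreover have "norm (s *\<^sub>R (v - S x)) \<le> 2 * e"
    proof -
      have "s *\<^sub>R (v - S x) = (S x2 - y) - (S x1 - (y + s *\<^sub>R v))"
        using s by (simp add: x_def S.scaleR S.diff algebra_simps)
      then show ?thesis
        using x(2,4) norm_triangle_ineq4[of "S x2 - y" "S x1 - (y + s *\<^sub>R v)"] by (simp add: dist_norm)
    qed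
    then have "norm (v - S x) \<le> norm v / 2"
      using s unfolding e_def norm_scaleR by simp
    ultimately show ?thesis by blast
  qed
  then obtain X where X: "\<And>v. v \<in> range S \<Longrightarrow> norm (X v) \<le> M * norm v"
    "\<And>v. v \<in> range S \<Longrightarrow> norm (v - S (X v)) \<le> norm v / 2"
    by metis
  have M0: "M \<ge> 0" using y by (simp add: M_def)
  show ?thesis
  proof (rule that[of "2 * M"])
    show "2 * M \<ge> 0" using M0 by simp
    fix v assume v: "v \<in> range S"
    \<comment> \<open>The remainders after successive corrections.\<close>
    define V where "V = rec_nat v (\<lambda>_ u. u - S (X u))"
    have V0: "V 0 = v" and VS: "V (Suc j) = V j - S (X (V j))" for j
      by (simp_all add: V_def)
    have Vr: "V j \<in> range S" for j
    proof (induction j)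
      case (Suc j)
      then show ?case unfolding VS by (metis S.diff imageE rangeI)
    qed (simp add: V0 v)
    have Vn: "norm (V j) \<le> norm v * (1/2) ^ j" for j
    proof (induction j)
      case (Suc j)
      then show ?case unfolding VS using X(2)[OF Vr[of j]] by simp
    qed (simp add: V0)
    have bd: "norm (X (V j)) \<le> M * norm v * (1/2) ^ j" for j
      using X(1)[OF Vr[of j]] mult_left_mono[OF Vn[of j] M0] by (simp add: mult.assoc)
    have geo: "(\<lambda>j. M * norm v * (1/2) ^ j) sums (M * norm v * 2)"
      using sums_mult[OF geometric_sums[of "1/2 :: real"], of "M * norm v"] by simp
    have sm: "summable (\<lambda>j. norm (X (V j)))"
      by (rule summable_comparison_test'[OF sums_summable[OF geo], of 0]) (use bd in auto)
    define x where "x = (\<Sum>j. X (V j))"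
    have "norm x \<le> M * norm v * 2"
      unfolding x_def
      by (rule order_trans[OF summable_norm[OF sm]])
        (use suminf_le[OF bd sm sums_summable[OF geo]] sums_unique[OF geo] in simp)
    moreover have "S x = v"
    proof -
      have "(\<lambda>n. \<Sum>j<n. S (X (V j))) \<longlonglongrightarrow> S x"
        using S.sums[OF summable_sums[OF summable_norm_cancel[OF sm]]]
        by (simp add: sums_def x_def)
      moreover have "(\<Sum>j<n. S (X (V j))) = v - V n" for n
        by (induction n) (simp_all add: V0 VS)
      moreover have "V \<longlonglongrightarrow> 0"
        by (rule Lim_null_comparison[where g="\<lambda>j. norm v * (1/2) ^ j"])
          (use Vn in \<open>auto intro!: tendsto_mult_right_zero LIMSEQ_power_zero\<close>)
      then have "(\<lambda>n. v - V n) \<longlonglongrightarrow> v"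
        using tendsto_diff[OF tendsto_const[of v]] by fastforce
      ultimately show ?thesis using LIMSEQ_unique by simp
    qed
    ultimately show "\<exists>x. S x = v \<and> norm x \<le> 2 * M * norm v"
      by (intro exI[of _ x]) (simp add: mult_ac)
  qed
qed

text \<open>The dual counterpart: a vector \<open>x\<close> has distance at most \<open>C |S x|\<close> from the kernel, and any
  \<open>k + 1\<close> vectors of a \<open>k\<close>-dimensional kernel are dependent.\<close>

lemma upper_semi_Fredholm_vector_bound:
  fixes S :: "'a::complex_banach \<Rightarrow> 'a"
  assumes S: "bounded_clinear S" and usf: "upper_semi_Fredholm S"
  shows "\<exists>C\<ge>0. \<exists>k::nat. \<forall>x. \<exists>a. (\<forall>i\<le>k. cmod (a i) \<le> 1) \<and> (\<exists>i\<le>k. cmod (a i) = 1) \<and>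
         norm (\<Sum>i\<le>k. a i *\<^sub>C x i) \<le> C * (\<Sum>i\<le>k. norm (S (x i)))"
proof -
  interpret S: bounded_linear S using S by (simp add: bounded_clinear_def)
  obtain C where C: "C \<ge> 0" "\<And>v. v \<in> range S \<Longrightarrow> \<exists>x. S x = v \<and> norm x \<le> C * norm v"
    using closed_range_imp_preimage_bound[OF S.bounded_linear_axioms] usf
    unfolding upper_semi_Fredholm_def by blast
  obtain B where B: "finite B" "{x. S x = 0} \<subseteq> complex_vector.span B"
    using usf unfolding upper_semi_Fredholm_def finite_cdim_def by blast
  define k where "k = card B"
  show ?thesis
  proof (intro exI[of _ C] exI[of _ k] conjI allI)
    show "C \<ge> 0" by (fact C(1))
    fix x :: "nat \<Rightarrow> 'a"
    have "\<forall>i. \<exists>h. S h = S (x i) \<and> norm h \<le> C * norm (S (x i))"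
      using C(2) by blast
    then obtain h where h: "\<And>i. S (h i) = S (x i)" "\<And>i. norm (h i) \<le> C * norm (S (x i))"
      by metis
    have "x i - h i \<in> complex_vector.span B" for i
      using B(2) h(1)[of i] by (auto simp: S.diff)
    then have "\<forall>i. \<exists>c. x i - h i = (\<Sum>b\<in>B. c b *\<^sub>C b)"
      by (auto simp: complex_vector.span_finite[OF B(1)])
    then obtain c where c: "\<And>i. x i - h i = (\<Sum>b\<in>B. c i b *\<^sub>C b)"
      by metis
    obtain a where a: "\<And>i. i \<le> k \<Longrightarrow> cmod (a i) \<le> 1" "\<exists>i\<le>k. cmod (a i) = 1"
      "\<And>b. b \<in> B \<Longrightarrow> (\<Sum>i\<le>k. a i * c i b) = 0"
      using homogeneous_system_normalised[of B k c] B k_def by blast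
    have "(\<Sum>i\<le>k. a i *\<^sub>C (x i - h i)) = (\<Sum>i\<le>k. \<Sum>b\<in>B. (a i * c i b) *\<^sub>C b)"
      by (simp add: c complex_vector.scale_sum_right)
    also have "\<dots> = (\<Sum>b\<in>B. (\<Sum>i\<le>k. a i * c i b) *\<^sub>C b)"
      by (subst sum.swap) (simp add: complex_vector.scale_sum_left)
    also have "\<dots> = 0" using a(3) by simp
    finally have "(\<Sum>i\<le>k. a i *\<^sub>C x i) = (\<Sum>i\<le>k. a i *\<^sub>C h i)"
      by (simp add: complex_vector.scale_right_diff_distrib sum_subtractf)
    also have "norm \<dots> \<le> (\<Sum>i\<le>k. norm (a i *\<^sub>C h i))" by (rule norm_sum)
    also have "\<dots> \<le> (\<Sum>i\<le>k. 1 * (C * norm (S (x i))))"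
      unfolding norm_scaleC using a(1) h(2) C(1) by (intro sum_mono mult_mono) auto
    finally show "\<exists>a. (\<forall>i\<le>k. cmod (a i) \<le> 1) \<and> (\<exists>i\<le>k. cmod (a i) = 1) \<and>
         norm (\<Sum>i\<le>k. a i *\<^sub>C x i) \<le> C * (\<Sum>i\<le>k. norm (S (x i)))"
      using a(1,2) by (intro exI[of _ a]) (simp add: sum_distrib_left)
  qed
qed

lemma lower_semi_Fredholm_surj: "surj S \<Longrightarrow> lower_semi_Fredholm S"
  unfolding lower_semi_Fredholm_def finite_ccodim_def
  by (intro exI[of _ "{}"]) (simp add: complex_vector.span_UNIV)

lemma bounded_below_imp_upper_semi_Fredholm:
  fixes S :: "'a::complex_banach \<Rightarrow> 'a"
  assumes S: "bounded_clinear S" and c: "c > 0" "\<And>x. c * norm x \<le> norm (S x)"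
  shows "upper_semi_Fredholm S"
  unfolding upper_semi_Fredholm_def
proof
  interpret S: bounded_linear S using S by (simp add: bounded_clinear_def)
  have "complete (range S)"
    by (rule complete_isometric_image[OF c(1) subspace_UNIV S.bounded_linear_axioms])
      (use c(2) in \<open>auto simp: complete_UNIV\<close>)
  then show "closed (range S)" by (rule complete_imp_closed)
  have "x = 0" if "S x = 0" for x
    using c(2)[of x] c(1) that by (simp add: mult_le_0_iff)
  then show "finite_cdim {x. S x = 0}"
    unfolding finite_cdim_def by (intro exI[of _ "{0}"]) (auto simp: complex_vector.span_base)
qed

lemma bounded_clinear_shifted:
  assumes "bounded_clinear T"
  shows "bounded_clinear (shifted \<mu> T)"
proof -
  interpret T: bounded_linear T using assms by (simp add: bounded_clinear_def)
  have bl: "bounded_linear (\<lambda>x. \<mu> *\<^sub>C x)"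
    by (rule bounded_linear_intro[where K="cmod \<mu>"])
      (simp_all add: complex_vector.scale_right_distrib scaleR_scaleC scaleC_scaleC norm_scaleC mult.commute)
  have "bounded_linear (shifted \<mu> T)"
    unfolding shifted_def[abs_def] by (rule bounded_linear_sub[OF bl T.bounded_linear_axioms])
  moreover have "shifted \<mu> T (c *\<^sub>C x) = c *\<^sub>C shifted \<mu> T x" for c x
  proof -
    have "T (c *\<^sub>C x) = c *\<^sub>C T x" using assms unfolding bounded_clinear_def by blast
    then show ?thesis
      by (simp add: shifted_def complex_vector.scale_right_diff_distrib scaleC_scaleC mult.commute)
  qed
  ultimately show ?thesis unfolding bounded_clinear_def by blast
qed

lemma lower_semi_Fredholm_spectrum_subset_spectrum:
  "lower_semi_Fredholm_spectrum T \<subseteq> spectrum T"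
proof
  fix \<mu> assume mu: "\<mu> \<in> lower_semi_Fredholm_spectrum T"
  show "\<mu> \<in> spectrum T"
  proof (rule ccontr)
    assume "\<mu> \<notin> spectrum T"
    then obtain S where "shifted \<mu> T \<circ> S = id" unfolding spectrum_def by blast
    then have "surj (shifted \<mu> T)" by (metis comp_surj surj_id surj_def comp_apply id_apply)
    then show False
      using mu lower_semi_Fredholm_surj unfolding lower_semi_Fredholm_spectrum_def by blast
  qed
qed

lemma semi_Fredholm_spectrum_subset_lower:
  "semi_Fredholm_spectrum T \<subseteq> lower_semi_Fredholm_spectrum T"
  unfolding semi_Fredholm_spectrum_def lower_semi_Fredholm_spectrum_def semi_Fredholm_def by blast

lemma bounded_below_notin_approx_point_spectrum:
  assumes c: "c > 0" "\<And>x. c * norm x \<le> norm (shifted \<mu> T x)"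
  shows "\<mu> \<notin> approx_point_spectrum T"
proof
  assume "\<mu> \<in> approx_point_spectrum T"
  then obtain x where x: "\<And>n. norm (x n) = 1" "(\<lambda>n. T (x n) - \<mu> *\<^sub>C x n) \<longlonglongrightarrow> 0"
    unfolding approx_point_spectrum_def by blast
  have "c \<le> norm (T (x n) - \<mu> *\<^sub>C x n)" for n
    using c(2)[of "x n"] x(1)[of n] by (simp add: shifted_def norm_minus_commute)
  then have "c \<le> 0"
    using tendsto_norm[OF x(2)] by (intro tendsto_lowerbound[where F=sequentially]) auto
  then show False using c(1) by simp
qed

lemma approx_point_spectrum_disjoint_resolvent:
  assumes "\<mu> \<notin> spectrum T"
  shows "\<mu> \<notin> approx_point_spectrum T"
proof -
  obtain S where S: "bounded_clinear S" "S \<circ> shifted \<mu> T = id"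
    using assms unfolding spectrum_def by blast
  then obtain K where K: "K > 0" "\<And>x. norm (S x) \<le> norm x * K"
    using bounded_linear.pos_bounded unfolding bounded_clinear_def by blast
  have "(1 / K) * norm x \<le> norm (shifted \<mu> T x)" for x
    using K(2)[of "shifted \<mu> T x"] K(1) fun_cong[OF S(2), of x] by (simp add: field_simps)
  with K(1) show ?thesis by (intro bounded_below_notin_approx_point_spectrum[of "1 / K"]) auto
qed

lemma approx_point_spectrumI:
  assumes "\<And>e. e > 0 \<Longrightarrow> \<exists>x. norm x \<ge> 1 \<and> norm (shifted \<mu> T x) \<le> e" and T: "bounded_clinear T"
  shows "\<mu> \<in> approx_point_spectrum T"
proof -
  have "\<forall>n. \<exists>x. norm x = 1 \<and> norm (T x - \<mu> *\<^sub>C x) \<le> 1 / real (Suc n)"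
  proof
    fix n
    obtain x where x: "norm x \<ge> 1" "norm (shifted \<mu> T x) \<le> 1 / real (Suc n)"
      using assms(1)[of "1 / real (Suc n)"] by auto
    interpret S: bounded_linear "shifted \<mu> T"
      using bounded_clinear_shifted[OF T] by (simp add: bounded_clinear_def)
    define y where "y = (1 / norm x) *\<^sub>R x"
    have "norm y = 1" using x(1) by (auto simp: y_def)
    moreover have "norm (shifted \<mu> T y) \<le> norm (shifted \<mu> T x)"
      using x(1) by (simp add: y_def S.scaleR divide_le_eq mult_le_cancel_left1)
    ultimately show "\<exists>x. norm x = 1 \<and> norm (T x - \<mu> *\<^sub>C x) \<le> 1 / real (Suc n)"
      using x(2) by (intro exI[of _ y]) (simp add: shifted_def norm_minus_commute)
  qed
  then obtain x where x: "\<And>n. norm (x n) = 1" "\<And>n. norm (T (x n) - \<mu> *\<^sub>C x n) \<le> 1 / real (Suc n)"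
    by metis
  have "(\<lambda>n. T (x n) - \<mu> *\<^sub>C x n) \<longlonglongrightarrow> 0"
    by (rule Lim_null_comparison[OF always_eventually LIMSEQ_inverse_real_of_nat])
      (use x(2) in \<open>simp add: inverse_eq_divide\<close>)
  then show ?thesis unfolding approx_point_spectrum_def using x(1) by blast
qed

text \<open>Geometric decay of the powers, rather than a bound on the norm of \<open>V\<close> itself, is what the growth
  estimates for cocycles provide.\<close>

lemma Neumann_series_inverse:
  fixes V :: "'a::complex_banach \<Rightarrow> 'a"
  assumes V: "bounded_clinear V" and C: "C \<ge> 0" and q: "0 \<le> q" "q < 1"
    and pow: "\<And>n x. norm ((V ^^ n) x) \<le> C * q ^ n * norm x"
  obtains S where "bounded_clinear S" "\<And>x. S (x - V x) = x" "\<And>x. S x - V (S x) = x"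
proof -
  interpret V: bounded_linear V using V by (simp add: bounded_clinear_def)
  have hom: "V (c *\<^sub>C x) = c *\<^sub>C V x" for c x
    using V unfolding bounded_clinear_def by blast
  have geo: "(\<lambda>n. C * q ^ n * norm x) sums (norm x * (C / (1 - q)))" for x :: 'a
    using sums_mult[OF geometric_sums[of q], of "C * norm x"] q
    by (simp add: mult_ac divide_inverse)
  have smn: "summable (\<lambda>n. norm ((V ^^ n) x))" for x
    by (rule summable_comparison_test'[OF sums_summable[OF geo[of x]], of 0]) (use pow in auto)
  have sm: "summable (\<lambda>n. (V ^^ n) x)" for x
    using smn by (rule summable_norm_cancel)
  define S where "S x = (\<Sum>n. (V ^^ n) x)" for x
  have addn: "(V ^^ n) (x + y) = (V ^^ n) x + (V ^^ n) y" for n x y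
    by (induction n) (simp_all add: V.add)
  have scn: "(V ^^ n) (c *\<^sub>C x) = c *\<^sub>C (V ^^ n) x" for n c x
    by (induction n) (simp_all add: hom)
  have sc_bl: "bounded_linear (\<lambda>x :: 'a. c *\<^sub>C x)" for c
    by (rule bounded_linear_intro[where K="cmod c"])
      (simp_all add: complex_vector.scale_right_distrib scaleR_scaleC scaleC_scaleC norm_scaleC mult.commute)
  have Sadd: "S (x + y) = S x + S y" for x y
    unfolding S_def addn by (rule suminf_add[OF sm sm, symmetric])
  have Ssc: "S (c *\<^sub>C x) = c *\<^sub>C S x" for c x
    unfolding S_def scn by (rule bounded_linear.suminf[OF sc_bl sm, symmetric])
  have Sn: "norm (S x) \<le> norm x * (C / (1 - q))" for x
    unfolding S_def
    by (rule order_trans[OF summable_norm[OF smn]])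
      (use suminf_le[OF pow smn sums_summable[OF geo]] sums_unique[OF geo] in metis)
  have Sb: "bounded_clinear S" by (rule bounded_clinearI[OF Sadd Ssc Sn])
  then interpret S: bounded_linear S by (simp add: bounded_clinear_def)
  have SV: "S x = x + S (V x)" for x
    unfolding S_def using suminf_split_initial_segment[OF sm[of x], of 1]
    by (simp add: funpow_swap1)
  have VS: "V (S x) = S (V x)" for x
    unfolding S_def by (subst V.suminf[OF sm]) (simp add: funpow_swap1)
  show ?thesis
  proof (rule that[OF Sb])
    show "S (x - V x) = x" for x using SV[of x] by (simp add: S.diff)
    show "S x - V (S x) = x" for x unfolding VS by (subst SV) simp
  qed
qed

text \<open>The \<open>\<tau> n\<close> form a chain of preimages under the transpose of \<open>T\<close> that ends at a functional
  annihilated by it. A transpose maps the series \<open>\<Sum>n. \<mu>\<^sup>n \<tau>\<^sub>n\<close> to \<open>\<mu>\<close> times itself, wherever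
  it converges.\<close>

lemma bounded_cfunctional_backward_chain:
  fixes T :: "'a::complex_banach \<Rightarrow> 'a"
  assumes T: "bounded_clinear T" and \<tau>: "\<And>n. bounded_cfunctional (\<tau> n)"
    and \<tau>0: "\<And>x. \<tau> 0 (T x) = 0" and \<tau>S: "\<And>n x. \<tau> (Suc n) (T x) = \<tau> n x"
    and bd: "\<And>n x. cmod (\<tau> n x) \<le> C * (1 / \<rho>) ^ n * norm x" and mu: "cmod \<mu> < \<rho>"
  shows "bounded_cfunctional (\<lambda>x. \<Sum>n. \<mu> ^ n * \<tau> n x)"
    and "(\<Sum>n. \<mu> ^ n * \<tau> n (shifted \<mu> T x)) = 0"
    and "summable (\<lambda>n. \<mu> ^ n * \<tau> n x)"
proof -
  have q: "0 \<le> cmod \<mu> / \<rho>" "cmod \<mu> / \<rho> < 1"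
    using mu norm_ge_zero[of \<mu>] by (auto intro!: divide_nonneg_nonneg simp: divide_less_eq simp del: norm_ge_zero)
  have le: "norm (\<mu> ^ n * \<tau> n x) \<le> C * norm x * (cmod \<mu> / \<rho>) ^ n" for n x
    using mult_left_mono[OF bd[of n x], of "cmod \<mu> ^ n"]
    by (simp add: norm_mult norm_power power_divide mult_ac)
  have geo: "(\<lambda>n. C * norm x * (cmod \<mu> / \<rho>) ^ n) sums (norm x * (C / (1 - cmod \<mu> / \<rho>)))" for x :: 'a
    using sums_mult[OF geometric_sums[of "cmod \<mu> / \<rho>"], of "C * norm x"] q by (simp add: mult_ac)
  have smn: "summable (\<lambda>n. norm (\<mu> ^ n * \<tau> n x))" for x
    by (rule summable_comparison_test'[OF sums_summable[OF geo[of x]], of 0]) (use le in auto)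
  have sm: "summable (\<lambda>n. \<mu> ^ n * \<tau> n x)" for x
    using smn by (rule summable_norm_cancel)
  then show "summable (\<lambda>n. \<mu> ^ n * \<tau> n x)" .
  have add: "\<tau> n (x + y) = \<tau> n x + \<tau> n y" and sc: "\<tau> n (c *\<^sub>C x) = c * \<tau> n x" for n x y c
  proof -
    interpret bounded_linear "\<tau> n" using \<tau> by (simp add: bounded_cfunctional_def)
    show "\<tau> n (x + y) = \<tau> n x + \<tau> n y" by (rule add)
    show "\<tau> n (c *\<^sub>C x) = c * \<tau> n x" using \<tau>[of n] unfolding bounded_cfunctional_def by blast
  qed
  show "bounded_cfunctional (\<lambda>x. \<Sum>n. \<mu> ^ n * \<tau> n x)"
  proof (rule bounded_cfunctionalI)
    show "(\<Sum>n. \<mu> ^ n * \<tau> n (x + y)) = (\<Sum>n. \<mu> ^ n * \<tau> n x) + (\<Sum>n. \<mu> ^ n * \<tau> n y)" for x y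
      unfolding add distrib_left by (rule suminf_add[OF sm sm, symmetric])
    show "(\<Sum>n. \<mu> ^ n * \<tau> n (c *\<^sub>C x)) = c * (\<Sum>n. \<mu> ^ n * \<tau> n x)" for c x
      unfolding sc by (subst suminf_mult[OF sm, symmetric]) (simp add: mult_ac)
    show "cmod (\<Sum>n. \<mu> ^ n * \<tau> n x) \<le> norm x * (C / (1 - cmod \<mu> / \<rho>))" for x
      by (rule order_trans[OF summable_norm[OF smn]])
        (use suminf_le[OF le smn sums_summable[OF geo]] sums_unique[OF geo] in metis)
  qed
  have diff: "\<tau> n (shifted \<mu> T x) = \<mu> * \<tau> n x - \<tau> n (T x)" for n x
  proof -
    interpret bounded_linear "\<tau> n" using \<tau> by (simp add: bounded_cfunctional_def)
    show ?thesis by (simp add: shifted_def diff sc)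
  qed
  have "(\<Sum>n. \<mu> ^ n * \<tau> n (T x)) = (\<Sum>n. \<mu> ^ Suc n * \<tau> (Suc n) (T x)) + \<mu> ^ 0 * \<tau> 0 (T x)"
    using suminf_split_head[OF sm[of "T x"]] by simp
  also have "\<dots> = (\<Sum>n. \<mu> * (\<mu> ^ n * \<tau> n x))"
    by (simp add: \<tau>0 \<tau>S mult_ac)
  also have "\<dots> = \<mu> * (\<Sum>n. \<mu> ^ n * \<tau> n x)" by (rule suminf_mult[OF sm])
  finally have T1: "(\<Sum>n. \<mu> ^ n * \<tau> n (T x)) = \<mu> * (\<Sum>n. \<mu> ^ n * \<tau> n x)" .
  have "(\<Sum>n. \<mu> ^ n * \<tau> n (shifted \<mu> T x)) = (\<Sum>n. \<mu> * (\<mu> ^ n * \<tau> n x) - \<mu> ^ n * \<tau> n (T x))"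
    by (simp add: diff algebra_simps)
  also have "\<dots> = (\<Sum>n. \<mu> * (\<mu> ^ n * \<tau> n x)) - (\<Sum>n. \<mu> ^ n * \<tau> n (T x))"
    by (rule suminf_diff[OF summable_mult[OF sm] sm, symmetric])
  also have "\<dots> = 0" by (simp add: suminf_mult[OF sm] T1)
  finally show "(\<Sum>n. \<mu> ^ n * \<tau> n (shifted \<mu> T x)) = 0" .
qed

text \<open>The sequences \<open>F\<close> separate the functionals in the limit, so no nontrivial combination of them
  can vanish.\<close>

lemma not_lower_semi_Fredholm_if_independent_functionals:
  fixes S :: "'a::complex_banach \<Rightarrow> 'a"
  assumes S: "bounded_clinear S"
    and ind: "\<And>k::nat. \<exists>\<nu>. (\<forall>i\<le>k. bounded_cfunctional (\<nu> i) \<and> (\<forall>x. \<nu> i (S x) = 0)) \<and>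
      (\<forall>j\<le>k. \<exists>F L. L \<noteq> 0 \<and> (\<forall>i\<le>k. (\<lambda>m::nat. \<nu> i (F m)) \<longlonglongrightarrow> (if i = j then L else 0)))"
  shows "\<not> lower_semi_Fredholm S"
proof
  assume "lower_semi_Fredholm S"
  from lower_semi_Fredholm_functional_bound[OF S this]
  obtain C :: real and k :: nat where C: "C \<ge> 0"
    "\<forall>\<nu> \<epsilon>. (\<forall>i\<le>k. bounded_cfunctional (\<nu> i)) \<longrightarrow> (\<forall>i\<le>k. \<forall>x. cmod (\<nu> i (S x)) \<le> \<epsilon> * norm x) \<longrightarrow>
       (\<exists>a. (\<forall>i\<le>k. cmod (a i) \<le> 1) \<and> (\<exists>i\<le>k. cmod (a i) = 1) \<and>
         (\<forall>x. cmod (\<Sum>i\<le>k. a i * \<nu> i x) \<le> C * \<epsilon> * norm x))"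
    by (elim exE conjE) (rule that)
  obtain \<nu> where \<nu>: "\<And>i. i \<le> k \<Longrightarrow> bounded_cfunctional (\<nu> i)" "\<And>i x. i \<le> k \<Longrightarrow> \<nu> i (S x) = 0"
    and test: "\<And>j. j \<le> k \<Longrightarrow> \<exists>F L. L \<noteq> 0 \<and> (\<forall>i\<le>k. (\<lambda>m::nat. \<nu> i (F m)) \<longlonglongrightarrow> (if i = j then L else 0))"
    using ind[of k] by blast
  have "cmod (\<nu> i (S x)) \<le> 0 * norm x" if "i \<le> k" for i x using \<nu>(2)[OF that] by simp
  then obtain a where a: "\<exists>i\<le>k. cmod (a i) = 1" "\<And>x. cmod (\<Sum>i\<le>k. a i * \<nu> i x) \<le> C * 0 * norm x"
    using C(2)[rule_format, of \<nu> 0] \<nu>(1) by blast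
  then obtain j where j: "j \<le> k" "cmod (a j) = 1" by blast
  obtain F L where F: "L \<noteq> 0" "\<And>i. i \<le> k \<Longrightarrow> (\<lambda>m::nat. \<nu> i (F m)) \<longlonglongrightarrow> (if i = j then L else 0)"
    using test[OF j(1)] by blast
  have "(\<lambda>m. \<Sum>i\<le>k. a i * \<nu> i (F m)) \<longlonglongrightarrow> (\<Sum>i\<le>k. a i * (if i = j then L else 0))"
    using F(2) by (intro tendsto_sum tendsto_mult tendsto_const) auto
  moreover have "(\<Sum>i\<le>k. a i * (if i = j then L else 0)) = a j * L"
    using j(1) by (simp add: if_distrib[of "\<lambda>t. _ * t"] sum.delta cong: if_cong)
  moreover have "(\<Sum>i\<le>k. a i * \<nu> i x) = 0" for x using a(2)[of x] by simp
  ultimately have "a j * L = 0" by (simp add: LIMSEQ_const_iff)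
  then show False using F(1) j(2) by auto
qed

section \<open>The bidisc algebra\<close>

lemma analytic_apply_bidisc: "analytic_open_bidisc (apply_bidisc f)"
  using apply_bidisc[of f] by simp

lemma compact_closed_bidisc: "compact closed_bidisc"
  by (intro compact_Times) auto

lemma torus_subset_closed_bidisc: "torus \<subseteq> closed_bidisc"
  by auto

lemma continuous_on_slice_fst:
  "y \<in> cball 0 1 \<Longrightarrow> continuous_on (cball 0 1) (\<lambda>x. apply_bidisc f (x, y))"
  by (rule continuous_on_compose2[OF continuous_on_apply_bidisc]) (auto intro!: continuous_intros)

lemma continuous_on_slice_snd:
  "x \<in> cball 0 1 \<Longrightarrow> continuous_on (cball 0 1) (\<lambda>y. apply_bidisc f (x, y))"
  by (rule continuous_on_compose2[OF continuous_on_apply_bidisc]) (auto intro!: continuous_intros)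

lemma uniformly_continuous_on_apply_bidisc: "uniformly_continuous_on closed_bidisc (apply_bidisc f)"
  by (rule compact_uniformly_continuous[OF continuous_on_apply_bidisc compact_closed_bidisc])

lemma uniform_limit_apply_bidisc:
  assumes "\<And>n x. x \<in> A \<Longrightarrow> g n x \<in> closed_bidisc" "\<And>x. x \<in> A \<Longrightarrow> h x \<in> closed_bidisc"
    and "uniform_limit A g h sequentially"
  shows "uniform_limit A (\<lambda>n x. apply_bidisc f (g n x)) (\<lambda>x. apply_bidisc f (h x)) sequentially"
proof (rule uniform_limitI)
  fix e :: real assume "e > 0"
  then obtain d where d: "d > 0"
    "\<And>u v. u \<in> closed_bidisc \<Longrightarrow> v \<in> closed_bidisc \<Longrightarrow> dist u v < d \<Longrightarrow> dist (apply_bidisc f u) (apply_bidisc f v) < e"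
    using uniformly_continuous_on_apply_bidisc[of f] unfolding uniformly_continuous_on_def by metis
  from uniform_limitD[OF assms(3) d(1)]
  show "\<forall>\<^sub>F n in sequentially. \<forall>x\<in>A. dist (apply_bidisc f (g n x)) (apply_bidisc f (h x)) < e"
    by eventually_elim (use d(2) assms(1,2) in blast)
qed

lemma radial_uniform_limit:
  fixes y :: "complex"
  shows "(\<lambda>n. complex_of_real (1 - 1 / real (n + 2)) * y) \<longlonglongrightarrow> y"
proof -
  have "(\<lambda>n. 1 / real (n + 2)) \<longlonglongrightarrow> 0"
    using LIMSEQ_ignore_initial_segment[OF lim_1_over_n, of 2] by simp
  from tendsto_diff[OF tendsto_const[of 1] this]
  have "(\<lambda>n. 1 - 1 / real (n + 2)) \<longlonglongrightarrow> 1" by simp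
  from tendsto_of_real[OF this, where 'a=complex]
  have "(\<lambda>n. complex_of_real (1 - 1 / real (n + 2))) \<longlonglongrightarrow> 1" by simp
  from tendsto_mult[OF this tendsto_const[of y]] show ?thesis by simp
qed

lemma radial_in_ball:
  fixes y :: complex
  assumes "y \<in> cball 0 1"
  shows "complex_of_real (1 - 1 / real (n + 2)) * y \<in> ball 0 1"
proof -
  have "norm (complex_of_real (1 - 1 / real (n + 2)) * y) = (1 - 1 / real (n + 2)) * norm y"
    by (simp add: norm_mult del: of_real_diff)
  also have "\<dots> \<le> (1 - 1 / real (n + 2)) * 1"
    using assms by (intro mult_left_mono) auto
  also have "\<dots> < 1" by simp
  finally show ?thesis by simp
qed

text \<open>Slices through boundary points are uniform limits of slices through interior points.\<close>

lemma holomorphic_slice_fst: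
  assumes y: "y \<in> cball 0 1"
  shows "(\<lambda>x. apply_bidisc f (x, y)) holomorphic_on ball 0 1"
proof -
  let ?y = "\<lambda>n. complex_of_real (1 - 1 / real (n + 2)) * y"
  show ?thesis
  proof (rule holomorphic_uniform_limit[of 0 1 "\<lambda>n x. apply_bidisc f (x, ?y n)" sequentially])
    have b: "?y n \<in> ball 0 1" "?y n \<in> cball 0 1" for n
      using radial_in_ball[OF y, of n] by (auto simp del: of_real_diff)
    then show "\<forall>\<^sub>F n in sequentially. continuous_on (cball 0 1) (\<lambda>x. apply_bidisc f (x, ?y n))
        \<and> (\<lambda>x. apply_bidisc f (x, ?y n)) holomorphic_on ball 0 1"
      by (intro always_eventually allI conjI continuous_on_slice_fst
          analytic_slices(1)[OF analytic_apply_bidisc]) auto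
    have "uniform_limit (cball 0 1) (\<lambda>n x. (x, ?y n)) (\<lambda>x :: complex. (x, y)) sequentially"
    proof (rule uniform_limitI)
      fix e :: real assume "e > 0"
      from tendstoD[OF radial_uniform_limit[of y] this]
      show "\<forall>\<^sub>F n in sequentially. \<forall>x::complex\<in>cball 0 1. dist (x, ?y n) (x, y) < e"
        by (simp add: dist_Pair_Pair)
    qed
    then show "uniform_limit (cball 0 1) (\<lambda>n x. apply_bidisc f (x, ?y n)) (\<lambda>x. apply_bidisc f (x, y)) sequentially"
      using b y by (intro uniform_limit_apply_bidisc) (auto simp del: of_real_diff)
  qed auto
qed

lemma holomorphic_slice_snd:
  assumes x: "x \<in> cball 0 1"
  shows "(\<lambda>y. apply_bidisc f (x, y)) holomorphic_on ball 0 1"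
proof -
  let ?x = "\<lambda>n. complex_of_real (1 - 1 / real (n + 2)) * x"
  show ?thesis
  proof (rule holomorphic_uniform_limit[of 0 1 "\<lambda>n y. apply_bidisc f (?x n, y)" sequentially])
    have b: "?x n \<in> ball 0 1" "?x n \<in> cball 0 1" for n
      using radial_in_ball[OF x, of n] by (auto simp del: of_real_diff)
    then show "\<forall>\<^sub>F n in sequentially. continuous_on (cball 0 1) (\<lambda>y. apply_bidisc f (?x n, y))
        \<and> (\<lambda>y. apply_bidisc f (?x n, y)) holomorphic_on ball 0 1"
      by (intro always_eventually allI conjI continuous_on_slice_snd
          analytic_slices(2)[OF analytic_apply_bidisc]) auto
    have "uniform_limit (cball 0 1) (\<lambda>n y. (?x n, y)) (\<lambda>y :: complex. (x, y)) sequentially"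
    proof (rule uniform_limitI)
      fix e :: real assume "e > 0"
      from tendstoD[OF radial_uniform_limit[of x] this]
      show "\<forall>\<^sub>F n in sequentially. \<forall>y::complex\<in>cball 0 1. dist (?x n, y) (x, y) < e"
        by (simp add: dist_Pair_Pair)
    qed
    then show "uniform_limit (cball 0 1) (\<lambda>n y. apply_bidisc f (?x n, y)) (\<lambda>y. apply_bidisc f (x, y)) sequentially"
      using b x by (intro uniform_limit_apply_bidisc) (auto simp del: of_real_diff)
  qed auto
qed

lemma maximum_modulus_disc:
  assumes "g holomorphic_on ball 0 1" "continuous_on (cball 0 1) g"
    and "\<And>z. z \<in> sphere 0 1 \<Longrightarrow> cmod (g z) \<le> B" and "z \<in> cball 0 1"
  shows "cmod (g z) \<le> B"
  by (rule maximum_modulus_frontier[of g "cball 0 1" B z]) (use assms in auto)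

text \<open>The maximum principle is applied in one variable after the other; the second application is to
  slices with a boundary point as parameter.\<close>

lemma norm_bidisc_le_torus:
  assumes "\<And>z. z \<in> torus \<Longrightarrow> cmod (apply_bidisc f z) \<le> B"
  shows "norm f \<le> B"
proof (rule norm_bidisc_le)
  have 1: "cmod (apply_bidisc f (x, y)) \<le> B" if "x \<in> sphere 0 1" "y \<in> cball 0 1" for x y
    by (rule maximum_modulus_disc[OF holomorphic_slice_snd continuous_on_slice_snd])
      (use that assms in auto)
  fix z :: "complex \<times> complex" assume "z \<in> closed_bidisc"
  then obtain x y where z: "z = (x, y)" "x \<in> cball 0 1" "y \<in> cball 0 1" by auto
  have "cmod (apply_bidisc f (x, y)) \<le> B"
    by (rule maximum_modulus_disc[OF holomorphic_slice_fst continuous_on_slice_fst])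
      (use z 1 in auto)
  then show "cmod (apply_bidisc f z) \<le> B" by (simp add: z)
qed

definition bidisc_of :: "(complex \<times> complex \<Rightarrow> complex) \<Rightarrow> bidisc_algebra" where
  "bidisc_of g = Abs_bidisc (\<lambda>z. if z \<in> closed_bidisc then g z else 0)"

lemma apply_bidisc_of:
  assumes cont: "continuous_on closed_bidisc g"
    and hol1: "\<And>y. y \<in> ball 0 1 \<Longrightarrow> (\<lambda>x. g (x, y)) holomorphic_on ball 0 1"
    and hol2: "\<And>x. x \<in> ball 0 1 \<Longrightarrow> (\<lambda>y. g (x, y)) holomorphic_on ball 0 1"
    and z: "z \<in> closed_bidisc"
  shows "apply_bidisc (bidisc_of g) z = g z"
proof -
  define l where "l z = (if z \<in> closed_bidisc then g z else 0)" for z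
  have cl: "continuous_on closed_bidisc l"
    using cont by (rule continuous_on_eq) (simp add: l_def)
  have "analytic_open_bidisc l"
  proof (rule separately_holomorphic_imp_analytic[OF cl])
    show "(\<lambda>x. l (x, y)) holomorphic_on ball 0 1" if "y \<in> ball 0 1" for y
      using hol1[OF that] by (rule holomorphic_transform) (use that in \<open>auto simp: l_def\<close>)
    show "(\<lambda>y. l (x, y)) holomorphic_on ball 0 1" if "x \<in> ball 0 1" for x
      using hol2[OF that] by (rule holomorphic_transform) (use that in \<open>auto simp: l_def\<close>)
  qed
  then have "apply_bidisc (Abs_bidisc l) = l"
    using cl by (intro Abs_bidisc_inverse) (auto simp: l_def)
  moreover have "bidisc_of g = Abs_bidisc l"
    unfolding bidisc_of_def l_def[abs_def] ..
  ultimately show ?thesis using z by (simp add: l_def)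
qed

lemma apply_bidisc_sum: "apply_bidisc (\<Sum>i\<in>I. f i) z = (\<Sum>i\<in>I. apply_bidisc (f i) z)"
  by (induction I rule: infinite_finite_induct) (simp_all add: apply_simps)

lemma bounded_cfunctional_eval:
  assumes "z \<in> closed_bidisc"
  shows "bounded_cfunctional (\<lambda>f. apply_bidisc f z)"
  by (rule bounded_cfunctionalI[where K=1]) (use norm_apply_le[OF assms] in \<open>auto simp: apply_simps\<close>)

lemma power_away_from_peak_uniform:
  fixes v :: "'x::metric_space \<Rightarrow> real"
  assumes K: "compact K" and v: "continuous_on K v" "\<And>x. x \<in> K \<Longrightarrow> 0 \<le> v x"
    and lt: "\<And>x. x \<in> K \<Longrightarrow> x \<noteq> a \<Longrightarrow> v x < 1"
    and k: "continuous_on K k" and "d > 0" "e > 0"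
  shows "\<forall>\<^sub>F m in sequentially. \<forall>x\<in>K - ball a d. \<bar>k x\<bar> * v x ^ m \<le> e"
proof (cases "K - ball a d = {}")
  case False
  have "compact (K - ball a d)" using K by (intro compact_diff) auto
  then obtain b where b: "b \<in> K - ball a d" "\<And>x. x \<in> K - ball a d \<Longrightarrow> v x \<le> v b"
    using continuous_attains_sup[OF _ False continuous_on_subset[OF v(1)]] by blast
  have "b \<noteq> a" using b(1) \<open>d > 0\<close> by auto
  then have q: "0 \<le> v b" "v b < 1"
    using b(1) v(2) lt by auto
  have "bounded (k ` K)" using K k by (intro compact_imp_bounded compact_continuous_image)
  then obtain B where B: "B > 0" "\<And>x. x \<in> K \<Longrightarrow> \<bar>k x\<bar> \<le> B"
    unfolding bounded_pos by auto
  have "(\<lambda>m. B * v b ^ m) \<longlonglongrightarrow> B * 0"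
    using q by (intro tendsto_intros LIMSEQ_power_zero) auto
  then have "\<forall>\<^sub>F m in sequentially. B * v b ^ m < e"
    using \<open>e > 0\<close> by (auto dest: order_tendstoD(2))
  then show ?thesis
  proof eventually_elim
    case (elim m)
    show ?case
    proof
      fix x assume x: "x \<in> K - ball a d"
      have "\<bar>k x\<bar> * v x ^ m \<le> B * v b ^ m"
        using x B b(2)[OF x] v(2) by (intro mult_mono power_mono) auto
      with elim show "\<bar>k x\<bar> * v x ^ m \<le> e" by simp
    qed
  qed
qed (auto intro!: always_eventually)

text \<open>High powers of functions that peak at distinct points are almost disjointly supported: near each
  peak only one summand is alive, and its coefficient is close to the value at the peak.\<close>

lemma sum_peak_powers_le:
  fixes v k :: "'i \<Rightarrow> 'x::metric_space \<Rightarrow> real"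
  assumes K: "compact K" and I: "finite I"
    and v: "\<And>i. i \<in> I \<Longrightarrow> continuous_on K (v i)" "\<And>i x. i \<in> I \<Longrightarrow> x \<in> K \<Longrightarrow> 0 \<le> v i x \<and> v i x \<le> 1"
    and lt: "\<And>i x. i \<in> I \<Longrightarrow> x \<in> K \<Longrightarrow> x \<noteq> a i \<Longrightarrow> v i x < 1"
    and a: "inj_on a I" "a ` I \<subseteq> K"
    and k: "\<And>i. i \<in> I \<Longrightarrow> continuous_on K (k i)" "\<And>i. i \<in> I \<Longrightarrow> \<bar>k i (a i)\<bar> \<le> e"
    and "e > 0"
  shows "\<forall>\<^sub>F m in sequentially. \<forall>x\<in>K. (\<Sum>i\<in>I. \<bar>k i x\<bar> * v i x ^ m) \<le> 3 * e"
proof -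
  \<comment> \<open>The radius of the neighbourhoods of the peaks has to make them disjoint and the coefficients almost constant.\<close>
  have "\<forall>\<^sub>F d in at_right (0::real). \<forall>i\<in>I. \<forall>j\<in>I. i \<noteq> j \<longrightarrow> 2 * d < dist (a i) (a j)"
  proof (intro eventually_ball_finite[OF I] ballI)
    fix i j assume "i \<in> I" "j \<in> I"
    show "\<forall>\<^sub>F d in at_right (0::real). i \<noteq> j \<longrightarrow> 2 * d < dist (a i) (a j)"
    proof (cases "i = j")
      case False
      then have "dist (a i) (a j) > 0" using a \<open>i \<in> I\<close> \<open>j \<in> I\<close> by (auto simp: inj_on_def)
      then have "\<forall>\<^sub>F d in at_right (0::real). d < dist (a i) (a j) / 2"
        by (intro order_tendstoD(2)[OF tendsto_ident_at]) auto
      then show ?thesis by eventually_elim simp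
    qed simp
  qed
  moreover have "\<forall>\<^sub>F d in at_right (0::real). \<forall>i\<in>I. \<forall>x\<in>K. dist x (a i) < d \<longrightarrow> \<bar>k i x\<bar> \<le> 2 * e"
  proof (intro eventually_ball_finite[OF I] ballI)
    fix i assume i: "i \<in> I"
    then obtain d where d: "d > 0" "\<And>x. x \<in> K \<Longrightarrow> dist x (a i) < d \<Longrightarrow> dist (k i x) (k i (a i)) < e"
      using k(1)[OF i] a(2) \<open>e > 0\<close> unfolding continuous_on_iff by blast
    have "\<forall>\<^sub>F d' in at_right (0::real). d' < d"
      using d(1) by (intro order_tendstoD(2)[OF tendsto_ident_at]) auto
    then show "\<forall>\<^sub>F d in at_right (0::real). \<forall>x\<in>K. dist x (a i) < d \<longrightarrow> \<bar>k i x\<bar> \<le> 2 * e"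
    proof eventually_elim
      case (elim d')
      show ?case
      proof (intro ballI impI)
        fix x assume "x \<in> K" "dist x (a i) < d'"
        then have "dist (k i x) (k i (a i)) < e" using elim d(2) by auto
        then show "\<bar>k i x\<bar> \<le> 2 * e" using k(2)[OF i] by (simp add: dist_real_def)
      qed
    qed
  qed
  moreover have "\<forall>\<^sub>F d in at_right (0::real). d > 0"
    by (simp add: eventually_at_right_less)
  ultimately have "\<forall>\<^sub>F d in at_right (0::real). d > 0 \<and> (\<forall>i\<in>I. \<forall>j\<in>I. i \<noteq> j \<longrightarrow> 2 * d < dist (a i) (a j)) \<and>
     (\<forall>i\<in>I. \<forall>x\<in>K. dist x (a i) < d \<longrightarrow> \<bar>k i x\<bar> \<le> 2 * e)"
    by eventually_elim blast
  then have "\<exists>d. d > 0 \<and> (\<forall>i\<in>I. \<forall>j\<in>I. i \<noteq> j \<longrightarrow> 2 * d < dist (a i) (a j)) \<and>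
     (\<forall>i\<in>I. \<forall>x\<in>K. dist x (a i) < d \<longrightarrow> \<bar>k i x\<bar> \<le> 2 * e)"
    by (intro eventually_happens'[OF trivial_limit_at_right_real])
  then obtain d where dd: "d > 0" "\<forall>i\<in>I. \<forall>j\<in>I. i \<noteq> j \<longrightarrow> 2 * d < dist (a i) (a j)"
    "\<forall>i\<in>I. \<forall>x\<in>K. dist x (a i) < d \<longrightarrow> \<bar>k i x\<bar> \<le> 2 * e"
    by (elim exE conjE)
  note d = dd(1) dd(2)[rule_format] dd(3)[rule_format]
  define e' where "e' = e / (real (card I) + 1)"
  have e': "e' > 0" using \<open>e > 0\<close> by (simp add: e'_def)
  have "\<forall>\<^sub>F m in sequentially. \<forall>i\<in>I. \<forall>x\<in>K - ball (a i) d. \<bar>k i x\<bar> * v i x ^ m \<le> e'"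
    using v lt k(1) K d(1) e'
    by (intro eventually_ball_finite[OF I] ballI power_away_from_peak_uniform) auto
  then show ?thesis
  proof eventually_elim
    case (elim m)
    show ?case
    proof
      fix x assume x: "x \<in> K"
      have small: "(\<Sum>i\<in>J. \<bar>k i x\<bar> * v i x ^ m) \<le> e" if "J \<subseteq> I" "\<And>i. i \<in> J \<Longrightarrow> x \<notin> ball (a i) d" for J
      proof -
        have "(\<Sum>i\<in>J. \<bar>k i x\<bar> * v i x ^ m) \<le> (\<Sum>i\<in>J. e')"
          using elim x that by (intro sum_mono) blast
        also have "\<dots> \<le> real (card I) * e'"
          using card_mono[OF I that(1)] e' by simp
        also have "\<dots> \<le> e" using \<open>e > 0\<close> by (simp add: e'_def field_simps)
        finally show ?thesis .
      qed
      show "(\<Sum>i\<in>I. \<bar>k i x\<bar> * v i x ^ m) \<le> 3 * e"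
      proof (cases "\<exists>i\<in>I. x \<in> ball (a i) d")
        case False
        then show ?thesis using small[of I] \<open>e > 0\<close> by fastforce
      next
        case True
        then obtain i where i: "i \<in> I" "dist x (a i) < d" by (auto simp: dist_commute)
        have "x \<notin> ball (a j) d" if "j \<in> I - {i}" for j
          using d(2)[of i j] i that dist_triangle2[of "a i" "a j" x] by (auto simp: dist_commute)
        then have "(\<Sum>j\<in>I - {i}. \<bar>k j x\<bar> * v j x ^ m) \<le> e" by (intro small) auto
        moreover have "\<bar>k i x\<bar> * v i x ^ m \<le> 2 * e * 1"
          using d(3)[OF i(1) x i(2)] v(2)[OF i(1) x] by (intro mult_mono power_le_one) auto
        ultimately show ?thesis using i I by (simp add: sum.remove)
      qed
    qed
  qed
qed

lemma one_plus_cnj_mult_eq_2_imp: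
  assumes "x \<in> sphere 0 1" "z \<in> cball (0::complex) 1" "cmod (1 + cnj x * z) = 2"
  shows "z = x"
proof -
  have x1: "x * cnj x = 1" using assms(1) by (simp add: complex_norm_square[symmetric])
  let ?u = "cnj x * z"
  have u: "cmod ?u \<le> 1" using assms by (simp add: norm_mult)
  have "(cmod (1 + ?u))\<^sup>2 = 1 + 2 * Re ?u + (cmod ?u)\<^sup>2"
    unfolding cmod_power2 by (simp add: power2_eq_square algebra_simps)
  moreover have "(cmod ?u)\<^sup>2 \<le> 1" using u by (simp add: power_le_one)
  moreover have "Re ?u \<le> 1" using u complex_Re_le_cmod[of ?u] by linarith
  ultimately have "Re ?u = 1" using assms(3) by simp
  moreover have "(Re ?u)\<^sup>2 + (Im ?u)\<^sup>2 \<le> 1"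
    using \<open>(cmod ?u)\<^sup>2 \<le> 1\<close> unfolding cmod_power2 .
  ultimately have "?u = 1" by (simp add: complex_eq_iff)
  then have "x * cnj x * z = x" by (simp add: mult.assoc)
  then show "z = x" using x1 by simp
qed

lemma one_plus_cnj_mult_le_2:
  assumes "x \<in> sphere 0 1" "z \<in> cball (0::complex) 1"
  shows "cmod (1 + cnj x * z) \<le> 2"
  using norm_triangle_ineq[of 1 "cnj x * z"] assms by (simp add: norm_mult)

definition torus_peak :: "complex \<times> complex \<Rightarrow> complex \<times> complex \<Rightarrow> complex" where
  "torus_peak a z = (1 + cnj (fst a) * fst z) * (1 + cnj (snd a) * snd z) / 4"

lemma torus_peak_self: "a \<in> torus \<Longrightarrow> torus_peak a a = 1"
  by (auto simp: torus_peak_def mult.commute complex_norm_square[symmetric])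

lemma norm_torus_peak_le_1:
  assumes "a \<in> torus" "z \<in> closed_bidisc"
  shows "cmod (torus_peak a z) \<le> 1"
proof -
  have "cmod (1 + cnj (fst a) * fst z) * cmod (1 + cnj (snd a) * snd z) \<le> 2 * 2"
    using assms by (intro mult_mono one_plus_cnj_mult_le_2) auto
  then show ?thesis by (simp add: torus_peak_def norm_mult norm_divide)
qed

lemma norm_torus_peak_less_1:
  assumes "a \<in> torus" "z \<in> closed_bidisc" "z \<noteq> a"
  shows "cmod (torus_peak a z) < 1"
proof -
  have le: "cmod (1 + cnj (fst a) * fst z) \<le> 2" "cmod (1 + cnj (snd a) * snd z) \<le> 2"
    using assms by (auto intro!: one_plus_cnj_mult_le_2)
  have "cmod (1 + cnj (fst a) * fst z) < 2 \<or> cmod (1 + cnj (snd a) * snd z) < 2"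
  proof (rule ccontr)
    assume "\<not> ?thesis"
    then have "cmod (1 + cnj (fst a) * fst z) = 2" "cmod (1 + cnj (snd a) * snd z) = 2"
      using le by linarith+
    then have "fst z = fst a" "snd z = snd a"
      using assms by (auto intro!: one_plus_cnj_mult_eq_2_imp)
    then show False using assms(3) by (simp add: prod_eq_iff)
  qed
  then have "cmod (1 + cnj (fst a) * fst z) * cmod (1 + cnj (snd a) * snd z) < 2 * 2"
  proof
    assume "cmod (1 + cnj (fst a) * fst z) < 2"
    then show ?thesis
      using mult_left_mono[OF le(2), of "cmod (1 + cnj (fst a) * fst z)"] by (auto intro: order_le_less_trans)
  next
    assume "cmod (1 + cnj (snd a) * snd z) < 2"
    then show ?thesis
      using mult_right_mono[OF le(1), of "cmod (1 + cnj (snd a) * snd z)"] by (auto intro: order_le_less_trans)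
  qed
  then show ?thesis by (simp add: torus_peak_def norm_mult norm_divide)
qed

lemma continuous_on_torus_peak: "continuous_on A (torus_peak a)"
  unfolding torus_peak_def[abs_def] by (intro continuous_intros) auto

lemma apply_bidisc_of_torus_peak_power:
  assumes "z \<in> closed_bidisc"
  shows "apply_bidisc (bidisc_of (\<lambda>z. torus_peak a z ^ m)) z = torus_peak a z ^ m"
  by (rule apply_bidisc_of)
    (use assms in \<open>auto intro!: continuous_intros continuous_on_torus_peak holomorphic_intros simp: torus_peak_def\<close>)

text \<open>Point evaluations at distinct points of the torus behave like the unit vectors of \<open>\<ell>\<^sup>1\<close>: a sum of
  high powers of peak functions, with the phases opposite to those of the coefficients, has bounded
  norm and takes almost arbitrary values at the given points. The factor \<open>3\<close> is the one from
  \<open>sum_peak_powers_le\<close>.\<close>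

lemma torus_point_masses_norm:
  fixes c :: "'i \<Rightarrow> complex"
  assumes I: "finite I" and a: "inj_on a I" "a ` I \<subseteq> torus" and M: "M \<ge> 0"
    and le: "\<And>f. cmod (\<Sum>i\<in>I. c i * apply_bidisc f (a i)) \<le> M * norm f"
  shows "(\<Sum>i\<in>I. cmod (c i)) \<le> 3 * M"
proof -
  define s where "s i = cnj (sgn (c i))" for i
  have s1: "cmod (s i) \<le> 1" for i by (simp add: s_def norm_sgn)
  have sc: "c i * s i = complex_of_real (cmod (c i))" for i
  proof (cases "c i = 0")
    case False
    then show ?thesis
      using complex_norm_square[of "c i"]
      by (simp add: s_def sgn_eq power2_eq_square field_simps)
  qed (simp add: s_def)
  define F where "F m = (\<Sum>i\<in>I. s i *\<^sub>C bidisc_of (\<lambda>z. torus_peak (a i) z ^ m))" for m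
  have F: "apply_bidisc (F m) z = (\<Sum>i\<in>I. s i * torus_peak (a i) z ^ m)" if "z \<in> closed_bidisc" for m z
    unfolding F_def using that by (simp add: apply_bidisc_sum apply_simps apply_bidisc_of_torus_peak_power del: mem_Times_iff)
  have at: "a i \<in> torus" "a i \<in> closed_bidisc" if "i \<in> I" for i
    using a(2) that by auto
  have "\<forall>\<^sub>F m in sequentially. \<forall>x\<in>closed_bidisc. (\<Sum>i\<in>I. \<bar>1\<bar> * cmod (torus_peak (a i) x) ^ m) \<le> 3 * 1"
    using I a at norm_torus_peak_le_1 norm_torus_peak_less_1
    by (intro sum_peak_powers_le[where a=a] compact_closed_bidisc continuous_on_norm continuous_on_torus_peak)
      auto
  then have "\<forall>\<^sub>F m in sequentially. norm (F m) \<le> 3"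
  proof eventually_elim
    case (elim m)
    show ?case
    proof (rule norm_bidisc_le)
      fix z :: "complex \<times> complex" assume z: "z \<in> closed_bidisc"
      have "cmod (apply_bidisc (F m) z) \<le> (\<Sum>i\<in>I. 1 * cmod (torus_peak (a i) z) ^ m)"
        unfolding F[OF z] by (rule order_trans[OF norm_sum])
          (use s1 in \<open>auto intro!: sum_mono mult_left_le_one_le simp: norm_mult norm_power\<close>)
      then show "cmod (apply_bidisc (F m) z) \<le> 3" using elim z by force
    qed
  qed
  then have ev: "\<forall>\<^sub>F m in sequentially. cmod (\<Sum>i\<in>I. c i * apply_bidisc (F m) (a i)) \<le> 3 * M"
  proof eventually_elim
    case (elim m)
    then show ?case using le[of "F m"] mult_left_mono[OF elim M] by simp
  qed
  have lim: "(\<lambda>m. s j * torus_peak (a j) (a i) ^ m) \<longlonglongrightarrow> (if j = i then s i else 0)"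
    if "i \<in> I" "j \<in> I" for i j
  proof (cases "j = i")
    case True
    then show ?thesis using at[OF that(1)] by (simp add: torus_peak_self)
  next
    case False
    then have "a i \<noteq> a j" using a(1) that by (auto simp: inj_on_def)
    then have "cmod (torus_peak (a j) (a i)) < 1"
      using at that by (intro norm_torus_peak_less_1) auto
    from tendsto_mult_right_zero[OF LIMSEQ_power_zero[OF this]] False show ?thesis by simp
  qed
  have "(\<lambda>m. \<Sum>i\<in>I. c i * apply_bidisc (F m) (a i)) \<longlonglongrightarrow> (\<Sum>i\<in>I. c i * (\<Sum>j\<in>I. if j = i then s i else 0))"
  proof (intro tendsto_sum tendsto_mult tendsto_const)
    fix i assume i: "i \<in> I"
    show "(\<lambda>m. apply_bidisc (F m) (a i)) \<longlonglongrightarrow> (\<Sum>j\<in>I. if j = i then s i else 0)"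
      unfolding F[OF at(2)[OF i]] by (intro tendsto_sum lim i)
  qed
  also have "(\<Sum>i\<in>I. c i * (\<Sum>j\<in>I. if j = i then s i else 0)) = complex_of_real (\<Sum>i\<in>I. cmod (c i))"
    using I by (simp add: sum.delta sc)
  finally have "(\<lambda>m. cmod (\<Sum>i\<in>I. c i * apply_bidisc (F m) (a i))) \<longlonglongrightarrow> cmod (complex_of_real (\<Sum>i\<in>I. cmod (c i)))"
    by (rule tendsto_norm)
  from tendsto_upperbound[OF this ev] have "cmod (complex_of_real (\<Sum>i\<in>I. cmod (c i))) \<le> 3 * M" by simp
  then show ?thesis by (simp add: sum_nonneg del: of_real_sum)
qed

lemma apply_bidisc_mult:
  assumes "z \<in> closed_bidisc"
  shows "apply_bidisc (bidisc_of (\<lambda>z. apply_bidisc f z * apply_bidisc g z)) z = apply_bidisc f z * apply_bidisc g z"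
  by (rule apply_bidisc_of[OF _ _ _ assms])
    (auto intro!: continuous_intros holomorphic_intros holomorphic_slice_fst holomorphic_slice_snd continuous_on_apply_bidisc)

lemma invertible_torus_iff: "invertible_torus w \<longleftrightarrow> (\<forall>z\<in>torus. apply_bidisc w z \<noteq> 0)"
proof
  assume "invertible_torus w"
  then show "\<forall>z\<in>torus. apply_bidisc w z \<noteq> 0" unfolding invertible_torus_def by force
next
  assume nz: "\<forall>z\<in>torus. apply_bidisc w z \<noteq> 0"
  show "invertible_torus w" unfolding invertible_torus_def
  proof (intro exI conjI ballI)
    show "continuous_on torus (\<lambda>z. inverse (apply_bidisc w z))"
      using nz by (intro continuous_on_inverse continuous_on_subset[OF continuous_on_apply_bidisc torus_subset_closed_bidisc]) auto
  qed (use nz in auto)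
qed

lemma invertible_bidisc_iff: "invertible_bidisc w \<longleftrightarrow> (\<forall>z\<in>closed_bidisc. apply_bidisc w z \<noteq> 0)"
proof
  assume "invertible_bidisc w"
  then show "\<forall>z\<in>closed_bidisc. apply_bidisc w z \<noteq> 0" unfolding invertible_bidisc_def by force
next
  assume nz: "\<forall>z\<in>closed_bidisc. apply_bidisc w z \<noteq> 0"
  have "apply_bidisc (bidisc_of (\<lambda>z. inverse (apply_bidisc w z))) z = inverse (apply_bidisc w z)"
    if "z \<in> closed_bidisc" for z
  proof (rule apply_bidisc_of[OF _ _ _ that])
    show "continuous_on closed_bidisc (\<lambda>z. inverse (apply_bidisc w z))"
      using nz by (intro continuous_on_inverse continuous_on_apply_bidisc) auto
    show "(\<lambda>x. inverse (apply_bidisc w (x, y))) holomorphic_on ball 0 1" if "y \<in> ball 0 1" for y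
      using nz that by (intro holomorphic_on_inverse holomorphic_slice_fst) auto
    show "(\<lambda>y. inverse (apply_bidisc w (x, y))) holomorphic_on ball 0 1" if "x \<in> ball 0 1" for x
      using nz that by (intro holomorphic_on_inverse holomorphic_slice_snd) auto
  qed
  then show "invertible_bidisc w"
    unfolding invertible_bidisc_def using nz
    by (intro exI[of _ "bidisc_of (\<lambda>z. inverse (apply_bidisc w z))"]) simp
qed

section \<open>Parabolic automorphisms of the disc\<close>

text \<open>The automorphism of the disc that fixes \<open>\<zeta>\<close> and is the translation by \<open>s\<close> in the coordinate
  \<open>height_coord\<close> below.\<close>

definition parabolic :: "complex \<Rightarrow> real \<Rightarrow> complex \<Rightarrow> complex" where
  "parabolic \<zeta> s y =
    \<zeta> * ((2 * \<i> - of_real s) * y + of_real s * \<zeta>) / ((2 * \<i> + of_real s) * \<zeta> - of_real s * y)"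

text \<open>A Cayley transform: \<open>\<zeta>\<close> goes to infinity, the circle to the line at height \<open>1\<close>, and the open disc
  to the half plane above it.\<close>

definition height_coord :: "complex \<Rightarrow> complex \<Rightarrow> complex" where
  "height_coord \<zeta> y = 2 * \<i> * \<zeta> / (\<zeta> - y)"

lemma height_coord_inj:
  assumes "\<zeta> \<noteq> 0" "y \<noteq> \<zeta>" "y' \<noteq> \<zeta>" "height_coord \<zeta> y = height_coord \<zeta> y'"
  shows "y = y'"
  using assms by (simp add: height_coord_def field_simps)

lemma parabolic_denominator_nonzero:
  assumes "cmod \<zeta> = 1" "y \<in> cball 0 1"
  shows "(2 * \<i> + of_real s) * \<zeta> - of_real s * y \<noteq> 0"
proof
  assume "(2 * \<i> + of_real s) * \<zeta> - of_real s * y = 0"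
  then have "(2 * \<i> + of_real s) * \<zeta> = of_real s * y" by simp
  then have "cmod ((2 * \<i> + of_real s) * \<zeta>) = cmod (of_real s * y)" by simp
  then have "cmod (2 * \<i> + of_real s) = \<bar>s\<bar> * cmod y" using assms(1) by (simp add: norm_mult)
  also have "\<dots> \<le> \<bar>s\<bar>" using assms(2) by (simp add: mult_left_le)
  finally have "(cmod (2 * \<i> + of_real s))\<^sup>2 \<le> \<bar>s\<bar>\<^sup>2" by (intro power_mono) auto
  then show False by (simp add: cmod_power2)
qed

lemma parabolic_fixed_point:
  assumes "\<zeta> \<noteq> 0"
  shows "parabolic \<zeta> s \<zeta> = \<zeta>"
  using assms by (simp add: parabolic_def field_simps)

lemma parabolic_minus_fixed_point:
  assumes "cmod \<zeta> = 1" "y \<in> cball 0 1"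
  shows "\<zeta> - parabolic \<zeta> s y = 2 * \<i> * \<zeta> * (\<zeta> - y) / ((2 * \<i> + of_real s) * \<zeta> - of_real s * y)"
proof -
  let ?d = "(2 * \<i> + of_real s) * \<zeta> - of_real s * y"
  have "\<zeta> - parabolic \<zeta> s y = (\<zeta> * ?d - \<zeta> * ((2 * \<i> - of_real s) * y + of_real s * \<zeta>)) / ?d"
    using parabolic_denominator_nonzero[OF assms, of s] by (simp add: parabolic_def diff_divide_distrib)
  also have "\<zeta> * ?d - \<zeta> * ((2 * \<i> - of_real s) * y + of_real s * \<zeta>) = 2 * \<i> * \<zeta> * (\<zeta> - y)"
    by (simp add: algebra_simps)
  finally show ?thesis .
qed

lemma parabolic_neq_fixed_point:
  assumes "cmod \<zeta> = 1" "y \<in> cball 0 1" "y \<noteq> \<zeta>"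
  shows "parabolic \<zeta> s y \<noteq> \<zeta>"
proof -
  have "\<zeta> - parabolic \<zeta> s y \<noteq> 0"
    unfolding parabolic_minus_fixed_point[OF assms(1,2)]
    using parabolic_denominator_nonzero[OF assms(1,2)] assms by auto
  then show ?thesis by auto
qed

lemma height_coord_parabolic:
  assumes "cmod \<zeta> = 1" "y \<in> cball 0 1" "y \<noteq> \<zeta>"
  shows "height_coord \<zeta> (parabolic \<zeta> s y) = height_coord \<zeta> y + of_real s"
proof -
  let ?d = "(2 * \<i> + of_real s) * \<zeta> - of_real s * y"
  have d: "?d \<noteq> 0" by (rule parabolic_denominator_nonzero[OF assms(1,2)])
  have z: "\<zeta> \<noteq> 0" "\<zeta> - y \<noteq> 0" using assms by auto
  have "height_coord \<zeta> (parabolic \<zeta> s y) = ?d / (\<zeta> - y)"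
    unfolding height_coord_def parabolic_minus_fixed_point[OF assms(1,2)] using d z by simp
  also have "?d = 2 * \<i> * \<zeta> + of_real s * (\<zeta> - y)" by (simp add: algebra_simps)
  finally show ?thesis using z by (simp add: height_coord_def add_divide_distrib)
qed

text \<open>Numerator and denominator of \<open>parabolic\<close>; after division by \<open>\<zeta>\<close> both depend on \<open>y cnj \<zeta>\<close> only.\<close>

lemma parabolic_norm_identity:
  assumes "cmod \<zeta> = 1"
  shows "(cmod ((2 * \<i> + of_real s) * \<zeta> - of_real s * y))\<^sup>2 - (cmod ((2 * \<i> - of_real s) * y + of_real s * \<zeta>))\<^sup>2
    = 4 * (1 - (cmod y)\<^sup>2)"
proof -
  define q where "q = y * cnj \<zeta>"
  have zz: "\<zeta> * cnj \<zeta> = 1" using assms by (simp add: complex_norm_square[symmetric])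
  have y: "y = \<zeta> * q"
    using zz unfolding q_def by (metis mult.assoc mult.commute mult_1)
  have "(2 * \<i> + of_real s) * \<zeta> - of_real s * y = \<zeta> * ((2 * \<i> + of_real s) - of_real s * q)"
    "(2 * \<i> - of_real s) * y + of_real s * \<zeta> = \<zeta> * ((2 * \<i> - of_real s) * q + of_real s)"
    by (simp_all add: y algebra_simps)
  moreover have "(cmod ((2 * \<i> + of_real s) - of_real s * q))\<^sup>2 - (cmod ((2 * \<i> - of_real s) * q + of_real s))\<^sup>2
    = 4 * (1 - (cmod q)\<^sup>2)"
    unfolding cmod_power2 by (simp add: power2_eq_square algebra_simps)
  moreover have "cmod y = cmod q" using assms by (simp add: y norm_mult)
  ultimately show ?thesis using assms by (simp add: norm_mult)
qed

lemma norm_parabolic_square: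
  assumes "cmod \<zeta> = 1" "y \<in> cball 0 1"
  shows "1 - (cmod (parabolic \<zeta> s y))\<^sup>2
    = 4 * (1 - (cmod y)\<^sup>2) / (cmod ((2 * \<i> + of_real s) * \<zeta> - of_real s * y))\<^sup>2"
proof -
  let ?d = "(2 * \<i> + of_real s) * \<zeta> - of_real s * y"
  let ?n = "(2 * \<i> - of_real s) * y + of_real s * \<zeta>"
  have d: "cmod ?d \<noteq> 0" using parabolic_denominator_nonzero[OF assms] by simp
  have "(cmod (parabolic \<zeta> s y))\<^sup>2 = (cmod ?n)\<^sup>2 / (cmod ?d)\<^sup>2"
    using assms by (simp add: parabolic_def norm_mult norm_divide power_divide)
  then have "1 - (cmod (parabolic \<zeta> s y))\<^sup>2 = ((cmod ?d)\<^sup>2 - (cmod ?n)\<^sup>2) / (cmod ?d)\<^sup>2"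
    using d by (simp add: diff_divide_distrib)
  then show ?thesis unfolding parabolic_norm_identity[OF assms(1)] .
qed

lemma parabolic_in_disc:
  assumes "cmod \<zeta> = 1"
  shows "y \<in> cball 0 1 \<Longrightarrow> parabolic \<zeta> s y \<in> cball 0 1"
    and "y \<in> ball 0 1 \<Longrightarrow> parabolic \<zeta> s y \<in> ball 0 1"
    and "y \<in> sphere 0 1 \<Longrightarrow> parabolic \<zeta> s y \<in> sphere 0 1"
proof -
  have d: "(cmod ((2 * \<i> + of_real s) * \<zeta> - of_real s * y))\<^sup>2 > 0" if "y \<in> cball 0 1"
    using parabolic_denominator_nonzero[OF assms that, of s] by simp
  show "parabolic \<zeta> s y \<in> cball 0 1" if y: "y \<in> cball 0 1"
  proof -
    have "(cmod y)\<^sup>2 \<le> 1" using y by (simp add: power_le_one)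
    then have "1 - (cmod (parabolic \<zeta> s y))\<^sup>2 \<ge> 0"
      unfolding norm_parabolic_square[OF assms y] by simp
    then show ?thesis by (simp add: abs_square_le_1)
  qed
  show "parabolic \<zeta> s y \<in> ball 0 1" if y: "y \<in> ball 0 1"
  proof -
    have yc: "y \<in> cball 0 1" using y by simp
    have "(cmod y)\<^sup>2 < 1" using y by (simp add: abs_square_less_1)
    then have "1 - (cmod (parabolic \<zeta> s y))\<^sup>2 > 0"
      unfolding norm_parabolic_square[OF assms yc] using d[OF yc] by simp
    then show ?thesis by (simp add: abs_square_less_1)
  qed
  show "parabolic \<zeta> s y \<in> sphere 0 1" if y: "y \<in> sphere 0 1"
  proof -
    have yc: "y \<in> cball 0 1" using y by simp
    have "1 - (cmod (parabolic \<zeta> s y))\<^sup>2 = 0"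
      unfolding norm_parabolic_square[OF assms yc] using y by simp
    then have "(cmod (parabolic \<zeta> s y))\<^sup>2 = 1\<^sup>2" by simp
    then have "cmod (parabolic \<zeta> s y) = 1" by (rule power2_eq_imp_eq) auto
    then show ?thesis by simp
  qed
qed

lemma parabolic_add:
  assumes "cmod \<zeta> = 1" "y \<in> cball 0 1"
  shows "parabolic \<zeta> s (parabolic \<zeta> t y) = parabolic \<zeta> (s + t) y"
proof (cases "y = \<zeta>")
  case True
  have "\<zeta> \<noteq> 0" using assms by auto
  then show ?thesis unfolding True by (simp add: parabolic_fixed_point)
next
  case False
  have t: "parabolic \<zeta> t y \<in> cball 0 1" "parabolic \<zeta> t y \<noteq> \<zeta>"
    by (rule parabolic_in_disc(1)[OF assms], rule parabolic_neq_fixed_point[OF assms False])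
  show ?thesis
  proof (rule height_coord_inj)
    show "\<zeta> \<noteq> 0" using assms by auto
    show "parabolic \<zeta> s (parabolic \<zeta> t y) \<noteq> \<zeta>" "parabolic \<zeta> (s + t) y \<noteq> \<zeta>"
      by (intro parabolic_neq_fixed_point assms False t)+
    show "height_coord \<zeta> (parabolic \<zeta> s (parabolic \<zeta> t y)) = height_coord \<zeta> (parabolic \<zeta> (s + t) y)"
      unfolding height_coord_parabolic[OF assms(1) t] height_coord_parabolic[OF assms False] by simp
  qed
qed

lemma parabolic_0:
  assumes "cmod \<zeta> = 1"
  shows "parabolic \<zeta> 0 y = y"
  using assms by (auto simp: parabolic_def)

lemma holomorphic_on_parabolic:
  assumes "cmod \<zeta> = 1" "A \<subseteq> cball 0 1"
  shows "parabolic \<zeta> s holomorphic_on A"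
  unfolding parabolic_def[abs_def]
  using parabolic_denominator_nonzero[OF assms(1)] assms(2) by (intro holomorphic_intros) blast

lemma continuous_on_parabolic:
  assumes "cmod \<zeta> = 1" "A \<subseteq> cball 0 1"
  shows "continuous_on A (parabolic \<zeta> s)"
  by (intro holomorphic_on_imp_continuous_on holomorphic_on_parabolic assms)

lemma dist_parabolic_fixed_point:
  assumes "cmod \<zeta> = 1" "y \<in> cball 0 1" "y \<noteq> \<zeta>"
  shows "dist (parabolic \<zeta> s y) \<zeta> = 2 / cmod (height_coord \<zeta> y + of_real s)"
proof -
  have "height_coord \<zeta> (parabolic \<zeta> s y) * (\<zeta> - parabolic \<zeta> s y) = 2 * \<i> * \<zeta>"
    using parabolic_neq_fixed_point[OF assms, of s] by (simp add: height_coord_def)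
  then have "cmod (height_coord \<zeta> y + of_real s) * cmod (\<zeta> - parabolic \<zeta> s y) = 2"
    unfolding height_coord_parabolic[OF assms] norm_mult[symmetric] using assms(1) by (simp add: norm_mult)
  then show ?thesis
    by (metis dist_commute dist_norm mult_eq_0_iff nonzero_eq_divide_eq mult.commute zero_neq_numeral)
qed

text \<open>The circle corresponds to the horizontal line at height \<open>1\<close>.\<close>

lemma Im_height_coord:
  assumes "cmod \<zeta> = 1" "y \<noteq> \<zeta>"
  shows "Im (height_coord \<zeta> y) = 1 + (1 - (cmod y)\<^sup>2) / (cmod (\<zeta> - y))\<^sup>2"
proof -
  define q where "q = y * cnj \<zeta>"
  have zz: "\<zeta> * cnj \<zeta> = 1" using assms by (simp add: complex_norm_square[symmetric])
  have y: "y = \<zeta> * q"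
    using zz unfolding q_def by (metis mult.assoc mult.commute mult_1)
  have q: "q \<noteq> 1" "cmod y = cmod q" using assms by (auto simp: y norm_mult)
  have zq: "\<zeta> - y = \<zeta> * (1 - q)" by (simp add: y algebra_simps)
  have d: "(cmod (\<zeta> - y))\<^sup>2 = (1 - Re q)\<^sup>2 + (Im q)\<^sup>2"
    using assms(1) by (simp add: zq norm_mult cmod_power2)
  have d0: "(cmod (\<zeta> - y))\<^sup>2 > 0" using assms(2) by simp
  have "\<zeta> \<noteq> 0" using assms(1) by auto
  then have "height_coord \<zeta> y = 2 * \<i> / (1 - q)"
    unfolding height_coord_def zq by simp
  then have "Im (height_coord \<zeta> y) = 2 * (1 - Re q) / (cmod (\<zeta> - y))\<^sup>2"
    by (simp add: Im_divide d)
  also have "2 * (1 - Re q) = (cmod (\<zeta> - y))\<^sup>2 + (1 - (cmod y)\<^sup>2)"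
    unfolding d q(2) unfolding cmod_power2 by (simp add: power2_eq_square algebra_simps)
  finally show ?thesis using d0 by (simp add: add_divide_distrib)
qed

lemma height_coord_on_line:
  assumes "cmod \<zeta> = 1" "Im \<kappa> = 1"
  obtains y where "y \<in> sphere 0 1" "y \<noteq> \<zeta>" "height_coord \<zeta> y = \<kappa>"
proof -
  have k: "\<kappa> \<noteq> 0" and z: "\<zeta> \<noteq> 0" using assms by auto
  let ?y = "\<zeta> * ((\<kappa> - 2 * \<i>) / \<kappa>)"
  have sq: "(cmod (\<kappa> - 2 * \<i>))\<^sup>2 = (cmod \<kappa>)\<^sup>2"
    using assms(2) unfolding cmod_power2 by (simp add: power2_eq_square)
  have "cmod (\<kappa> - 2 * \<i>) = cmod \<kappa>"
    by (rule power2_eq_imp_eq[OF sq]) auto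
  then have "?y \<in> sphere 0 1" using assms(1) k by (simp add: norm_mult norm_divide)
  moreover have eq: "\<zeta> - ?y = 2 * \<i> * \<zeta> / \<kappa>" using k by (simp add: field_simps)
  moreover from eq have "?y \<noteq> \<zeta>" using k z by auto
  moreover have "height_coord \<zeta> ?y = \<kappa>" unfolding height_coord_def eq using k z by simp
  ultimately show ?thesis using that by blast
qed

text \<open>Composed with a Moebius function the automorphism fixes \<open>0\<close>, and the Schwarz lemma for this map and
  for its inverse leaves only rotations. The identity extends to the circle by continuity.\<close>

lemma disc_moebius_fractional_linear:
  assumes "disc_moebius \<psi>"
  obtains c m where "cmod c = 1" "cmod m < 1" "\<And>z. z \<in> cball 0 1 \<Longrightarrow> \<psi> z * (1 + cnj m * c * z) = c * z + m"
proof -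
  have hol: "\<psi> holomorphic_on ball 0 1" and bij: "bij_betw \<psi> (ball 0 1) (ball 0 1)"
    and cont: "continuous_on (cball 0 1) \<psi>"
    using assms by (auto simp: disc_moebius_def)
  define m where "m = \<psi> 0"
  have m: "cmod m < 1" using bij_betwE[OF bij] by (auto simp: m_def)
  define F where "F z = Moebius_function 0 m (\<psi> z)" for z
  have psi1: "cmod (\<psi> z) < 1" if "cmod z < 1" for z
    using bij_betwE[OF bij] that by auto
  have F_hol: "F holomorphic_on ball 0 1"
    unfolding F_def[abs_def]
    by (rule holomorphic_on_compose_gen[OF hol Moebius_function_holomorphic[OF m], unfolded o_def])
      (use psi1 in auto)
  have F0: "F 0 = 0" by (simp add: F_def m_def Moebius_function_eq_zero)
  have F1: "cmod (F z) < 1" if "cmod z < 1" for z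
    unfolding F_def by (rule Moebius_function_norm_lt_1[OF m psi1[OF that]])
  have MM: "Moebius_function 0 (- m) (F z) = \<psi> z" if "cmod z < 1" for z
    unfolding F_def by (rule Moebius_function_compose) (use m psi1[OF that] in auto)
  have F_inj: "inj_on F (ball 0 1)"
  proof (rule inj_onI)
    fix x y assume "x \<in> ball 0 1" "y \<in> ball (0::complex) 1" "F x = F y"
    then have "\<psi> x = \<psi> y" using MM[of x] MM[of y] by simp
    then show "x = y" using bij \<open>x \<in> _\<close> \<open>y \<in> _\<close> by (auto simp: bij_betw_def inj_on_def)
  qed
  have F_img: "F ` ball 0 1 = ball 0 1"
  proof (intro equalityI subsetI)
    fix u :: complex assume u: "u \<in> ball 0 1"
    have v: "cmod (Moebius_function 0 (- m) u) < 1"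
      by (rule Moebius_function_norm_lt_1) (use m u in auto)
    then obtain x where x: "x \<in> ball 0 1" "\<psi> x = Moebius_function 0 (- m) u"
      using bij by (force simp: bij_betw_def)
    then have "F x = u"
      unfolding F_def x by (intro Moebius_function_compose) (use m u in auto)
    with x show "u \<in> F ` ball 0 1" by blast
  qed (use F1 in auto)
  obtain G where G: "G holomorphic_on F ` ball 0 1" "\<And>z. z \<in> ball 0 1 \<Longrightarrow> G (F z) = z"
    using holomorphic_has_inverse[OF F_hol open_ball F_inj] by metis
  have G_hol: "G holomorphic_on ball 0 1" using G(1) by (simp add: F_img)
  have G0: "G 0 = 0" using G(2)[of 0] F0 by simp
  have G1: "cmod (G u) < 1" if "cmod u < 1" for u
  proof -
    have "u \<in> F ` ball 0 1" using that F_img by simp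
    then show ?thesis using G(2) by auto
  qed
  have eq: "cmod (F z) = cmod z" if "cmod z < 1" for z
    using Schwarz_Lemma(1)[OF F_hol F0 F1 that] Schwarz_Lemma(1)[OF G_hol G0 G1 F1[OF that]] G(2)[of z] that
    by simp
  have "\<exists>z. cmod z < 1 \<and> z \<noteq> 0 \<and> cmod (F z) = cmod z"
    by (rule exI[of _ "1/2"]) (simp add: eq)
  then obtain c where c: "\<And>z. cmod z < 1 \<Longrightarrow> F z = c * z" "cmod c = 1"
    using Schwarz_Lemma(3)[OF F_hol F0 F1, of 0] by auto
  have nz: "1 + cnj m * c * z \<noteq> 0" if "cmod z \<le> 1" for z
  proof
    assume "1 + cnj m * c * z = 0"
    then have "cmod (cnj m * c * z) = 1" by (metis add_eq_0_iff norm_minus_cancel norm_one)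
    then have "cmod m * cmod z = 1" using c(2) by (simp add: norm_mult)
    moreover have "cmod m * cmod z \<le> cmod m" using that by (simp add: mult_left_le)
    ultimately show False using m by simp
  qed
  have ball: "\<psi> z * (1 + cnj m * c * z) = c * z + m" if "z \<in> ball 0 1" for z
    using MM[of z] c(1)[of z] that nz[of z] by (auto simp: Moebius_function_simple field_simps)
  have "\<psi> z * (1 + cnj m * c * z) - (c * z + m) = 0" if "z \<in> cball 0 1" for z
    by (rule continuous_constant_on_closure[where S="ball 0 1"])
      (use that ball cont in \<open>auto intro!: continuous_intros\<close>)
  then show ?thesis using that[of c m] c(2) m by auto
qed

text \<open>In the coordinate at its fixed point the automorphism is an affine map \<open>\<kappa> \<mapsto> A \<kappa> + B\<close> preserving
  the line at height \<open>1\<close>, which makes \<open>A\<close> real. If \<open>A\<close> were not \<open>1\<close>, the affine map would have a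
  fixed point on that line, hence the automorphism a second fixed point on the circle.\<close>

lemma parabolic_disc_moebius_normal_form:
  assumes par: "parabolic_disc_moebius \<psi>" and z: "\<zeta> \<in> cball 0 1" "\<psi> \<zeta> = \<zeta>"
  obtains b where "b \<noteq> 0" "cmod \<zeta> = 1" "\<And>z. z \<in> cball 0 1 \<Longrightarrow> \<psi> z = parabolic \<zeta> b z"
proof -
  have dm: "disc_moebius \<psi>" and nid: "\<exists>z\<in>cball 0 1. \<psi> z \<noteq> z"
    using par unfolding parabolic_disc_moebius_def by blast+
  obtain \<zeta>' where z': "\<zeta>' \<in> sphere 0 1" "{z \<in> cball 0 1. \<psi> z = z} = {\<zeta>'}"
    using par unfolding parabolic_disc_moebius_def by blast
  have "\<zeta> \<in> {z \<in> cball 0 1. \<psi> z = z}" using z by blast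
  then have "\<zeta> = \<zeta>'" unfolding z'(2) by simp
  then have zeta: "cmod \<zeta> = 1" using z'(1) by simp
  have uniq: "z = \<zeta>" if "z \<in> cball 0 1" "\<psi> z = z" for z
    using that z'(2) \<open>\<zeta> = \<zeta>'\<close> by blast
  obtain c m where c: "cmod c = 1" and m: "cmod m < 1"
    and psi: "\<And>z. z \<in> cball 0 1 \<Longrightarrow> \<psi> z * (1 + cnj m * c * z) = c * z + m"
    using disc_moebius_fractional_linear[OF dm] by metis
  have z0: "\<zeta> \<noteq> 0" and c0: "c \<noteq> 0" using zeta c by auto
  have cz: "c * cnj c = 1" "\<zeta> * cnj \<zeta> = 1"
    using c zeta by (simp_all add: complex_norm_square[symmetric])
  have nz: "1 + cnj m * u \<noteq> 0" if "cmod u \<le> 1" for u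
  proof
    assume "1 + cnj m * u = 0"
    then have "cmod (cnj m * u) = 1" by (metis add_eq_0_iff norm_minus_cancel norm_one)
    then have "cmod m * cmod u = 1" by (simp add: norm_mult)
    moreover have "cmod m * cmod u \<le> cmod m" using that by (simp add: mult_left_le)
    ultimately show False using m by simp
  qed
  have nz1: "1 + cnj m * c * u \<noteq> 0" if "cmod u \<le> 1" for u
    using nz[of "c * u"] that c by (simp add: norm_mult mult.assoc)
  have nz2: "1 - \<zeta> * cnj m \<noteq> 0"
    using nz[of "- \<zeta>"] zeta by (simp add: mult.commute)
  have fix1: "\<zeta> * (1 + cnj m * c * \<zeta>) = c * \<zeta> + m" using psi[OF z(1)] z(2) by simp
  have diff: "(\<zeta> - \<psi> u) * (1 + cnj m * c * u) = c * (1 - \<zeta> * cnj m) * (\<zeta> - u)" if "u \<in> cball 0 1" for u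
    using psi[OF that] fix1 by algebra
  \<comment> \<open>The coefficients of the affine map in the coordinate at the fixed point.\<close>
  define A where "A = (1 + cnj m * c * \<zeta>) / (c * (1 - \<zeta> * cnj m))"
  define B where "B = - 2 * \<i> * \<zeta> * cnj m / (1 - \<zeta> * cnj m)"
  have ne: "\<psi> u \<noteq> \<zeta>" if "u \<in> cball 0 1" "u \<noteq> \<zeta>" for u
    using diff[OF that(1)] that(2) c0 nz2 by auto
  have aff: "height_coord \<zeta> (\<psi> u) = A * height_coord \<zeta> u + B" if u: "u \<in> cball 0 1" "u \<noteq> \<zeta>" for u
  proof -
    have n1: "1 + cnj m * c * u \<noteq> 0" using nz1 u by simp
    have "\<zeta> - \<psi> u = c * (1 - \<zeta> * cnj m) * (\<zeta> - u) / (1 + cnj m * c * u)"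
      using diff[OF u(1)] n1 by (simp add: field_simps)
    then have "height_coord \<zeta> (\<psi> u) = 2 * \<i> * \<zeta> * (1 + cnj m * c * u) / (c * (1 - \<zeta> * cnj m) * (\<zeta> - u))"
      by (simp add: height_coord_def)
    also have "1 + cnj m * c * u = (1 + cnj m * c * \<zeta>) - cnj m * c * (\<zeta> - u)"
      by (simp add: algebra_simps)
    also have "2 * \<i> * \<zeta> * \<dots> / (c * (1 - \<zeta> * cnj m) * (\<zeta> - u)) = A * height_coord \<zeta> u + B"
    proof -
      have d: "\<zeta> - u \<noteq> 0" using u by simp
      show ?thesis
        unfolding A_def B_def height_coord_def using d c0 nz2
        by (simp add: divide_simps) (simp add: algebra_simps)
    qed
    finally show ?thesis .
  qed
  have sph: "\<psi> u \<in> sphere 0 1" if u: "u \<in> sphere 0 1" for u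
  proof -
    have uu: "u * cnj u = 1" using u by (simp add: complex_norm_square[symmetric])
    have "c * u + m = c * u * cnj (1 + cnj m * c * u)"
      using uu cz(1) by (simp add: algebra_simps)
    then have "cmod (c * u + m) = cmod (1 + cnj m * c * u)"
      using u c by (metis complex_mod_cnj dist_0_norm mem_sphere mult_1 norm_mult)
    then have "cmod (\<psi> u) * cmod (1 + cnj m * c * u) = cmod (1 + cnj m * c * u)"
      using psi[of u] u by (simp add: norm_mult[symmetric])
    then show ?thesis using nz1[of u] u by simp
  qed
  have line: "Im (A * \<kappa> + B) = 1" if k: "Im \<kappa> = 1" for \<kappa>
  proof -
    obtain y where y: "y \<in> sphere 0 1" "y \<noteq> \<zeta>" "height_coord \<zeta> y = \<kappa>"
      using height_coord_on_line[OF zeta k] by metis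
    then have yc: "y \<in> cball 0 1" by simp
    show ?thesis
      using Im_height_coord[OF zeta ne[OF yc y(2)]] sph[OF y(1)] aff[OF yc y(2)] y(3) by simp
  qed
  have ImA: "Im A = 0" using line[of "\<i>"] line[of "\<i> + 1"] by simp
  have AB: "Re A + Im B = 1" using line[of "\<i>"] by simp
  have A1: "A = 1"
  proof (rule ccontr)
    assume "A \<noteq> 1"
    then have A: "1 - Re A \<noteq> 0" using ImA by (auto simp: complex_eq_iff)
    \<comment> \<open>The affine map fixes \<open>\<kappa>\<close>.\<close>
    define \<kappa> where "\<kappa> = B / of_real (1 - Re A)"
    have "Im \<kappa> = 1" using A AB by (simp add: \<kappa>_def del: of_real_diff)
    then obtain y where y: "y \<in> sphere 0 1" "y \<noteq> \<zeta>" "height_coord \<zeta> y = \<kappa>"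
      using height_coord_on_line[OF zeta] by metis
    then have yc: "y \<in> cball 0 1" by simp
    have "A = of_real (Re A)" using ImA by (simp add: complex_eq_iff)
    then have "(1 - A) * \<kappa> = B"
      using A unfolding \<kappa>_def by (metis nonzero_eq_divide_eq mult.commute of_real_1 of_real_diff of_real_eq_0_iff)
    then have "A * \<kappa> + B = \<kappa>" by (simp add: algebra_simps)
    then have "height_coord \<zeta> (\<psi> y) = height_coord \<zeta> y" using aff[OF yc y(2)] y(3) by simp
    then have "\<psi> y = y" using height_coord_inj[OF z0 ne[OF yc y(2)] y(2)] by simp
    then show False using uniq[OF yc] y(2) by blast
  qed
  define b where "b = Re B"
  have Bb: "B = of_real b" using AB A1 by (simp add: b_def complex_eq_iff)
  have form: "\<psi> u = parabolic \<zeta> b u" if u: "u \<in> cball 0 1" for u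
  proof (cases "u = \<zeta>")
    case True
    then show ?thesis using z(2) z0 by (simp add: parabolic_fixed_point)
  next
    case False
    then show ?thesis
      using aff[OF u False] height_coord_parabolic[OF zeta u False, of b] A1 Bb
      by (intro height_coord_inj[OF z0 ne[OF u False] parabolic_neq_fixed_point[OF zeta u False]]) simp
  qed
  moreover have "b \<noteq> 0"
    using nid form parabolic_0[OF zeta] by auto
  ultimately show ?thesis using that zeta by blast
qed

lemma card_int_translates_le:
  fixes x b c :: real
  assumes "b \<noteq> 0"
  shows "finite {n::int. \<bar>x + of_int n * b\<bar> \<le> c}"
    and "card {n::int. \<bar>x + of_int n * b\<bar> \<le> c} \<le> nat (\<lfloor>2 * c / \<bar>b\<bar>\<rfloor> + 1)"
proof -
  let ?A = "{n::int. \<bar>x + of_int n * b\<bar> \<le> c}"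
  define x' where "x' = x / b"
  define c' where "c' = c / \<bar>b\<bar>"
  have "?A \<subseteq> {\<lceil>- x' - c'\<rceil>..\<lfloor>c' - x'\<rfloor>}"
  proof
    fix n assume "n \<in> ?A"
    then have "\<bar>x + of_int n * b\<bar> / \<bar>b\<bar> \<le> c'" using assms by (simp add: c'_def divide_right_mono)
    moreover have "\<bar>x + of_int n * b\<bar> / \<bar>b\<bar> = \<bar>x' + of_int n\<bar>"
      using assms by (simp add: x'_def abs_divide[symmetric] add_divide_distrib)
    ultimately have "\<bar>x' + of_int n\<bar> \<le> c'" by simp
    then show "n \<in> {\<lceil>- x' - c'\<rceil>..\<lfloor>c' - x'\<rfloor>}"
      by (auto simp: ceiling_le_iff le_floor_iff)
  qed
  then show "finite ?A" by (rule finite_subset) simp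
  have "card ?A \<le> card {\<lceil>- x' - c'\<rceil>..\<lfloor>c' - x'\<rfloor>}"
    by (rule card_mono) (use \<open>?A \<subseteq> _\<close> in auto)
  also have "\<dots> = nat (\<lfloor>c' - x'\<rfloor> - \<lceil>- x' - c'\<rceil> + 1)" by simp
  also have "\<dots> \<le> nat (\<lfloor>2 * c / \<bar>b\<bar>\<rfloor> + 1)"
  proof -
    have "real_of_int (\<lfloor>c' - x'\<rfloor> - \<lceil>- x' - c'\<rceil>) \<le> 2 * c / \<bar>b\<bar>"
    proof -
      have "2 * c / \<bar>b\<bar> = 2 * c'" by (simp add: c'_def)
      then show ?thesis
        using of_int_floor_le[of "c' - x'"] le_of_int_ceiling[of "- x' - c'"]
        unfolding of_int_diff by linarith
    qed
    then have "\<lfloor>c' - x'\<rfloor> - \<lceil>- x' - c'\<rceil> \<le> \<lfloor>2 * c / \<bar>b\<bar>\<rfloor>" by (simp add: le_floor_iff)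
    then show ?thesis by simp
  qed
  finally show "card ?A \<le> nat (\<lfloor>2 * c / \<bar>b\<bar>\<rfloor> + 1)" .
qed

section \<open>Orbits and growth of the cocycle\<close>

text \<open>The product is cut into blocks of length \<open>p\<close>. A block with a start outside \<open>E\<close> contributes at most
  \<open>\<rho>\<^sup>p\<close>; the at most \<open>K\<close> other blocks and the incomplete last one are estimated crudely.\<close>

lemma prod_le_of_block_bounds:
  fixes g :: "nat \<Rightarrow> real"
  assumes "p > 0" "\<rho> > 0"
    and "\<And>j. j < n \<Longrightarrow> 0 \<le> g j \<and> g j \<le> B"
    and "finite E" "card E \<le> K"
    and "\<And>j. j \<notin> E \<Longrightarrow> j + p \<le> n \<Longrightarrow> (\<Prod>i<p. g (j + i)) \<le> \<rho> ^ p"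
  shows "(\<Prod>j<n. g j) \<le> max 1 (B / \<rho>) ^ (p * (K + 1)) * \<rho> ^ n"
  using assms(3-)
proof (induction n arbitrary: g E K rule: less_induct)
  case (less n)
  define D where "D = max 1 (B / \<rho>)"
  have D1: "D \<ge> 1" by (simp add: D_def)
  have "B / \<rho> \<le> D" by (simp add: D_def)
  then have "B \<le> D * \<rho>" using assms(2) by (simp add: field_simps)
  then have gD: "0 \<le> g j" "g j \<le> D * \<rho>" if "j < n" for j
    using less.prems(1)[OF that] by auto
  have crude: "(\<Prod>j<m. g j) \<le> D ^ m * \<rho> ^ m" if "m \<le> n" for m
  proof -
    have "(\<Prod>j<m. g j) \<le> (\<Prod>j<m. D * \<rho>)"
      using gD that by (intro prod_mono) auto
    then show ?thesis by (simp add: power_mult_distrib)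
  qed
  show ?case unfolding D_def[symmetric]
  proof (cases "n < p")
    case True
    have "D ^ n \<le> D ^ (p * (K + 1))"
      using D1 True by (intro power_increasing) auto
    then show "(\<Prod>j<n. g j) \<le> D ^ (p * (K + 1)) * \<rho> ^ n"
      using crude[of n] assms(2) by (auto intro: order_trans mult_right_mono)
  next
    case False
    define m where "m = n - p"
    have n: "n = p + m" using False by (simp add: m_def)
    define g' where "g' j = g (p + j)" for j
    define E' where "E' = {j. p + j \<in> E}"
    have img: "(\<lambda>j. p + j) ` E' \<subseteq> E - {0}" using assms(1) by (auto simp: E'_def)
    have finE': "finite E'"
      by (rule finite_imageD[OF finite_subset[OF img]]) (use less.prems(2) in auto)
    have cardE': "card E' \<le> card (E - {0})"
      using card_mono[OF _ img] less.prems(2) by (simp add: card_image)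
    have split: "(\<Prod>j<n. g j) = (\<Prod>j<p. g j) * (\<Prod>j<m. g' j)"
      unfolding n g'_def by (induction m) (simp_all add: mult.assoc)
    have IH: "(\<Prod>j<m. g' j) \<le> D ^ (p * (K' + 1)) * \<rho> ^ m" if "card E' \<le> K'" for K'
      unfolding D_def
    proof (rule less.IH[OF _ _ finE' that])
      show "m < n" using n assms(1) by simp
      show "0 \<le> g' j \<and> g' j \<le> B" if "j < m" for j
        using less.prems(1)[of "p + j"] that n by (simp add: g'_def)
      show "(\<Prod>i<p. g' (j + i)) \<le> \<rho> ^ p" if "j \<notin> E'" "j + p \<le> m" for j
        using less.prems(4)[of "p + j"] that n by (simp add: g'_def E'_def add.assoc)
    qed
    have nn: "0 \<le> (\<Prod>j<m. g' j)"
      using gD(1) n by (intro prod_nonneg) (auto simp: g'_def)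
    show "(\<Prod>j<n. g j) \<le> D ^ (p * (K + 1)) * \<rho> ^ n"
    proof (cases "0 \<in> E")
      case False
      have "(\<Prod>j<p. g j) \<le> \<rho> ^ p" using less.prems(4)[OF False] n by simp
      moreover have "card E' \<le> K" using cardE' False less.prems(3) by simp
      ultimately have "(\<Prod>j<p. g j) * (\<Prod>j<m. g' j) \<le> \<rho> ^ p * (D ^ (p * (K + 1)) * \<rho> ^ m)"
        using nn assms(2) IH by (intro mult_mono) auto
      then show ?thesis unfolding split by (simp add: n power_add mult_ac)
    next
      case True
      have c: "card (E - {0}) = card E - 1" "card E > 0"
        using True less.prems(2) by (auto simp: card_gt_0_iff)
      define K' where "K' = K - 1"
      have K: "K = K' + 1" "card E' \<le> K'" using c cardE' less.prems(3) by (auto simp: K'_def)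
      have "(\<Prod>j<p. g j) * (\<Prod>j<m. g' j) \<le> (D ^ p * \<rho> ^ p) * (D ^ (p * (K' + 1)) * \<rho> ^ m)"
        using nn assms(2) D1 IH[OF K(2)] crude[of p] n by (intro mult_mono) auto
      also have "\<dots> = D ^ (p * (K + 1)) * \<rho> ^ n"
        by (simp add: K n power_add algebra_simps)
      finally show ?thesis unfolding split .
    qed
  qed
qed

text \<open>The dynamics, in the normal form of the parabolic map. Integer iterates are available because
  both factors are invertible.\<close>

locale parabolic_rotation =
  fixes \<alpha> \<zeta> :: complex and p :: nat and b :: real
  assumes alpha_power: "\<alpha> ^ p = 1" and p_pos: "p > 0"
    and norm_zeta: "cmod \<zeta> = 1" and b_nonzero: "b \<noteq> 0"
begin

definition \<Phi> :: "int \<Rightarrow> complex \<times> complex \<Rightarrow> complex \<times> complex" where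
  "\<Phi> n z = (\<alpha> powi n * fst z, parabolic \<zeta> (of_int n * b) (snd z))"

lemma norm_alpha: "cmod \<alpha> = 1"
proof -
  have "cmod \<alpha> ^ p = 1" using alpha_power by (metis norm_one norm_power)
  then show ?thesis using p_pos power_eq_1_iff[of "cmod \<alpha>" p] by auto
qed

lemma zeta_in: "\<zeta> \<in> sphere 0 1" "\<zeta> \<in> cball 0 1"
  using norm_zeta by auto

lemma alpha_nonzero: "\<alpha> \<noteq> 0"
  using norm_alpha by auto

lemma norm_alpha_powi: "cmod (\<alpha> powi n) = 1"
  by (simp add: norm_power_int norm_alpha)

lemma Phi_add:
  assumes "z \<in> closed_bidisc"
  shows "\<Phi> m (\<Phi> n z) = \<Phi> (m + n) z"
proof -
  have "snd z \<in> cball 0 1" using assms by auto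
  then show ?thesis
    by (simp add: \<Phi>_def parabolic_add[OF norm_zeta] power_int_add alpha_nonzero algebra_simps)
qed

lemma Phi_0: "\<Phi> 0 z = z"
  by (simp add: \<Phi>_def parabolic_0[OF norm_zeta])

lemma Phi_in_closed_bidisc: "z \<in> closed_bidisc \<Longrightarrow> \<Phi> n z \<in> closed_bidisc"
  using parabolic_in_disc(1)[OF norm_zeta, of "snd z"]
  by (auto simp: \<Phi>_def norm_mult norm_alpha_powi)

lemma Phi_in_torus: "z \<in> torus \<Longrightarrow> \<Phi> n z \<in> torus"
  using parabolic_in_disc(3)[OF norm_zeta, of "snd z"]
  by (auto simp: \<Phi>_def norm_mult norm_alpha_powi)

lemma Phi_in_cylinder: "z \<in> sphere 0 1 \<times> cball 0 1 \<Longrightarrow> \<Phi> n z \<in> sphere 0 1 \<times> cball 0 1"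
  using parabolic_in_disc(1)[OF norm_zeta, of "snd z"]
  by (auto simp: \<Phi>_def norm_mult norm_alpha_powi)

lemma Phi_zeta: "\<Phi> n (x, \<zeta>) = (\<alpha> powi n * x, \<zeta>)"
proof -
  have "\<zeta> \<noteq> 0" using norm_zeta by auto
  then show ?thesis by (simp add: \<Phi>_def parabolic_fixed_point)
qed

lemma continuous_on_Phi: "continuous_on closed_bidisc (\<Phi> n)"
  unfolding \<Phi>_def[abs_def]
  by (intro continuous_intros continuous_on_compose2[OF continuous_on_parabolic[OF norm_zeta order_refl]]) auto

lemma inj_snd_Phi:
  assumes "z \<in> closed_bidisc" "snd z \<noteq> \<zeta>"
  shows "inj (\<lambda>n. snd (\<Phi> n z))"
proof (rule injI)
  fix m n assume "snd (\<Phi> m z) = snd (\<Phi> n z)"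
  moreover have "snd z \<in> cball 0 1" using assms by auto
  ultimately have "of_real (of_int m * b) = (of_real (of_int n * b) :: complex)"
    using height_coord_parabolic[OF norm_zeta _ assms(2), of "of_int m * b"]
      height_coord_parabolic[OF norm_zeta _ assms(2), of "of_int n * b"]
    unfolding \<Phi>_def snd_conv by (metis add_left_cancel)
  then show "m = n" using b_nonzero by (simp only: of_real_eq_iff) simp
qed

lemma apply_bidisc_compose_Phi:
  assumes "z \<in> closed_bidisc"
  shows "apply_bidisc (bidisc_of (\<lambda>z. apply_bidisc f (\<Phi> n z))) z = apply_bidisc f (\<Phi> n z)"
proof (rule apply_bidisc_of[OF _ _ _ assms])
  show "continuous_on closed_bidisc (\<lambda>z. apply_bidisc f (\<Phi> n z))"
    by (rule continuous_on_compose2[OF continuous_on_apply_bidisc continuous_on_Phi])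
      (use Phi_in_closed_bidisc in blast)
  show "(\<lambda>x. apply_bidisc f (\<Phi> n (x, y))) holomorphic_on ball 0 1" if y: "y \<in> ball 0 1" for y
  proof -
    have y': "parabolic \<zeta> (of_int n * b) y \<in> cball 0 1"
      using parabolic_in_disc(1)[OF norm_zeta] y by auto
    have "((\<lambda>x. apply_bidisc f (x, parabolic \<zeta> (of_int n * b) y)) \<circ> (\<lambda>x. \<alpha> powi n * x)) holomorphic_on ball 0 1"
      by (rule holomorphic_on_compose_gen[OF _ holomorphic_slice_fst[OF y']])
        (auto intro!: holomorphic_intros simp: norm_mult norm_alpha_powi)
    then show ?thesis by (simp add: \<Phi>_def o_def)
  qed
  show "(\<lambda>y. apply_bidisc f (\<Phi> n (x, y))) holomorphic_on ball 0 1" if x: "x \<in> ball 0 1" for x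
  proof -
    have x': "\<alpha> powi n * x \<in> cball 0 1" using x by (simp add: norm_mult norm_alpha_powi)
    have "((\<lambda>y. apply_bidisc f (\<alpha> powi n * x, y)) \<circ> parabolic \<zeta> (of_int n * b)) holomorphic_on ball 0 1"
      by (rule holomorphic_on_compose_gen[OF _ holomorphic_slice_snd[OF x']])
        (use parabolic_in_disc(2)[OF norm_zeta] in \<open>auto intro!: holomorphic_on_parabolic[OF norm_zeta]\<close>)
    then show ?thesis by (simp add: \<Phi>_def o_def)
  qed
qed

text \<open>Far from \<open>\<zeta>\<close> means a bounded value of the coordinate, and translations by multiples of \<open>b\<close>
  visit an interval a bounded number of times, with a bound that depends on its length only.\<close>

lemma card_orbit_away_from_zeta:
  assumes "d > 0"
  obtains K where "\<And>z. z \<in> closed_bidisc \<Longrightarrow> finite {n. d \<le> dist (snd (\<Phi> n z)) \<zeta>}"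
    "\<And>z. z \<in> closed_bidisc \<Longrightarrow> card {n. d \<le> dist (snd (\<Phi> n z)) \<zeta>} \<le> K"
proof -
  define K where "K = nat (\<lfloor>2 * (2 / d) / \<bar>b\<bar>\<rfloor> + 1)"
  have "finite {n. d \<le> dist (snd (\<Phi> n z)) \<zeta>} \<and> card {n. d \<le> dist (snd (\<Phi> n z)) \<zeta>} \<le> K"
    if z: "z \<in> closed_bidisc" for z
  proof (cases "snd z = \<zeta>")
    case True
    then have "snd (\<Phi> n z) = \<zeta>" for n using Phi_zeta[of n "fst z"] by (simp add: \<Phi>_def)
    then show ?thesis using assms by simp
  next
    case False
    define x where "x = Re (height_coord \<zeta> (snd z))"
    let ?A = "{n::int. \<bar>x + of_int n * b\<bar> \<le> 2 / d}"
    have sub: "{n. d \<le> dist (snd (\<Phi> n z)) \<zeta>} \<subseteq> ?A"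
    proof (rule subsetI, unfold mem_Collect_eq)
      fix n assume n: "d \<le> dist (snd (\<Phi> n z)) \<zeta>"
      let ?h = "height_coord \<zeta> (snd z) + of_real (of_int n * b)"
      have "snd z \<in> cball 0 1" using z by auto
      then have d: "d \<le> 2 / cmod ?h"
        using n dist_parabolic_fixed_point[OF norm_zeta _ False] by (simp add: \<Phi>_def)
      then have "cmod ?h > 0" using assms by (smt (verit) divide_nonneg_nonpos norm_ge_zero divide_eq_0_iff)
      then have "cmod ?h \<le> 2 / d" using d assms by (simp add: field_simps)
      moreover have "\<bar>x + of_int n * b\<bar> \<le> cmod ?h"
        using abs_Re_le_cmod[of ?h] by (simp add: x_def)
      ultimately show "\<bar>x + of_int n * b\<bar> \<le> 2 / d" by linarith
    qed
    have "finite ?A" "card ?A \<le> K"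
      unfolding K_def by (rule card_int_translates_le[OF b_nonzero])+
    then show ?thesis
      using sub finite_subset card_mono by (metis (no_types, lifting) order_trans)
  qed
  then show ?thesis using that by blast
qed

text \<open>The weight of the \<open>n\<close>-th power of the operator.\<close>

definition cocycle :: "bidisc_algebra \<Rightarrow> nat \<Rightarrow> complex \<times> complex \<Rightarrow> complex" where
  "cocycle w n z = (\<Prod>j<n. apply_bidisc w (\<Phi> (int j) z))"

lemma cocycle_0 [simp]: "cocycle w 0 z = 1"
  by (simp add: cocycle_def)

lemma cocycle_Suc: "cocycle w (Suc n) z = cocycle w n z * apply_bidisc w (\<Phi> (int n) z)"
  by (simp add: cocycle_def)

lemma cocycle_Suc_shift:
  assumes "z \<in> closed_bidisc"
  shows "cocycle w (Suc n) z = apply_bidisc w z * cocycle w n (\<Phi> 1 z)"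
  unfolding cocycle_def prod.lessThan_Suc_shift
  by (simp add: Phi_0 Phi_add[OF assms] add.commute)

lemma continuous_on_cocycle: "continuous_on closed_bidisc (cocycle w n)"
  unfolding cocycle_def[abs_def]
  by (intro continuous_on_prod continuous_on_compose2[OF continuous_on_apply_bidisc continuous_on_Phi])
    (use Phi_in_closed_bidisc in blast)

lemma cylinder_near_zeta:
  fixes H :: "complex \<times> complex \<Rightarrow> real"
  assumes "continuous_on closed_bidisc H" "\<And>x. x \<in> sphere 0 1 \<Longrightarrow> H (x, \<zeta>) < c"
  obtains d where "d > 0"
    "\<And>z. z \<in> sphere 0 1 \<times> cball 0 1 \<Longrightarrow> dist (snd z) \<zeta> < d \<Longrightarrow> H z < c"
proof -
  have ne: "sphere (0::complex) 1 \<noteq> {}" using zeta_in by blast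
  have "continuous_on (sphere 0 1) (\<lambda>x. H (x, \<zeta>))"
    by (rule continuous_on_compose2[OF assms(1)]) (use norm_zeta in \<open>auto intro!: continuous_intros\<close>)
  from continuous_attains_sup[OF compact_sphere ne this]
  obtain x0 where x0: "x0 \<in> sphere 0 1" "\<And>x. x \<in> sphere 0 1 \<Longrightarrow> H (x, \<zeta>) \<le> H (x0, \<zeta>)" by blast
  define e where "e = c - H (x0, \<zeta>)"
  have "e > 0" using assms(2)[OF x0(1)] by (simp add: e_def)
  then obtain d where d: "d > 0"
    "\<And>u v. u \<in> closed_bidisc \<Longrightarrow> v \<in> closed_bidisc \<Longrightarrow> dist u v < d \<Longrightarrow> dist (H u) (H v) < e"
    using compact_uniformly_continuous[OF assms(1) compact_closed_bidisc]
    unfolding uniformly_continuous_on_def by metis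
  show ?thesis
  proof (rule that[OF d(1)])
    fix z :: "complex \<times> complex"
    assume z: "z \<in> sphere 0 1 \<times> cball 0 1" "dist (snd z) \<zeta> < d"
    then obtain x y where xy: "z = (x, y)" "x \<in> sphere 0 1" "y \<in> cball 0 1" by auto
    have "dist (H (x, y)) (H (x, \<zeta>)) < e"
      by (rule d(2)) (use xy z norm_zeta in \<open>auto simp: dist_Pair_Pair\<close>)
    moreover have "H (x, \<zeta>) \<le> H (x0, \<zeta>)" using x0(2) xy by blast
    ultimately show "H z < c" by (simp add: xy e_def dist_real_def)
  qed
qed

text \<open>One growth estimate serves for upper bounds (\<open>G = |w|\<close>) and for lower bounds (\<open>G = 1 / |w|\<close>) of
  cocycles: only blocks near \<open>\<zeta>\<close> matter.\<close>

lemma orbit_product_bound: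
  assumes "d > 0" "\<rho> > 0"
  obtains C where "C > 0"
    "\<And>G z n. \<lbrakk>z \<in> closed_bidisc; \<And>j. j < n \<Longrightarrow> 0 \<le> G (\<Phi> (int j) z) \<and> G (\<Phi> (int j) z) \<le> (B::real);
       \<And>j. j + p \<le> n \<Longrightarrow> dist (snd (\<Phi> (int j) z)) \<zeta> < d \<Longrightarrow> (\<Prod>i<p. G (\<Phi> (int (j + i)) z)) \<le> \<rho> ^ p\<rbrakk>
       \<Longrightarrow> (\<Prod>j<n. G (\<Phi> (int j) z)) \<le> C * \<rho> ^ n"
proof -
  obtain K where K: "\<And>z. z \<in> closed_bidisc \<Longrightarrow> finite {n. d \<le> dist (snd (\<Phi> n z)) \<zeta>}"
    "\<And>z. z \<in> closed_bidisc \<Longrightarrow> card {n. d \<le> dist (snd (\<Phi> n z)) \<zeta>} \<le> K"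
    using card_orbit_away_from_zeta[OF assms(1)] by metis
  show ?thesis
  proof (rule that)
    show "max 1 (B / \<rho>) ^ (p * (K + 1)) > 0" by simp
    fix G :: "complex \<times> complex \<Rightarrow> real" and z :: "complex \<times> complex" and n
    assume z: "z \<in> closed_bidisc" and G: "\<And>j. j < n \<Longrightarrow> 0 \<le> G (\<Phi> (int j) z) \<and> G (\<Phi> (int j) z) \<le> B"
      and blk: "\<And>j. j + p \<le> n \<Longrightarrow> dist (snd (\<Phi> (int j) z)) \<zeta> < d \<Longrightarrow> (\<Prod>i<p. G (\<Phi> (int (j + i)) z)) \<le> \<rho> ^ p"
    define E where "E = {j::nat. d \<le> dist (snd (\<Phi> (int j) z)) \<zeta>}"
    have sub: "int ` E \<subseteq> {n. d \<le> dist (snd (\<Phi> n z)) \<zeta>}" by (auto simp: E_def)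
    have finE: "finite E"
      by (rule finite_imageD[OF finite_subset[OF sub K(1)[OF z]]]) auto
    have "card E = card (int ` E)" by (simp add: card_image)
    also have "\<dots> \<le> K" using card_mono[OF K(1)[OF z] sub] K(2)[OF z] by linarith
    finally have "card E \<le> K" .
    then show "(\<Prod>j<n. G (\<Phi> (int j) z)) \<le> max 1 (B / \<rho>) ^ (p * (K + 1)) * \<rho> ^ n"
      by (intro prod_le_of_block_bounds[OF p_pos assms(2) G finE]) (use blk in \<open>auto simp: E_def\<close>)
  qed
qed

lemma cocycle_upper_bound:
  assumes "\<rho> > 0" "\<And>x. x \<in> sphere 0 1 \<Longrightarrow> cmod (cocycle w p (x, \<zeta>)) < \<rho> ^ p"
  obtains C where "C > 0" "\<And>z n. z \<in> torus \<Longrightarrow> cmod (cocycle w n z) \<le> C * \<rho> ^ n"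
proof -
  obtain d where d: "d > 0"
    "\<And>z. z \<in> sphere 0 1 \<times> cball 0 1 \<Longrightarrow> dist (snd z) \<zeta> < d \<Longrightarrow> cmod (cocycle w p z) < \<rho> ^ p"
    using cylinder_near_zeta[OF continuous_on_norm[OF continuous_on_cocycle] assms(2)] by metis
  obtain C where C: "C > 0"
    "\<And>G z n. \<lbrakk>z \<in> closed_bidisc; \<And>j. j < n \<Longrightarrow> 0 \<le> G (\<Phi> (int j) z) \<and> G (\<Phi> (int j) z) \<le> norm w;
       \<And>j. j + p \<le> n \<Longrightarrow> dist (snd (\<Phi> (int j) z)) \<zeta> < d \<Longrightarrow> (\<Prod>i<p. G (\<Phi> (int (j + i)) z)) \<le> \<rho> ^ p\<rbrakk>
       \<Longrightarrow> (\<Prod>j<n. G (\<Phi> (int j) z)) \<le> C * \<rho> ^ n"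
    using orbit_product_bound[OF d(1) assms(1), of "norm w"] by metis
  show ?thesis
  proof (rule that[OF C(1)])
    fix z :: "complex \<times> complex" and n assume z: "z \<in> torus"
    then have zc: "z \<in> closed_bidisc" by auto
    have "(\<Prod>j<n. cmod (apply_bidisc w (\<Phi> (int j) z))) \<le> C * \<rho> ^ n"
    proof (rule C(2)[OF zc])
      show "0 \<le> cmod (apply_bidisc w (\<Phi> (int j) z)) \<and> cmod (apply_bidisc w (\<Phi> (int j) z)) \<le> norm w" for j
        using norm_apply_le[OF Phi_in_closed_bidisc[OF zc]] by simp
      fix j assume "dist (snd (\<Phi> (int j) z)) \<zeta> < d"
      moreover have "\<Phi> (int j) z \<in> sphere 0 1 \<times> cball 0 1" using Phi_in_torus[OF z, of "int j"] by auto
      ultimately have "cmod (cocycle w p (\<Phi> (int j) z)) < \<rho> ^ p" by (intro d(2))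
      then show "(\<Prod>i<p. cmod (apply_bidisc w (\<Phi> (int (j + i)) z))) \<le> \<rho> ^ p"
        by (simp add: cocycle_def Phi_add[OF zc] prod_norm add.commute)
    qed
    then show "cmod (cocycle w n z) \<le> C * \<rho> ^ n" by (simp add: cocycle_def prod_norm)
  qed
qed

text \<open>The bound below for \<open>w\<close> follows from that for the cocycle, because the other factors are bounded.\<close>

lemma cocycle_lower_bound_near_zeta:
  assumes "\<rho> > 0" "\<And>x. x \<in> sphere 0 1 \<Longrightarrow> \<rho> ^ p < cmod (cocycle w p (x, \<zeta>))"
  obtains d m where "d > 0" "m > 0"
    "\<And>z. z \<in> sphere 0 1 \<times> cball 0 1 \<Longrightarrow> dist (snd z) \<zeta> < d \<Longrightarrow> \<rho> ^ p < cmod (cocycle w p z)"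
    "\<And>z. z \<in> sphere 0 1 \<times> cball 0 1 \<Longrightarrow> dist (snd z) \<zeta> < d \<Longrightarrow> m < cmod (apply_bidisc w z)"
proof -
  have cont: "continuous_on closed_bidisc (\<lambda>z. - cmod (cocycle w p z))"
    by (intro continuous_intros continuous_on_cocycle)
  obtain d where d: "d > 0"
    "\<And>z. z \<in> sphere 0 1 \<times> cball 0 1 \<Longrightarrow> dist (snd z) \<zeta> < d \<Longrightarrow> - cmod (cocycle w p z) < - (\<rho> ^ p)"
    using cylinder_near_zeta[OF cont, of "- (\<rho> ^ p)"] assms(2) by auto
  define B where "B = norm w + 1"
  have B: "B > 0" by (simp add: B_def add_nonneg_pos)
  define m where "m = \<rho> ^ p / B ^ (p - 1)"
  show ?thesis
  proof (rule that[of d "m"])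
    show "d > 0" "m > 0" using d B assms(1) by (auto simp: m_def)
    fix z :: "complex \<times> complex" assume z: "z \<in> sphere 0 1 \<times> cball 0 1" "dist (snd z) \<zeta> < d"
    show lt: "\<rho> ^ p < cmod (cocycle w p z)" using d(2)[OF z] by simp
    have zc: "z \<in> closed_bidisc" using z by auto
    have wB: "cmod (apply_bidisc w u) \<le> B" if "u \<in> closed_bidisc" for u
      using norm_apply_le[OF that, of w] by (simp add: B_def)
    have "cocycle w p z = apply_bidisc w z * cocycle w (p - 1) (\<Phi> 1 z)"
      using cocycle_Suc_shift[OF zc, of w "p - 1"] p_pos by simp
    moreover have "cmod (cocycle w (p - 1) (\<Phi> 1 z)) \<le> (\<Prod>j<p - 1. B)"
      unfolding cocycle_def prod_norm[symmetric]
      using wB Phi_in_closed_bidisc zc by (intro prod_mono) auto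
    ultimately have "cmod (cocycle w p z) \<le> cmod (apply_bidisc w z) * B ^ (p - 1)"
      by (simp add: norm_mult mult_left_mono)
    with lt have "\<rho> ^ p < cmod (apply_bidisc w z) * B ^ (p - 1)" by simp
    then show "m < cmod (apply_bidisc w z)"
      unfolding m_def using B by (simp add: divide_less_eq)
  qed
qed

lemma inverse_cocycle_bound_of_lower_bound:
  assumes "\<rho> > 0" and "m > 0" and "d > 0"
    and d: "\<And>z. z \<in> sphere 0 1 \<times> cball 0 1 \<Longrightarrow> dist (snd z) \<zeta> < d \<Longrightarrow> \<rho> ^ p < cmod (cocycle w p z)"
  obtains C where "C > 0"
    "\<And>z n. z \<in> sphere 0 1 \<times> cball 0 1 \<Longrightarrow> (\<And>j. j < n \<Longrightarrow> m \<le> cmod (apply_bidisc w (\<Phi> (int j) z))) \<Longrightarrow>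
       1 / cmod (cocycle w n z) \<le> C * (1 / \<rho>) ^ n"
proof -
  have r: "1 / \<rho> > 0" using assms(1) by simp
  obtain C where C: "C > 0"
    "\<And>G z n. \<lbrakk>z \<in> closed_bidisc; \<And>j. j < n \<Longrightarrow> 0 \<le> G (\<Phi> (int j) z) \<and> G (\<Phi> (int j) z) \<le> 1 / m;
       \<And>j. j + p \<le> n \<Longrightarrow> dist (snd (\<Phi> (int j) z)) \<zeta> < d \<Longrightarrow> (\<Prod>i<p. G (\<Phi> (int (j + i)) z)) \<le> (1 / \<rho>) ^ p\<rbrakk>
       \<Longrightarrow> (\<Prod>j<n. G (\<Phi> (int j) z)) \<le> C * (1 / \<rho>) ^ n"
    using orbit_product_bound[OF assms(3) r, of "1 / m"] by metis
  show ?thesis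
  proof (rule that[OF C(1)])
    fix z :: "complex \<times> complex" and n
    assume z: "z \<in> sphere 0 1 \<times> cball 0 1" and le: "\<And>j. j < n \<Longrightarrow> m \<le> cmod (apply_bidisc w (\<Phi> (int j) z))"
    have zc: "z \<in> closed_bidisc" using z by auto
    have "(\<Prod>j<n. 1 / cmod (apply_bidisc w (\<Phi> (int j) z))) \<le> C * (1 / \<rho>) ^ n"
    proof (rule C(2)[OF zc])
      show "0 \<le> 1 / cmod (apply_bidisc w (\<Phi> (int j) z)) \<and> 1 / cmod (apply_bidisc w (\<Phi> (int j) z)) \<le> 1 / m"
        if "j < n" for j
        using le[OF that] assms(2) by (auto intro!: divide_left_mono mult_pos_pos)
      fix j assume j: "dist (snd (\<Phi> (int j) z)) \<zeta> < d"
      have lt: "\<rho> ^ p < cmod (cocycle w p (\<Phi> (int j) z))"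
        by (rule d[OF Phi_in_cylinder[OF z] j])
      have "(\<Prod>i<p. 1 / cmod (apply_bidisc w (\<Phi> (int (j + i)) z))) = 1 / cmod (cocycle w p (\<Phi> (int j) z))"
        by (simp add: cocycle_def Phi_add[OF zc] prod_norm[symmetric] prod_dividef add.commute)
      also have "\<dots> \<le> 1 / \<rho> ^ p"
        using lt assms(1) by (intro divide_left_mono mult_pos_pos) (auto intro: less_trans[OF zero_less_power])
      finally show "(\<Prod>i<p. 1 / cmod (apply_bidisc w (\<Phi> (int (j + i)) z))) \<le> (1 / \<rho>) ^ p"
        by (simp add: power_divide)
    qed
    then show "1 / cmod (cocycle w n z) \<le> C * (1 / \<rho>) ^ n"
      by (simp add: cocycle_def prod_norm[symmetric] prod_dividef)
  qed
qed

lemma inverse_cocycle_bound_torus: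
  assumes r: "\<rho> > 0" "\<And>x. x \<in> sphere 0 1 \<Longrightarrow> \<rho> ^ p < cmod (cocycle w p (x, \<zeta>))"
    and nz: "\<And>z. z \<in> torus \<Longrightarrow> apply_bidisc w z \<noteq> 0"
  obtains C where "C > 0" "\<And>z n. z \<in> torus \<Longrightarrow> 1 / cmod (cocycle w n z) \<le> C * (1 / \<rho>) ^ n"
proof -
  obtain d m where d: "d > 0"
    "\<And>z. z \<in> sphere 0 1 \<times> cball 0 1 \<Longrightarrow> dist (snd z) \<zeta> < d \<Longrightarrow> \<rho> ^ p < cmod (cocycle w p z)"
    using cocycle_lower_bound_near_zeta[OF r] by metis
  have ne: "torus \<noteq> {}" using zeta_in by blast
  have "compact torus" by (intro compact_Times) auto
  moreover have "continuous_on torus (\<lambda>z. cmod (apply_bidisc w z))"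
    by (intro continuous_intros continuous_on_subset[OF continuous_on_apply_bidisc torus_subset_closed_bidisc])
  ultimately obtain z0 where z0: "z0 \<in> torus" "\<And>z. z \<in> torus \<Longrightarrow> cmod (apply_bidisc w z0) \<le> cmod (apply_bidisc w z)"
    using continuous_attains_inf[OF _ ne] by blast
  define m where "m = cmod (apply_bidisc w z0)"
  have m: "m > 0" using nz[OF z0(1)] by (simp add: m_def)
  obtain C where C: "C > 0"
    "\<And>z n. z \<in> sphere 0 1 \<times> cball 0 1 \<Longrightarrow> (\<And>j. j < n \<Longrightarrow> m \<le> cmod (apply_bidisc w (\<Phi> (int j) z))) \<Longrightarrow>
       1 / cmod (cocycle w n z) \<le> C * (1 / \<rho>) ^ n"
    using inverse_cocycle_bound_of_lower_bound[OF r(1) m d] by metis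
  show ?thesis
  proof (rule that[OF C(1)])
    show "1 / cmod (cocycle w n z) \<le> C * (1 / \<rho>) ^ n" if z: "z \<in> torus" for z n
      using C(2)[of z n] z z0(2)[OF Phi_in_torus[OF z]] by (auto simp: m_def)
  qed
qed

text \<open>Along one orbit zeros of \<open>w\<close> are harmless: there are finitely many, and between them \<open>|w|\<close> is bounded
  below because the orbit tends to cycles on which \<open>w\<close> has no zero.\<close>

lemma inverse_cocycle_bound_orbit:
  assumes r: "\<rho> > 0" "\<And>x. x \<in> sphere 0 1 \<Longrightarrow> \<rho> ^ p < cmod (cocycle w p (x, \<zeta>))"
    and z: "z \<in> sphere 0 1 \<times> cball 0 1"
  obtains C where "C > 0" "finite {n. apply_bidisc w (\<Phi> n z) = 0}"
    "\<And>k n. (\<And>j. j < n \<Longrightarrow> apply_bidisc w (\<Phi> (k + int j) z) \<noteq> 0) \<Longrightarrow>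
       1 / cmod (cocycle w n (\<Phi> k z)) \<le> C * (1 / \<rho>) ^ n"
proof -
  obtain d m where d: "d > 0" "m > 0"
    "\<And>z. z \<in> sphere 0 1 \<times> cball 0 1 \<Longrightarrow> dist (snd z) \<zeta> < d \<Longrightarrow> \<rho> ^ p < cmod (cocycle w p z)"
    "\<And>z. z \<in> sphere 0 1 \<times> cball 0 1 \<Longrightarrow> dist (snd z) \<zeta> < d \<Longrightarrow> m < cmod (apply_bidisc w z)"
    using cocycle_lower_bound_near_zeta[OF r] by metis
  have zc: "z \<in> closed_bidisc" using z by auto
  define A where "A = {n. d \<le> dist (snd (\<Phi> n z)) \<zeta>}"
  have A: "finite A" using card_orbit_away_from_zeta[OF d(1)] zc unfolding A_def by metis
  have notA: "m < cmod (apply_bidisc w (\<Phi> n z))" if "n \<notin> A" for n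
    using d(4)[OF Phi_in_cylinder[OF z]] that by (auto simp: A_def)
  define A' where "A' = {n \<in> A. apply_bidisc w (\<Phi> n z) \<noteq> 0}"
  define m' where "m' = Min (insert m ((\<lambda>n. cmod (apply_bidisc w (\<Phi> n z))) ` A'))"
  have A': "finite A'" using A by (simp add: A'_def)
  have m': "m' > 0" unfolding m'_def using A' d(2) by (subst Min_gr_iff) (auto simp: A'_def)
  have m'le: "m' \<le> cmod (apply_bidisc w (\<Phi> n z))" if "apply_bidisc w (\<Phi> n z) \<noteq> 0" for n
  proof (cases "n \<in> A")
    case True
    then show ?thesis unfolding m'_def using A' that by (intro Min_le) (auto simp: A'_def)
  next
    case False
    have "m' \<le> m" unfolding m'_def using A' by (intro Min_le) auto
    then show ?thesis using notA[OF False] by simp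
  qed
  obtain C where C: "C > 0"
    "\<And>z n. z \<in> sphere 0 1 \<times> cball 0 1 \<Longrightarrow> (\<And>j. j < n \<Longrightarrow> m' \<le> cmod (apply_bidisc w (\<Phi> (int j) z))) \<Longrightarrow>
       1 / cmod (cocycle w n z) \<le> C * (1 / \<rho>) ^ n"
    using inverse_cocycle_bound_of_lower_bound[OF r(1) m' d(1,3)] by metis
  show ?thesis
  proof (rule that[OF C(1)])
    have "{n. apply_bidisc w (\<Phi> n z) = 0} \<subseteq> A" using notA d(2) by force
    then show "finite {n. apply_bidisc w (\<Phi> n z) = 0}" using A by (rule finite_subset)
    fix k :: int and n assume nz: "\<And>j. j < n \<Longrightarrow> apply_bidisc w (\<Phi> (k + int j) z) \<noteq> 0"
    show "1 / cmod (cocycle w n (\<Phi> k z)) \<le> C * (1 / \<rho>) ^ n"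
      by (rule C(2)[OF Phi_in_cylinder[OF z]]) (use m'le nz in \<open>auto simp: Phi_add[OF zc] add.commute\<close>)
  qed
qed

end

section \<open>Powers of the operator and the resolvent\<close>

locale weighted_rotation = parabolic_rotation +
  fixes w :: bidisc_algebra and T :: "bidisc_algebra \<Rightarrow> bidisc_algebra"
  assumes apply_T: "\<And>f z. z \<in> closed_bidisc \<Longrightarrow> apply_bidisc (T f) z = apply_bidisc w z * apply_bidisc f (\<Phi> 1 z)"
begin

lemma bounded_clinear_T: "bounded_clinear T"
proof (rule bounded_clinearI)
  show "T (f + g) = T f + T g" "T (c *\<^sub>C f) = c *\<^sub>C T f" for c f g
    using Phi_in_closed_bidisc
    by (intro bidisc_eqI; simp add: apply_T apply_simps algebra_simps del: mem_Times_iff)+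
  show "norm (T f) \<le> norm f * norm w" for f
  proof (rule norm_bidisc_le)
    fix z :: "complex \<times> complex" assume z: "z \<in> closed_bidisc"
    have "cmod (apply_bidisc w z) * cmod (apply_bidisc f (\<Phi> 1 z)) \<le> norm w * norm f"
      using norm_apply_le[OF z] norm_apply_le[OF Phi_in_closed_bidisc[OF z]] by (intro mult_mono) auto
    then show "cmod (apply_bidisc (T f) z) \<le> norm f * norm w"
      unfolding apply_T[OF z] by (simp add: norm_mult mult.commute)
  qed
qed

lemma apply_T_power:
  assumes "z \<in> closed_bidisc"
  shows "apply_bidisc ((T ^^ n) f) z = cocycle w n z * apply_bidisc f (\<Phi> (int n) z)"
  using assms
proof (induction n arbitrary: z)
  case 0
  then show ?case by (simp add: Phi_0)
next
  case (Suc n)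
  then show ?case
    using Phi_in_closed_bidisc[OF Suc.prems, of 1]
    by (simp add: apply_T cocycle_Suc_shift Phi_add add.commute del: mem_Times_iff)
qed

lemma apply_shifted_T:
  assumes "z \<in> closed_bidisc"
  shows "apply_bidisc (shifted \<mu> T f) z = \<mu> * apply_bidisc f z - apply_bidisc w z * apply_bidisc f (\<Phi> 1 z)"
  using assms by (simp add: shifted_def apply_simps apply_T del: mem_Times_iff)

lemma norm_T_power_le:
  assumes "\<rho> > 0" "\<And>x. x \<in> sphere 0 1 \<Longrightarrow> cmod (cocycle w p (x, \<zeta>)) < \<rho> ^ p"
  obtains C where "C > 0" "\<And>n f. norm ((T ^^ n) f) \<le> C * \<rho> ^ n * norm f"
proof -
  obtain C where C: "C > 0" "\<And>z n. z \<in> torus \<Longrightarrow> cmod (cocycle w n z) \<le> C * \<rho> ^ n"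
    using cocycle_upper_bound[OF assms] by metis
  have "norm ((T ^^ n) f) \<le> C * \<rho> ^ n * norm f" for n f
  proof (rule norm_bidisc_le_torus)
    fix z :: "complex \<times> complex" assume z: "z \<in> torus"
    then have zc: "z \<in> closed_bidisc" by auto
    show "cmod (apply_bidisc ((T ^^ n) f) z) \<le> C * \<rho> ^ n * norm f"
      unfolding apply_T_power[OF zc] norm_mult
      using C(2)[OF z] C(1) assms(1) norm_apply_le[OF Phi_in_closed_bidisc[OF zc]]
      by (intro mult_mono) auto
  qed
  then show ?thesis using that C(1) by blast
qed

text \<open>On the torus \<open>T\<^sup>n\<close> can be inverted pointwise, and the torus determines the norm.\<close>

lemma norm_T_power_ge:
  assumes r: "\<rho> > 0" "\<And>x. x \<in> sphere 0 1 \<Longrightarrow> \<rho> ^ p < cmod (cocycle w p (x, \<zeta>))"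
    and nz: "\<And>z. z \<in> torus \<Longrightarrow> apply_bidisc w z \<noteq> 0"
  obtains C where "C > 0" "\<And>n f. norm f \<le> C * (1 / \<rho>) ^ n * norm ((T ^^ n) f)"
proof -
  obtain C where C: "C > 0" "\<And>z n. z \<in> torus \<Longrightarrow> 1 / cmod (cocycle w n z) \<le> C * (1 / \<rho>) ^ n"
    using inverse_cocycle_bound_torus[OF assms] by metis
  have "norm f \<le> C * (1 / \<rho>) ^ n * norm ((T ^^ n) f)" for n f
  proof (rule norm_bidisc_le_torus)
    fix z :: "complex \<times> complex" assume z: "z \<in> torus"
    then have zc: "z \<in> closed_bidisc" by auto
    \<comment> \<open>The value of f at z is recovered from the value of the power at the preimage of z.\<close>
    define u where "u = \<Phi> (- int n) z"
    have u: "u \<in> torus" "\<Phi> (int n) u = z"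
      using Phi_in_torus[OF z] by (simp_all add: u_def Phi_add[OF zc] Phi_0 del: mem_Times_iff)
    then have uc: "u \<in> closed_bidisc" by auto
    have "cocycle w n u \<noteq> 0"
      unfolding cocycle_def using nz Phi_in_torus[OF u(1)] by (simp del: mem_Times_iff)
    then have "cmod (apply_bidisc f z) = 1 / cmod (cocycle w n u) * cmod (apply_bidisc ((T ^^ n) f) u)"
      using u by (simp add: apply_T_power[OF uc] norm_mult)
    also have "\<dots> \<le> C * (1 / \<rho>) ^ n * norm ((T ^^ n) f)"
      using C(2)[OF u(1)] C(1) r(1) norm_apply_le[OF uc] by (intro mult_mono) auto
    finally show "cmod (apply_bidisc f z) \<le> C * (1 / \<rho>) ^ n * norm ((T ^^ n) f)" .
  qed
  then show ?thesis using that C(1) by blast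
qed

lemma notin_spectrum_if_large:
  assumes "0 < \<rho>" "\<rho> < cmod \<mu>" "\<And>x. x \<in> sphere 0 1 \<Longrightarrow> cmod (cocycle w p (x, \<zeta>)) < \<rho> ^ p"
  shows "\<mu> \<notin> spectrum T"
proof -
  obtain C where C: "C > 0" "\<And>n f. norm ((T ^^ n) f) \<le> C * \<rho> ^ n * norm f"
    using norm_T_power_le[OF assms(1,3)] by metis
  have mu: "\<mu> \<noteq> 0" using assms by auto
  define V where "V f = inverse \<mu> *\<^sub>C T f" for f
  interpret T: bounded_linear T using bounded_clinear_T by (simp add: bounded_clinear_def)
  have hom: "T (c *\<^sub>C f) = c *\<^sub>C T f" for c f
    using bounded_clinear_T unfolding bounded_clinear_def by blast
  have Vn: "(V ^^ n) f = inverse \<mu> ^ n *\<^sub>C (T ^^ n) f" for n f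
    by (induction n) (simp_all add: V_def hom scaleC_scaleC scaleC_one)
  have V: "bounded_clinear V"
  proof (rule bounded_clinearI)
    show "V (f + g) = V f + V g" for f g by (simp add: V_def T.add scaleC_add_right)
    show "V (c *\<^sub>C f) = c *\<^sub>C V f" for c f by (simp add: V_def hom scaleC_scaleC mult.commute)
    show "norm (V f) \<le> norm f * (cmod (inverse \<mu>) * C * \<rho>)" for f
      using mult_left_mono[OF C(2)[of 1 f], of "cmod (inverse \<mu>)"] by (simp add: V_def norm_scaleC mult_ac)
  qed
  have Vpow: "norm ((V ^^ n) f) \<le> C * (\<rho> / cmod \<mu>) ^ n * norm f" for n f
  proof -
    have "norm ((V ^^ n) f) \<le> inverse (cmod \<mu>) ^ n * (C * \<rho> ^ n * norm f)"
      unfolding Vn norm_scaleC norm_power norm_inverse by (rule mult_left_mono[OF C(2)]) simp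
    also have "\<dots> = C * (\<rho> / cmod \<mu>) ^ n * norm f"
      by (simp add: divide_inverse power_mult_distrib mult_ac)
    finally show ?thesis .
  qed
  have q: "0 \<le> \<rho> / cmod \<mu>" "\<rho> / cmod \<mu> < 1" using assms(1,2) mu by (auto simp: divide_less_eq)
  obtain S where S: "bounded_clinear S" "\<And>x. S (x - V x) = x" "\<And>x. S x - V (S x) = x"
    using Neumann_series_inverse[OF V less_imp_le[OF C(1)] q Vpow] by blast
  interpret S: bounded_linear S using S by (simp add: bounded_clinear_def)
  have Shom: "S (c *\<^sub>C f) = c *\<^sub>C S f" for c f using S(1) unfolding bounded_clinear_def by blast
  define S' where "S' f = inverse \<mu> *\<^sub>C S f" for f
  have sh: "shifted \<mu> T f = \<mu> *\<^sub>C (f - V f)" for f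
    using mu by (simp add: shifted_def V_def complex_vector.scale_right_diff_distrib scaleC_scaleC scaleC_one)
  obtain K where K: "\<And>x. norm (S x) \<le> norm x * K" using S.bounded by blast
  have "bounded_clinear S'"
  proof (rule bounded_clinearI)
    show "S' (f + g) = S' f + S' g" for f g by (simp add: S'_def S.add scaleC_add_right)
    show "S' (c *\<^sub>C f) = c *\<^sub>C S' f" for c f by (simp add: S'_def Shom scaleC_scaleC mult.commute)
    show "norm (S' f) \<le> norm f * (cmod (inverse \<mu>) * K)" for f
      using mult_left_mono[OF K[of f], of "cmod (inverse \<mu>)"] by (simp add: S'_def norm_scaleC mult_ac)
  qed
  moreover have "S' \<circ> shifted \<mu> T = id"
    using mu by (auto simp: fun_eq_iff S'_def sh Shom S(2) scaleC_scaleC scaleC_one)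
  moreover have "shifted \<mu> T \<circ> S' = id"
  proof
    fix f
    have "V (inverse \<mu> *\<^sub>C S f) = inverse \<mu> *\<^sub>C V (S f)"
      using V unfolding bounded_clinear_def by blast
    then have "S' f - V (S' f) = inverse \<mu> *\<^sub>C f"
      by (simp add: S'_def complex_vector.scale_right_diff_distrib[symmetric] S(3))
    then show "(shifted \<mu> T \<circ> S') f = id f"
      using mu by (simp add: sh scaleC_scaleC scaleC_one)
  qed
  ultimately show ?thesis unfolding spectrum_def by blast
qed

text \<open>For large \<open>n\<close> the operator \<open>T\<^sup>n - \<mu>\<^sup>n\<close> is bounded below by the growth of \<open>T\<^sup>n\<close>, and it
  has \<open>T - \<mu>\<close> as a factor.\<close>

lemma bounded_below_if_small:
  assumes "\<rho> > 0" "cmod \<mu> < \<rho>" "\<And>x. x \<in> sphere 0 1 \<Longrightarrow> \<rho> ^ p < cmod (cocycle w p (x, \<zeta>))"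
    and nz: "\<And>z. z \<in> torus \<Longrightarrow> apply_bidisc w z \<noteq> 0"
  obtains c where "c > 0" "\<And>f. c * norm f \<le> norm (shifted \<mu> T f)"
proof -
  obtain C where C: "C > 0" "\<And>n f. norm f \<le> C * (1 / \<rho>) ^ n * norm ((T ^^ n) f)"
    using norm_T_power_ge[OF assms(1,3) nz] by metis
  interpret T: bounded_linear T using bounded_clinear_T by (simp add: bounded_clinear_def)
  have hom: "T (c *\<^sub>C f) = c *\<^sub>C T f" for c f
    using bounded_clinear_T unfolding bounded_clinear_def by blast
  obtain K where K: "K > 0" "\<And>f. norm (T f) \<le> norm f * K" using T.pos_bounded by blast
  \<comment> \<open>The quotient of \<open>T\<^sup>n - \<mu>\<^sup>n\<close> by \<open>T - \<mu>\<close> is bounded by \<open>M\<close>.\<close>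
  have tele: "\<exists>M\<ge>0. \<forall>f. norm ((T ^^ n) f - \<mu> ^ n *\<^sub>C f) \<le> M * norm (shifted \<mu> T f)" for n
  proof (induction n)
    case 0
    then show ?case by (auto simp: scaleC_one)
  next
    case (Suc n)
    then obtain M where M: "M \<ge> 0" "\<And>f. norm ((T ^^ n) f - \<mu> ^ n *\<^sub>C f) \<le> M * norm (shifted \<mu> T f)" by blast
    have "norm ((T ^^ Suc n) f - \<mu> ^ Suc n *\<^sub>C f) \<le> (M * K + cmod (\<mu> ^ n)) * norm (shifted \<mu> T f)" for f
    proof -
      have "(T ^^ Suc n) f - \<mu> ^ Suc n *\<^sub>C f = T ((T ^^ n) f - \<mu> ^ n *\<^sub>C f) - \<mu> ^ n *\<^sub>C shifted \<mu> T f"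
        by (simp add: T.diff hom shifted_def complex_vector.scale_right_diff_distrib scaleC_scaleC mult.commute)
      also have "norm \<dots> \<le> norm (T ((T ^^ n) f - \<mu> ^ n *\<^sub>C f)) + norm (\<mu> ^ n *\<^sub>C shifted \<mu> T f)"
        by (rule norm_triangle_ineq4)
      also have "norm (T ((T ^^ n) f - \<mu> ^ n *\<^sub>C f)) \<le> (M * norm (shifted \<mu> T f)) * K"
        using K M(2)[of f] by (intro order_trans[OF K(2)] mult_right_mono) auto
      finally show ?thesis by (simp add: norm_scaleC algebra_simps)
    qed
    then show ?case using M(1) K(1) by (intro exI[of _ "M * K + cmod (\<mu> ^ n)"]) auto
  qed
  have "(\<lambda>n. C * (cmod \<mu> / \<rho>) ^ n) \<longlonglongrightarrow> C * 0"
    using assms(1,2) by (intro tendsto_intros LIMSEQ_power_zero) auto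
  then have "\<forall>\<^sub>F n in sequentially. C * (cmod \<mu> / \<rho>) ^ n < 1 / 2"
    by (intro order_tendstoD(2)) auto
  then obtain n where n: "C * (cmod \<mu> / \<rho>) ^ n < 1 / 2"
    by (meson eventually_happens' sequentially_bot)
  obtain M where M: "M \<ge> 0" "\<And>f. norm ((T ^^ n) f - \<mu> ^ n *\<^sub>C f) \<le> M * norm (shifted \<mu> T f)" using tele by blast
  define D where "D = C * (1 / \<rho>) ^ n * M + 1"
  have D: "D > 0" using C(1) assms(1) M(1) by (simp add: D_def add_nonneg_pos)
  show ?thesis
  proof (rule that[of "1 / (2 * D)"])
    show "1 / (2 * D) > 0" using D by simp
    fix f
    have "norm ((T ^^ n) f) \<le> norm ((T ^^ n) f - \<mu> ^ n *\<^sub>C f) + norm (\<mu> ^ n *\<^sub>C f)"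
      by (metis norm_triangle_sub add.commute)
    also have "\<dots> \<le> M * norm (shifted \<mu> T f) + cmod \<mu> ^ n * norm f"
      using M(2)[of f] by (simp add: norm_scaleC norm_power)
    finally have "norm f \<le> C * (1 / \<rho>) ^ n * (M * norm (shifted \<mu> T f) + cmod \<mu> ^ n * norm f)"
      using C(1) assms(1) by (intro order_trans[OF C(2)[of f n]] mult_left_mono) auto
    also have "\<dots> = (D - 1) * norm (shifted \<mu> T f) + (C * (cmod \<mu> / \<rho>) ^ n) * norm f"
      by (simp add: D_def algebra_simps power_divide)
    also have "\<dots> \<le> D * norm (shifted \<mu> T f) + (1 / 2) * norm f"
      using n by (intro add_mono mult_right_mono) auto
    finally show "1 / (2 * D) * norm f \<le> norm (shifted \<mu> T f)"
      using D by (simp add: field_simps)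
  qed
qed

text \<open>For invertible \<open>w\<close> the operator is invertible, and the powers of its inverse grow at most like
  \<open>\<rho>\<^sup>-\<^sup>n\<close>; so the Neumann series of \<open>1 - \<mu> T\<^sup>-\<^sup>1\<close> converges.\<close>

lemma notin_spectrum_if_small_invertible:
  assumes r: "\<rho> > 0" "cmod \<mu> < \<rho>" "\<And>x. x \<in> sphere 0 1 \<Longrightarrow> \<rho> ^ p < cmod (cocycle w p (x, \<zeta>))"
    and v: "\<And>z. z \<in> closed_bidisc \<Longrightarrow> apply_bidisc w z * apply_bidisc v z = 1"
  shows "\<mu> \<notin> spectrum T"
proof -
  have nz: "apply_bidisc w z \<noteq> 0" if "z \<in> torus" for z
    using v[of z] that by auto
  obtain C where C: "C > 0" "\<And>n f. norm f \<le> C * (1 / \<rho>) ^ n * norm ((T ^^ n) f)"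
    using norm_T_power_ge[OF r(1,3) nz] by metis
  interpret T: bounded_linear T using bounded_clinear_T by (simp add: bounded_clinear_def)
  have hom: "T (c *\<^sub>C f) = c *\<^sub>C T f" for c f
    using bounded_clinear_T unfolding bounded_clinear_def by blast
  define U where "U g = bidisc_of (\<lambda>z. apply_bidisc (bidisc_of (\<lambda>z. apply_bidisc v z * apply_bidisc g z)) (\<Phi> (- 1) z))" for g
  have U: "apply_bidisc (U g) z = apply_bidisc v (\<Phi> (- 1) z) * apply_bidisc g (\<Phi> (- 1) z)"
    if "z \<in> closed_bidisc" for g z
    unfolding U_def apply_bidisc_compose_Phi[OF that]
    by (rule apply_bidisc_mult[OF Phi_in_closed_bidisc[OF that]])
  have TU: "T (U g) = g" for g
  proof (rule bidisc_eqI)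
    fix z :: "complex \<times> complex" assume z: "z \<in> closed_bidisc"
    then have "apply_bidisc (T (U g)) z = (apply_bidisc w z * apply_bidisc v z) * apply_bidisc g z"
      by (simp add: apply_T U Phi_in_closed_bidisc Phi_add Phi_0 del: mem_Times_iff)
    then show "apply_bidisc (T (U g)) z = apply_bidisc g z" by (simp add: v[OF z])
  qed
  have inj: "f = g" if "T f = T g" for f g
  proof -
    have "T (f - g) = 0" using that by (simp add: T.diff)
    then have "norm (f - g) \<le> 0" using C(2)[of "f - g" 1] by simp
    then show ?thesis by simp
  qed
  have UT: "U (T f) = f" for f by (rule inj) (simp add: TU)
  have Uadd: "U (f + g) = U f + U g" for f g by (rule inj) (simp add: TU T.add)
  have Usc: "U (c *\<^sub>C f) = c *\<^sub>C U f" for c f by (rule inj) (simp add: TU hom)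
  have TnUn: "(T ^^ n) ((U ^^ n) g) = g" for n g
  proof (induction n arbitrary: g)
    case (Suc n)
    have "(T ^^ Suc n) ((U ^^ Suc n) g) = (T ^^ n) (T (U ((U ^^ n) g)))" by (simp add: funpow_swap1)
    then show ?case by (simp add: TU Suc)
  qed simp
  define V where "V f = \<mu> *\<^sub>C U f" for f
  have Vn: "(V ^^ n) f = \<mu> ^ n *\<^sub>C (U ^^ n) f" for n f
    by (induction n) (simp_all add: V_def Usc scaleC_scaleC scaleC_one)
  have Un: "norm ((U ^^ n) f) \<le> C * (1 / \<rho>) ^ n * norm f" for n f
    using C(2)[of "(U ^^ n) f" n] by (simp add: TnUn)
  have Ubl: "bounded_linear U"
    by (intro bounded_linear_intro[where K="C / \<rho>"])
      (use Un[of 1] in \<open>auto simp: scaleR_scaleC Uadd Usc mult_ac\<close>)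
  have V: "bounded_clinear V"
  proof (rule bounded_clinearI)
    show "V (f + g) = V f + V g" for f g by (simp add: V_def Uadd scaleC_add_right)
    show "V (c *\<^sub>C f) = c *\<^sub>C V f" for c f by (simp add: V_def Usc scaleC_scaleC mult.commute)
    show "norm (V f) \<le> norm f * (cmod \<mu> * (C / \<rho>))" for f
      using mult_left_mono[OF Un[of 1 f], of "cmod \<mu>"] by (simp add: V_def norm_scaleC mult_ac)
  qed
  have Vpow: "norm ((V ^^ n) f) \<le> C * (cmod \<mu> / \<rho>) ^ n * norm f" for n f
    using mult_left_mono[OF Un[of n f], of "cmod (\<mu> ^ n)"]
    by (simp add: Vn norm_scaleC norm_power power_divide mult_ac)
  have q: "0 \<le> cmod \<mu> / \<rho>" "cmod \<mu> / \<rho> < 1" using r(1,2) by auto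
  obtain S where S: "bounded_clinear S" "\<And>x. S (x - V x) = x" "\<And>x. S x - V (S x) = x"
    using Neumann_series_inverse[OF V less_imp_le[OF C(1)] q Vpow] by blast
  interpret S: bounded_linear S using S by (simp add: bounded_clinear_def)
  have Shom: "S (c *\<^sub>C f) = c *\<^sub>C S f" for c f using S(1) unfolding bounded_clinear_def by blast
  define S' where "S' f = - S (U f)" for f
  have sh1: "shifted \<mu> T f = - T (f - V f)" for f
    by (simp add: shifted_def V_def T.diff hom TU)
  have "bounded_linear S'"
    unfolding S'_def[abs_def]
    by (intro bounded_linear_minus bounded_linear_compose[OF S.bounded_linear_axioms Ubl])
  moreover have "S' (c *\<^sub>C f) = c *\<^sub>C S' f" for c f by (simp add: S'_def Usc Shom)
  ultimately have "bounded_clinear S'" by (simp add: bounded_clinear_def)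
  moreover have "S' \<circ> shifted \<mu> T = id"
  proof
    fix f
    have "U (- T (f - V f)) = - (f - V f)"
      using Usc[of "- 1" "T (f - V f)"] by (simp add: UT complex_vector.scale_minus_left scaleC_one)
    then have "S' (shifted \<mu> T f) = - S (- (f - V f))" by (simp add: S'_def sh1)
    also have "\<dots> = S (f - V f)" by (simp only: S.neg minus_minus)
    finally show "(S' \<circ> shifted \<mu> T) f = id f" by (simp add: S(2))
  qed
  moreover have "shifted \<mu> T \<circ> S' = id"
  proof
    fix f
    interpret V: bounded_linear V using V by (simp add: bounded_clinear_def)
    have "S' f - V (S' f) = - (S (U f) - V (S (U f)))" by (simp add: S'_def V.neg)
    also have "\<dots> = - U f" by (simp only: S(3))
    finally show "(shifted \<mu> T \<circ> S') f = id f" by (simp add: sh1 T.neg TU)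
  qed
  ultimately show ?thesis unfolding spectrum_def by blast
qed

end

section \<open>Almost eigenvectors and almost eigenfunctionals along orbit segments\<close>

lemma disjoint_supports_sequence:
  assumes "\<And>F. finite F \<Longrightarrow> \<exists>x. P x \<and> finite (S x) \<and> S x \<inter> F = {}"
  obtains X :: "nat \<Rightarrow> 'a" where "\<And>i. P (X i)" "\<And>i j. i \<noteq> j \<Longrightarrow> S (X i) \<inter> S (X j) = {}"
proof -
  have "\<exists>f. \<forall>n. (finite (fst (f n)) \<and> P (snd (f n)) \<and> finite (S (snd (f n))) \<and> S (snd (f n)) \<inter> fst (f n) = {}) \<and>
      fst (f (Suc n)) = fst (f n) \<union> S (snd (f n))"
  proof (rule dependent_nat_choice)
    show "\<exists>s. finite (fst s) \<and> P (snd s) \<and> finite (S (snd s)) \<and> S (snd s) \<inter> fst s = {}"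
      using assms[of "{}"] by force
    fix s :: "'b set \<times> 'a"
    assume s: "finite (fst s) \<and> P (snd s) \<and> finite (S (snd s)) \<and> S (snd s) \<inter> fst s = {}"
    then obtain x where "P x \<and> finite (S x) \<and> S x \<inter> (fst s \<union> S (snd s)) = {}"
      using assms[of "fst s \<union> S (snd s)"] by auto
    with s show "\<exists>t. (finite (fst t) \<and> P (snd t) \<and> finite (S (snd t)) \<and> S (snd t) \<inter> fst t = {}) \<and>
      fst t = fst s \<union> S (snd s)"
      by (intro exI[of _ "(fst s \<union> S (snd s), x)"]) simp
  qed
  then obtain f where f: "\<And>n. P (snd (f n))" "\<And>n. S (snd (f n)) \<inter> fst (f n) = {}"
    "\<And>n. fst (f (Suc n)) = fst (f n) \<union> S (snd (f n))" by blast
  have sub: "S (snd (f i)) \<subseteq> fst (f j)" if "i < j" for i j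
    using that by (induction j) (auto simp: f(3) less_Suc_eq)
  have "S (snd (f i)) \<inter> S (snd (f j)) = {}" if "i \<noteq> j" for i j
  proof (cases "i < j")
    case True
    then show ?thesis using sub[OF True] f(2)[of j] by blast
  next
    case False
    then have "j < i" using that by simp
    from sub[OF this] f(2)[of i] show ?thesis by blast
  qed
  then show ?thesis using that[of "\<lambda>n. snd (f n)"] f(1) by blast
qed

context weighted_rotation
begin

text \<open>Infinitely many orbit segments with pairwise disjoint sets of second coordinates, obtained by
  avoiding the finitely many second coordinates that have been used before.\<close>

lemma separated_segments:
  assumes "\<And>F. finite F \<Longrightarrow> \<exists>z N c. P z N c \<and> (\<forall>n\<le>N. snd (\<Phi> (int n) z) \<notin> F)"
  shows "\<exists>z N (c :: nat \<Rightarrow> nat \<Rightarrow> complex). (\<forall>i::nat. P (z i) (N i) (c i)) \<and>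
    (\<forall>i j n m. i \<noteq> j \<longrightarrow> n \<le> N i \<longrightarrow> m \<le> N j \<longrightarrow> snd (\<Phi> (int n) (z i)) \<noteq> snd (\<Phi> (int m) (z j)))"
proof -
  define supp where "supp x = (case x of (z, N, c :: nat \<Rightarrow> complex) \<Rightarrow> (\<lambda>n. snd (\<Phi> (int n) z)) ` {..N::nat})" for x
  obtain X where X: "\<And>i::nat. case X i of (z, N, c) \<Rightarrow> P z N c"
    "\<And>i j. i \<noteq> j \<Longrightarrow> supp (X i) \<inter> supp (X j) = {}"
  proof (rule disjoint_supports_sequence[of "\<lambda>x. case x of (z, N, c) \<Rightarrow> P z N c" supp])
    fix F :: "complex set" assume "finite F"
    then obtain z N c where "P z N c" "\<forall>n\<le>N. snd (\<Phi> (int n) z) \<notin> F"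
      using assms by metis
    then show "\<exists>x. (case x of (z, N, c) \<Rightarrow> P z N c) \<and> finite (supp x) \<and> supp x \<inter> F = {}"
      by (intro exI[of _ "(z, N, c)"]) (auto simp: supp_def)
  qed blast
  show ?thesis
  proof (rule exI[of _ "\<lambda>i. fst (X i)"], rule exI[of _ "\<lambda>i. fst (snd (X i))"],
      rule exI[of _ "\<lambda>i. snd (snd (X i))"], intro conjI allI impI)
    show "P (fst (X i)) (fst (snd (X i))) (snd (snd (X i)))" for i
      using X(1)[of i] by (simp split: prod.splits)
    show "snd (\<Phi> (int n) (fst (X i))) \<noteq> snd (\<Phi> (int m) (fst (X j)))"
      if "i \<noteq> j" "n \<le> fst (snd (X i))" "m \<le> fst (snd (X j))" for i j n m
      using X(2)[OF that(1)] that(2,3) by (auto simp: supp_def split: prod.splits)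
  qed
qed

text \<open>The sum \<open>\<Sum>n\<le>N. c\<^sub>n \<delta>\<^sub>n\<close> of evaluations \<open>\<delta>\<^sub>n\<close> at the points \<open>\<Phi> n z\<close> is mapped by the transpose of \<open>\<mu> - T\<close> to
  a sum of evaluations at \<open>\<Phi> 0 z, \<dots>, \<Phi> (N + 1) z\<close>, whose coefficients are those in the last condition.\<close>

definition functional_segment :: "complex \<Rightarrow> real \<Rightarrow> complex \<times> complex \<Rightarrow> nat \<Rightarrow> (nat \<Rightarrow> complex) \<Rightarrow> bool" where
  "functional_segment \<mu> \<epsilon> z N c \<longleftrightarrow>
    z \<in> torus \<and> snd z \<noteq> \<zeta> \<and> 1 \<le> (\<Sum>n\<le>N. cmod (c n)) \<and>
    cmod (\<mu> * c 0) + (\<Sum>n<N. cmod (\<mu> * c (Suc n) - c n * apply_bidisc w (\<Phi> (int n) z)))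
      + cmod (c N * apply_bidisc w (\<Phi> (int N) z)) \<le> \<epsilon>"

text \<open>Here \<open>c\<^sub>n\<close> is the coefficient of a function that peaks at \<open>\<Phi> n z\<close>. Composition with \<open>\<phi>\<close> moves
  the peak from \<open>\<Phi> n z\<close> to \<open>\<Phi> (n - 1) z\<close>, which is why the next coefficient enters. The conditions
  \<open>c\<^sub>0 = 0\<close> and \<open>c\<^sub>N\<^sub>+\<^sub>1 = 0\<close> keep all peaks inside the segment.\<close>

definition vector_segment :: "complex \<Rightarrow> real \<Rightarrow> complex \<times> complex \<Rightarrow> nat \<Rightarrow> (nat \<Rightarrow> complex) \<Rightarrow> bool" where
  "vector_segment \<mu> \<epsilon> z N c \<longleftrightarrow>
    z \<in> torus \<and> snd z \<noteq> \<zeta> \<and> c 0 = 0 \<and> c (Suc N) = 0 \<and> (\<exists>n\<le>N. 1 \<le> cmod (c n)) \<and>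
    (\<forall>n\<le>N. cmod (\<mu> * c n - c (Suc n) * apply_bidisc w (\<Phi> (int n) z)) \<le> \<epsilon>)"

text \<open>Disjoint segments give arbitrarily many functionals that are almost annihilated by the transpose
  of \<open>\<mu> - T\<close> and that, by \<open>torus_point_masses_norm\<close>, are independent like the unit vectors of \<open>\<ell>\<^sup>1\<close>.\<close>

lemma not_lower_semi_Fredholm_if_functional_segments:
  assumes seg: "\<And>\<epsilon> F. \<epsilon> > 0 \<Longrightarrow> finite F \<Longrightarrow>
    \<exists>z N c. functional_segment \<mu> \<epsilon> z N c \<and> (\<forall>n\<le>N. snd (\<Phi> (int n) z) \<notin> F)"
  shows "\<not> lower_semi_Fredholm (shifted \<mu> T)"
proof
  assume lsf: "lower_semi_Fredholm (shifted \<mu> T)"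
  obtain C :: real and k :: nat where C: "C \<ge> 0"
    "\<forall>\<nu> \<epsilon>. (\<forall>i\<le>k. bounded_cfunctional (\<nu> i)) \<longrightarrow>
       (\<forall>i\<le>k. \<forall>f. cmod (\<nu> i (shifted \<mu> T f)) \<le> \<epsilon> * norm f) \<longrightarrow>
       (\<exists>a. (\<forall>i\<le>k. cmod (a i) \<le> 1) \<and> (\<exists>i\<le>k. cmod (a i) = 1) \<and>
         (\<forall>f. cmod (\<Sum>i\<le>k. a i * \<nu> i f) \<le> C * \<epsilon> * norm f))"
    using lower_semi_Fredholm_functional_bound[OF bounded_clinear_shifted[OF bounded_clinear_T] lsf]
    by (elim exE conjE) (rule that)
  \<comment> \<open>The constants are such that \<open>3 C \<epsilon> < 1\<close>.\<close>
  define \<epsilon> where "\<epsilon> = 1 / (4 * (C + 1))"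
  have e: "\<epsilon> > 0" using C(1) by (simp add: \<epsilon>_def)
  have "\<exists>z N (c :: nat \<Rightarrow> nat \<Rightarrow> complex). (\<forall>i::nat. functional_segment \<mu> \<epsilon> (z i) (N i) (c i)) \<and>
    (\<forall>i j n m. i \<noteq> j \<longrightarrow> n \<le> N i \<longrightarrow> m \<le> N j \<longrightarrow> snd (\<Phi> (int n) (z i)) \<noteq> snd (\<Phi> (int m) (z j)))"
    by (rule separated_segments) (rule seg[OF e])
  then obtain z N c where segments: "\<forall>i::nat. functional_segment \<mu> \<epsilon> (z i) (N i) (c i)"
    "\<forall>i j n m. i \<noteq> j \<longrightarrow> n \<le> N i \<longrightarrow> m \<le> N j \<longrightarrow> snd (\<Phi> (int n) (z i)) \<noteq> snd (\<Phi> (int m) (z j))"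
    by (elim exE conjE) (rule that)
  note fs = segments(1)[rule_format] and disj = segments(2)[rule_format]
  have zt: "z i \<in> torus" and zz: "snd (z i) \<noteq> \<zeta>" for i
    using fs[of i] unfolding functional_segment_def by blast+
  then have zc: "z i \<in> closed_bidisc" for i using torus_subset_closed_bidisc by blast
  define \<nu> where "\<nu> i f = (\<Sum>n\<le>N i. c i n * apply_bidisc f (\<Phi> (int n) (z i)))" for i f
  have \<nu>b: "bounded_cfunctional (\<nu> i)" for i
    unfolding \<nu>_def[abs_def]
    by (intro bounded_cfunctional_sum bounded_cfunctional_eval Phi_in_closed_bidisc zc)
  have \<nu>S: "cmod (\<nu> i (shifted \<mu> T f)) \<le> \<epsilon> * norm f" for i f
  proof -
    let ?f = "\<lambda>n. apply_bidisc f (\<Phi> (int n) (z i))" and ?w = "\<lambda>n. apply_bidisc w (\<Phi> (int n) (z i))"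
    have step: "apply_bidisc (shifted \<mu> T f) (\<Phi> (int n) (z i)) = \<mu> * ?f n - ?w n * ?f (Suc n)" for n
      using Phi_in_closed_bidisc[OF zc] by (simp add: apply_shifted_T Phi_add[OF zc] del: mem_Times_iff)
    have "\<nu> i (shifted \<mu> T f) = (\<Sum>n\<le>N i. \<mu> * c i n * ?f n) - (\<Sum>n\<le>N i. c i n * ?w n * ?f (Suc n))"
      unfolding \<nu>_def step by (simp add: right_diff_distrib sum_subtractf mult_ac)
    also have "(\<Sum>n\<le>N i. \<mu> * c i n * ?f n) = \<mu> * c i 0 * ?f 0 + (\<Sum>n<N i. \<mu> * c i (Suc n) * ?f (Suc n))"
      by (simp only: lessThan_Suc_atMost[symmetric] sum.lessThan_Suc_shift)
    also have "(\<Sum>n\<le>N i. c i n * ?w n * ?f (Suc n)) = (\<Sum>n<N i. c i n * ?w n * ?f (Suc n)) + c i (N i) * ?w (N i) * ?f (Suc (N i))"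
      by (simp only: lessThan_Suc_atMost[symmetric] sum.lessThan_Suc)
    finally have eq: "\<nu> i (shifted \<mu> T f) = \<mu> * c i 0 * ?f 0
        + (\<Sum>n<N i. (\<mu> * c i (Suc n) - c i n * ?w n) * ?f (Suc n)) - c i (N i) * ?w (N i) * ?f (Suc (N i))"
      by (simp add: left_diff_distrib sum_subtractf)
    have "cmod (\<nu> i (shifted \<mu> T f)) \<le> cmod (\<mu> * c i 0 * ?f 0)
        + cmod (\<Sum>n<N i. (\<mu> * c i (Suc n) - c i n * ?w n) * ?f (Suc n)) + cmod (c i (N i) * ?w (N i) * ?f (Suc (N i)))"
      unfolding eq by (rule order_trans[OF norm_triangle_ineq4 add_right_mono[OF norm_triangle_ineq]])
    also have "\<dots> \<le> cmod (\<mu> * c i 0) * norm f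
        + (\<Sum>n<N i. cmod (\<mu> * c i (Suc n) - c i n * ?w n) * norm f) + cmod (c i (N i) * ?w (N i)) * norm f"
    proof -
      have fb: "cmod (v * ?f n) \<le> cmod v * norm f" for v n
        unfolding norm_mult by (rule mult_left_mono[OF norm_apply_le[OF Phi_in_closed_bidisc[OF zc]]]) simp
      show ?thesis
        by (rule add_mono[OF add_mono[OF fb order_trans[OF norm_sum sum_mono[OF fb]]] fb])
    qed
    also have "\<dots> = (cmod (\<mu> * c i 0)
        + (\<Sum>n<N i. cmod (\<mu> * c i (Suc n) - c i n * ?w n)) + cmod (c i (N i) * ?w (N i))) * norm f"
      by (simp only: sum_distrib_right distrib_right)
    also have "\<dots> \<le> \<epsilon> * norm f"
      using fs[of i] unfolding functional_segment_def by (intro mult_right_mono) auto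
    finally show ?thesis .
  qed
  obtain a where a: "\<And>i. i \<le> k \<Longrightarrow> cmod (a i) \<le> 1" "\<exists>i\<le>k. cmod (a i) = 1"
    "\<And>f. cmod (\<Sum>i\<le>k. a i * \<nu> i f) \<le> C * \<epsilon> * norm f"
    using C(2)[rule_format, of \<nu> \<epsilon>, OF \<nu>b \<nu>S] by blast
  define I where "I = Sigma {..k} (\<lambda>i. {..N i})"
  define pt where "pt x = \<Phi> (int (snd x)) (z (fst x))" for x :: "nat \<times> nat"
  define co where "co x = a (fst x) * c (fst x) (snd x)" for x :: "nat \<times> nat"
  have sumI: "(\<Sum>x\<in>I. h (fst x) (snd x)) = (\<Sum>i\<le>k. \<Sum>n\<le>N i. h i n)" for h :: "nat \<Rightarrow> nat \<Rightarrow> complex"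
    by (simp add: I_def sum.Sigma case_prod_unfold)
  have sumI_real: "(\<Sum>x\<in>I. h (fst x) (snd x)) = (\<Sum>i\<le>k. \<Sum>n\<le>N i. h i n)" for h :: "nat \<Rightarrow> nat \<Rightarrow> real"
    by (simp add: I_def sum.Sigma case_prod_unfold)
  have "(\<Sum>x\<in>I. cmod (co x)) \<le> 3 * (C * \<epsilon>)"
  proof (rule torus_point_masses_norm[where a=pt])
    show "finite I" by (simp add: I_def)
    show "inj_on pt I"
    proof (rule inj_onI)
      fix x y assume xy: "x \<in> I" "y \<in> I" "pt x = pt y"
      have 1: "fst x = fst y"
      proof (rule ccontr)
        assume "fst x \<noteq> fst y"
        from disj[OF this, of "snd x" "snd y"] xy show False by (auto simp: I_def pt_def)
      qed
      have "int (snd x) = int (snd y)"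
        by (rule injD[OF inj_snd_Phi[OF zc zz, of "fst y"]]) (use xy(3) in \<open>simp add: pt_def 1\<close>)
      then show "x = y" using 1 by (simp add: prod_eq_iff)
    qed
    show "pt ` I \<subseteq> torus" using Phi_in_torus[OF zt] unfolding pt_def by blast
    show "0 \<le> C * \<epsilon>" using C(1) e by simp
    show "cmod (\<Sum>x\<in>I. co x * apply_bidisc f (pt x)) \<le> C * \<epsilon> * norm f" for f
      using a(3)[of f] sumI[of "\<lambda>i n. a i * (c i n * apply_bidisc f (\<Phi> (int n) (z i)))"]
      by (simp add: co_def pt_def \<nu>_def sum_distrib_left mult.assoc)
  qed
  moreover have "(\<Sum>x\<in>I. cmod (co x)) = (\<Sum>i\<le>k. cmod (a i) * (\<Sum>n\<le>N i. cmod (c i n)))"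
    using sumI_real[of "\<lambda>i n. cmod (a i) * cmod (c i n)"]
    by (simp add: co_def sum_distrib_left norm_mult)
  moreover have "1 \<le> (\<Sum>i\<le>k. cmod (a i) * (\<Sum>n\<le>N i. cmod (c i n)))"
  proof -
    obtain j where j: "j \<le> k" "cmod (a j) = 1" using a(2) by blast
    have "1 \<le> cmod (a j) * (\<Sum>n\<le>N j. cmod (c j n))"
      using fs[of j] j by (simp add: functional_segment_def)
    also have "\<dots> \<le> (\<Sum>i\<le>k. cmod (a i) * (\<Sum>n\<le>N i. cmod (c i n)))"
      using j by (intro member_le_sum) (auto intro!: mult_nonneg_nonneg sum_nonneg)
    finally show ?thesis .
  qed
  moreover have "3 * (C * \<epsilon>) < 1" using C(1) by (simp add: \<epsilon>_def field_simps)
  ultimately show False by simp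
qed

text \<open>All peaks come from the single one at the end \<open>\<Phi> N z\<close> of the segment by composition with iterates
  of \<open>\<phi>\<close>; hence composition with \<open>\<phi>\<close> permutes them exactly.\<close>

definition segment_vector :: "complex \<times> complex \<Rightarrow> nat \<Rightarrow> (nat \<Rightarrow> complex) \<Rightarrow> nat \<Rightarrow> bidisc_algebra" where
  "segment_vector z N c m = (\<Sum>n\<le>N. c n *\<^sub>C
     bidisc_of (\<lambda>u. apply_bidisc (bidisc_of (\<lambda>u. torus_peak (\<Phi> (int N) z) u ^ m)) (\<Phi> (int N - int n) u)))"

lemma apply_segment_vector:
  assumes "u \<in> closed_bidisc"
  shows "apply_bidisc (segment_vector z N c m) u =
    (\<Sum>n\<le>N. c n * torus_peak (\<Phi> (int N) z) (\<Phi> (int N - int n) u) ^ m)"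
  unfolding segment_vector_def
  using Phi_in_closed_bidisc[OF assms] assms
  by (simp add: apply_bidisc_sum apply_simps apply_bidisc_compose_Phi apply_bidisc_of_torus_peak_power del: mem_Times_iff)

lemma norm_orbit_peak:
  assumes z: "z \<in> torus" and u: "u \<in> closed_bidisc"
  shows "cmod (torus_peak (\<Phi> (int N) z) (\<Phi> (int N - int n) u)) \<le> 1"
    and "u \<noteq> \<Phi> (int n) z \<Longrightarrow> cmod (torus_peak (\<Phi> (int N) z) (\<Phi> (int N - int n) u)) < 1"
    and "torus_peak (\<Phi> (int N) z) (\<Phi> (int N - int n) (\<Phi> (int n) z)) = 1"
proof -
  have zc: "z \<in> closed_bidisc" using z by auto
  show "cmod (torus_peak (\<Phi> (int N) z) (\<Phi> (int N - int n) u)) \<le> 1"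
    by (intro norm_torus_peak_le_1 Phi_in_torus Phi_in_closed_bidisc z u)
  show "torus_peak (\<Phi> (int N) z) (\<Phi> (int N - int n) (\<Phi> (int n) z)) = 1"
    by (simp add: Phi_add[OF zc] torus_peak_self[OF Phi_in_torus[OF z]])
  show "cmod (torus_peak (\<Phi> (int N) z) (\<Phi> (int N - int n) u)) < 1" if "u \<noteq> \<Phi> (int n) z"
  proof (intro norm_torus_peak_less_1 Phi_in_torus Phi_in_closed_bidisc z u notI)
    assume "\<Phi> (int N - int n) u = \<Phi> (int N) z"
    then have "\<Phi> (int n - int N) (\<Phi> (int N - int n) u) = \<Phi> (int n - int N) (\<Phi> (int N) z)" by simp
    then have "u = \<Phi> (int n) z" by (simp add: Phi_add[OF zc] Phi_add[OF u] Phi_0)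
    with that show False by simp
  qed
qed

lemma continuous_on_orbit_peak:
  "continuous_on closed_bidisc (\<lambda>u. torus_peak a (\<Phi> n u))"
  by (rule continuous_on_compose2[OF continuous_on_torus_peak[of UNIV] continuous_on_Phi]) auto

lemma apply_shifted_segment_vector:
  assumes u: "u \<in> closed_bidisc" and c: "c 0 = 0" "c (Suc N) = 0"
  shows "apply_bidisc (shifted \<mu> T (segment_vector z N c m)) u =
    (\<Sum>n\<le>N. (\<mu> * c n - c (Suc n) * apply_bidisc w u) * torus_peak (\<Phi> (int N) z) (\<Phi> (int N - int n) u) ^ m)"
proof -
  let ?P = "\<lambda>n. torus_peak (\<Phi> (int N) z) (\<Phi> (int N - int n) u) ^ m"
  have P1: "torus_peak (\<Phi> (int N) z) (\<Phi> (int N - int (Suc n)) (\<Phi> 1 u)) ^ m = ?P n" for n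
    by (simp add: Phi_add[OF u])
  have "(\<Sum>n\<le>N. c n * torus_peak (\<Phi> (int N) z) (\<Phi> (int N - int n) (\<Phi> 1 u)) ^ m)
      = (\<Sum>n\<le>Suc N. c n * torus_peak (\<Phi> (int N) z) (\<Phi> (int N - int n) (\<Phi> 1 u)) ^ m)"
    by (simp add: c)
  also have "\<dots> = (\<Sum>n\<le>N. c (Suc n) * ?P n)"
    by (subst sum.atMost_Suc_shift) (simp only: P1 c mult_zero_left add_0)
  finally have "apply_bidisc (segment_vector z N c m) (\<Phi> 1 u) = (\<Sum>n\<le>N. c (Suc n) * ?P n)"
    unfolding apply_segment_vector[OF Phi_in_closed_bidisc[OF u]] .
  then show ?thesis
    unfolding apply_shifted_T[OF u] apply_segment_vector[OF u]
    by (simp add: sum_distrib_left left_diff_distrib sum_subtractf mult_ac)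
qed

text \<open>As the exponent grows, the norm tends to the largest defect of the shift recursion, up to the
  constant of \<open>sum_peak_powers_le\<close>.\<close>

lemma norm_shifted_segment_vector:
  assumes vs: "vector_segment \<mu> \<epsilon> z N c" and e: "\<epsilon> > 0"
  shows "\<forall>\<^sub>F m in sequentially. norm (shifted \<mu> T (segment_vector z N c m)) \<le> 3 * \<epsilon>"
proof -
  have z: "z \<in> torus" "snd z \<noteq> \<zeta>" and c: "c 0 = 0" "c (Suc N) = 0"
    and le: "\<And>n. n \<le> N \<Longrightarrow> cmod (\<mu> * c n - c (Suc n) * apply_bidisc w (\<Phi> (int n) z)) \<le> \<epsilon>"
    using vs unfolding vector_segment_def by blast+
  have zc: "z \<in> closed_bidisc" using z torus_subset_closed_bidisc by blast
  have "\<forall>\<^sub>F m in sequentially. \<forall>u\<in>closed_bidisc.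
      (\<Sum>n\<in>{..N}. \<bar>cmod (\<mu> * c n - c (Suc n) * apply_bidisc w u)\<bar>
        * cmod (torus_peak (\<Phi> (int N) z) (\<Phi> (int N - int n) u)) ^ m) \<le> 3 * \<epsilon>"
  proof (rule sum_peak_powers_le[where a="\<lambda>n. \<Phi> (int n) z" and I="{..N}"
        and k="\<lambda>n u. cmod (\<mu> * c n - c (Suc n) * apply_bidisc w u)"
        and v="\<lambda>n u. cmod (torus_peak (\<Phi> (int N) z) (\<Phi> (int N - int n) u))"])
    show "inj_on (\<lambda>n. \<Phi> (int n) z) {..N}"
    proof (rule inj_onI)
      fix m n assume "\<Phi> (int m) z = \<Phi> (int n) z"
      then show "m = n" using injD[OF inj_snd_Phi[OF zc z(2)], of "int m" "int n"] by simp
    qed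
    show "(\<lambda>n. \<Phi> (int n) z) ` {..N} \<subseteq> closed_bidisc"
      using Phi_in_closed_bidisc[OF zc] by blast
    show "continuous_on closed_bidisc (\<lambda>u. cmod (\<mu> * c n - c (Suc n) * apply_bidisc w u))" for n
      by (intro continuous_intros continuous_on_apply_bidisc)
    show "continuous_on closed_bidisc (\<lambda>u. cmod (torus_peak (\<Phi> (int N) z) (\<Phi> (int N - int n) u)))" for n
      by (intro continuous_on_norm continuous_on_orbit_peak)
    show "\<bar>cmod (\<mu> * c n - c (Suc n) * apply_bidisc w (\<Phi> (int n) z))\<bar> \<le> \<epsilon>" if "n \<in> {..N}" for n
      using le that by simp
    show "cmod (torus_peak (\<Phi> (int N) z) (\<Phi> (int N - int n) u)) < 1"
      if "u \<in> closed_bidisc" "u \<noteq> \<Phi> (int n) z" for n u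
      using that by (intro norm_orbit_peak(2)[OF z(1)])
    show "0 \<le> cmod (torus_peak (\<Phi> (int N) z) (\<Phi> (int N - int n) u)) \<and>
        cmod (torus_peak (\<Phi> (int N) z) (\<Phi> (int N - int n) u)) \<le> 1" if "u \<in> closed_bidisc" for n u
      using norm_orbit_peak(1)[OF z(1) that] by simp
  qed (use e compact_closed_bidisc in auto)
  then show ?thesis
  proof eventually_elim
    case (elim m)
    show ?case
    proof (rule norm_bidisc_le)
      fix u :: "complex \<times> complex" assume u: "u \<in> closed_bidisc"
      have "cmod (apply_bidisc (shifted \<mu> T (segment_vector z N c m)) u)
        \<le> (\<Sum>n\<le>N. \<bar>cmod (\<mu> * c n - c (Suc n) * apply_bidisc w u)\<bar>
          * cmod (torus_peak (\<Phi> (int N) z) (\<Phi> (int N - int n) u)) ^ m)"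
        unfolding apply_shifted_segment_vector[where c=c, OF u c]
        by (rule order_trans[OF norm_sum]) (simp add: norm_mult norm_power)
      then show "cmod (apply_bidisc (shifted \<mu> T (segment_vector z N c m)) u) \<le> 3 * \<epsilon>"
        using elim u by force
    qed
  qed
qed

lemma segment_vector_at_orbit:
  assumes z: "z \<in> torus" "snd z \<noteq> \<zeta>" and n: "n \<le> N"
  shows "(\<lambda>m. apply_bidisc (segment_vector z N c m) (\<Phi> (int n) z)) \<longlonglongrightarrow> c n"
proof -
  have zc: "z \<in> closed_bidisc" using z torus_subset_closed_bidisc by blast
  have "(\<lambda>m. \<Sum>j\<le>N. c j * torus_peak (\<Phi> (int N) z) (\<Phi> (int N - int j) (\<Phi> (int n) z)) ^ m)
     \<longlonglongrightarrow> (\<Sum>j\<le>N. c j * (if j = n then 1 else 0))"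
  proof (intro tendsto_sum tendsto_mult tendsto_const)
    fix j
    show "(\<lambda>m. torus_peak (\<Phi> (int N) z) (\<Phi> (int N - int j) (\<Phi> (int n) z)) ^ m) \<longlonglongrightarrow> (if j = n then 1 else 0)"
    proof (cases "j = n")
      case True
      then show ?thesis by (simp add: norm_orbit_peak(3)[OF z(1) zc])
    next
      case False
      then have "\<Phi> (int n) z \<noteq> \<Phi> (int j) z"
        using injD[OF inj_snd_Phi[OF zc z(2)], of "int n" "int j"] by auto
      from LIMSEQ_power_zero[OF norm_orbit_peak(2)[OF z(1) Phi_in_closed_bidisc[OF zc] this]] False
      show ?thesis by simp
    qed
  qed
  moreover have "(\<Sum>j\<le>N. c j * (if j = n then 1 else 0)) = c n"
    using n by (simp add: if_distrib[of "\<lambda>t. _ * t"] sum.delta cong: if_cong)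
  ultimately show ?thesis
    unfolding apply_segment_vector[OF Phi_in_closed_bidisc[OF zc]] by simp
qed

lemma segment_vector_off_orbit:
  assumes z: "z \<in> torus" and u: "u \<in> closed_bidisc" and ne: "\<And>n. n \<le> N \<Longrightarrow> u \<noteq> \<Phi> (int n) z"
  shows "(\<lambda>m. apply_bidisc (segment_vector z N c m) u) \<longlonglongrightarrow> 0"
proof -
  have "(\<lambda>m. \<Sum>j\<le>N. c j * torus_peak (\<Phi> (int N) z) (\<Phi> (int N - int j) u) ^ m) \<longlonglongrightarrow> (\<Sum>j\<le>N. c j * 0)"
    using ne by (intro tendsto_sum tendsto_mult tendsto_const LIMSEQ_power_zero norm_orbit_peak(2)[OF z u]) auto
  then show ?thesis unfolding apply_segment_vector[OF u] by simp
qed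

lemma approx_point_spectrum_if_vector_segments:
  assumes seg: "\<And>\<epsilon>. \<epsilon> > 0 \<Longrightarrow> \<exists>z N c. vector_segment \<mu> \<epsilon> z N c"
  shows "\<mu> \<in> approx_point_spectrum T"
proof (rule approx_point_spectrumI[OF _ bounded_clinear_T])
  fix e :: real assume e: "e > 0"
  then obtain z N c where vs: "vector_segment \<mu> (e / 6) z N c" using seg[of "e / 6"] by auto
  then have z: "z \<in> torus" "snd z \<noteq> \<zeta>" and "\<exists>n\<le>N. 1 \<le> cmod (c n)"
    unfolding vector_segment_def by blast+
  then obtain n where n: "n \<le> N" "1 \<le> cmod (c n)" by blast
  have zc: "z \<in> closed_bidisc" using z torus_subset_closed_bidisc by blast
  have "\<forall>\<^sub>F m in sequentially. 1 / 2 < cmod (apply_bidisc (segment_vector z N c m) (\<Phi> (int n) z))"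
    using n by (intro order_tendstoD(1)[OF tendsto_norm[OF segment_vector_at_orbit[OF z n(1)]]]) auto
  moreover have "\<forall>\<^sub>F m in sequentially. norm (shifted \<mu> T (segment_vector z N c m)) \<le> 3 * (e / 6)"
    using e by (intro norm_shifted_segment_vector[OF vs]) auto
  ultimately have "\<forall>\<^sub>F m in sequentially. 1 / 2 < norm (segment_vector z N c m) \<and>
      norm (shifted \<mu> T (segment_vector z N c m)) \<le> e / 2"
  proof eventually_elim
    case (elim m)
    then show ?case
      using norm_apply_le[OF Phi_in_closed_bidisc[OF zc], of "segment_vector z N c m" "int n"] by linarith
  qed
  from eventually_happens'[OF sequentially_bot this]
  obtain m where m: "1 / 2 < norm (segment_vector z N c m)"
      "norm (shifted \<mu> T (segment_vector z N c m)) \<le> e / 2"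
    by blast
  have "shifted \<mu> T (2 *\<^sub>C segment_vector z N c m) = 2 *\<^sub>C shifted \<mu> T (segment_vector z N c m)"
    using bounded_clinear_shifted[OF bounded_clinear_T] unfolding bounded_clinear_def by blast
  then show "\<exists>x. norm x \<ge> 1 \<and> norm (shifted \<mu> T x) \<le> e"
    using m by (intro exI[of _ "2 *\<^sub>C segment_vector z N c m"]) (simp add: norm_scaleC)
qed

text \<open>Vectors on disjoint segments are almost in the kernel, and they are independent because
  evaluation at the peak of one of them almost annihilates the others.\<close>

lemma not_upper_semi_Fredholm_if_vector_segments:
  assumes seg: "\<And>\<epsilon> F. \<epsilon> > 0 \<Longrightarrow> finite F \<Longrightarrow>
    \<exists>z N c. vector_segment \<mu> \<epsilon> z N c \<and> (\<forall>n\<le>N. snd (\<Phi> (int n) z) \<notin> F)"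
  shows "\<not> upper_semi_Fredholm (shifted \<mu> T)"
proof
  assume usf: "upper_semi_Fredholm (shifted \<mu> T)"
  obtain C :: real and k :: nat where C: "C \<ge> 0"
    "\<forall>x. \<exists>a. (\<forall>i\<le>k. cmod (a i) \<le> 1) \<and> (\<exists>i\<le>k. cmod (a i) = 1) \<and>
         norm (\<Sum>i\<le>k. a i *\<^sub>C x i) \<le> C * (\<Sum>i\<le>k. norm (shifted \<mu> T (x i)))"
    using upper_semi_Fredholm_vector_bound[OF bounded_clinear_shifted[OF bounded_clinear_T] usf]
    by (elim exE conjE) (rule that)
  define K where "K = real (Suc k)"
  have K: "K > 0" by (simp add: K_def)
  \<comment> \<open>The constants are such that \<open>C K (3 \<epsilon>) \<le> 1 / 4\<close>.\<close>
  define \<epsilon> where "\<epsilon> = 1 / (12 * (C + 1) * K)"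
  have e: "\<epsilon> > 0" using C(1) K by (simp add: \<epsilon>_def)
  have "\<exists>z N (c :: nat \<Rightarrow> nat \<Rightarrow> complex). (\<forall>i::nat. vector_segment \<mu> \<epsilon> (z i) (N i) (c i)) \<and>
    (\<forall>i j n m. i \<noteq> j \<longrightarrow> n \<le> N i \<longrightarrow> m \<le> N j \<longrightarrow> snd (\<Phi> (int n) (z i)) \<noteq> snd (\<Phi> (int m) (z j)))"
    by (rule separated_segments) (rule seg[OF e])
  then obtain z N c where segments: "\<forall>i::nat. vector_segment \<mu> \<epsilon> (z i) (N i) (c i)"
    "\<forall>i j n m. i \<noteq> j \<longrightarrow> n \<le> N i \<longrightarrow> m \<le> N j \<longrightarrow> snd (\<Phi> (int n) (z i)) \<noteq> snd (\<Phi> (int m) (z j))"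
    by (elim exE conjE) (rule that)
  note vs = segments(1)[rule_format] and disj = segments(2)[rule_format]
  have zt: "z i \<in> torus" and zz: "snd (z i) \<noteq> \<zeta>" for i
    using vs[of i] unfolding vector_segment_def by blast+
  then have zc: "z i \<in> closed_bidisc" for i using torus_subset_closed_bidisc by blast
  have "\<forall>i. \<exists>n. n \<le> N i \<and> 1 \<le> cmod (c i n)"
    using vs unfolding vector_segment_def by blast
  then obtain n where n: "\<And>i. n i \<le> N i" "\<And>i. 1 \<le> cmod (c i (n i))" by metis
  define f where "f i m = segment_vector (z i) (N i) (c i) m" for i m
  define y where "y i = \<Phi> (int (n i)) (z i)" for i
  have yc: "y i \<in> closed_bidisc" for i unfolding y_def by (rule Phi_in_closed_bidisc[OF zc])
  have "\<forall>\<^sub>F m in sequentially. \<forall>i\<in>{..k}. norm (shifted \<mu> T (f i m)) \<le> 3 * \<epsilon>"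
    unfolding f_def by (intro eventually_ball_finite ballI norm_shifted_segment_vector[OF vs e]) auto
  moreover have "\<forall>\<^sub>F m in sequentially. \<forall>i\<in>{..k}. 3 / 4 < cmod (apply_bidisc (f i m) (y i))"
    unfolding f_def y_def
  proof (intro eventually_ball_finite ballI)
    fix i
    show "\<forall>\<^sub>F m in sequentially. 3 / 4 < cmod (apply_bidisc (segment_vector (z i) (N i) (c i) m) (\<Phi> (int (n i)) (z i)))"
      using n(2)[of i] by (intro order_tendstoD(1)[OF tendsto_norm[OF segment_vector_at_orbit[OF zt zz n(1)]]]) auto
  qed auto
  moreover have "\<forall>\<^sub>F m in sequentially. \<forall>i\<in>{..k}. \<forall>j\<in>{..k}. i \<noteq> j \<longrightarrow> cmod (apply_bidisc (f i m) (y j)) < 1 / (4 * K)"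
    unfolding f_def
  proof (intro eventually_ball_finite ballI)
    fix i j
    show "\<forall>\<^sub>F m in sequentially. i \<noteq> j \<longrightarrow> cmod (apply_bidisc (segment_vector (z i) (N i) (c i) m) (y j)) < 1 / (4 * K)"
    proof (cases "i = j")
      case False
      have "y j \<noteq> \<Phi> (int l) (z i)" if "l \<le> N i" for l
        using disj[OF False that n(1)[of j]] by (auto simp: y_def)
      from tendsto_norm[OF segment_vector_off_orbit[OF zt yc this]]
      have "\<forall>\<^sub>F m in sequentially. cmod (apply_bidisc (segment_vector (z i) (N i) (c i) m) (y j)) < 1 / (4 * K)"
        using K by (intro order_tendstoD(2)) auto
      then show ?thesis by eventually_elim simp
    qed simp
  qed auto
  ultimately have "\<forall>\<^sub>F m in sequentially. (\<forall>i\<in>{..k}. norm (shifted \<mu> T (f i m)) \<le> 3 * \<epsilon>) \<and>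
    (\<forall>i\<in>{..k}. 3 / 4 < cmod (apply_bidisc (f i m) (y i))) \<and>
    (\<forall>i\<in>{..k}. \<forall>j\<in>{..k}. i \<noteq> j \<longrightarrow> cmod (apply_bidisc (f i m) (y j)) < 1 / (4 * K))"
    by eventually_elim blast
  from eventually_happens'[OF sequentially_bot this]
  obtain m where mm: "\<forall>i\<in>{..k}. norm (shifted \<mu> T (f i m)) \<le> 3 * \<epsilon>"
    "\<forall>i\<in>{..k}. 3 / 4 < cmod (apply_bidisc (f i m) (y i))"
    "\<forall>i\<in>{..k}. \<forall>j\<in>{..k}. i \<noteq> j \<longrightarrow> cmod (apply_bidisc (f i m) (y j)) < 1 / (4 * K)"
    by blast
  have m: "\<And>i. i \<le> k \<Longrightarrow> norm (shifted \<mu> T (f i m)) \<le> 3 * \<epsilon>"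
    "\<And>i. i \<le> k \<Longrightarrow> 3 / 4 < cmod (apply_bidisc (f i m) (y i))"
    "\<And>i j. i \<le> k \<Longrightarrow> j \<le> k \<Longrightarrow> i \<noteq> j \<Longrightarrow> cmod (apply_bidisc (f i m) (y j)) < 1 / (4 * K)"
    using mm by blast+
  obtain a where a: "\<And>i. i \<le> k \<Longrightarrow> cmod (a i) \<le> 1" "\<exists>i\<le>k. cmod (a i) = 1"
    "norm (\<Sum>i\<le>k. a i *\<^sub>C f i m) \<le> C * (\<Sum>i\<le>k. norm (shifted \<mu> T (f i m)))"
    using C(2)[rule_format, of "\<lambda>i. f i m"] by blast
  obtain j where j: "j \<le> k" "cmod (a j) = 1" using a(2) by blast
  have "(\<Sum>i\<le>k. norm (shifted \<mu> T (f i m))) \<le> (\<Sum>i\<le>k. 3 * \<epsilon>)"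
    using m(1) by (intro sum_mono) auto
  then have "C * (\<Sum>i\<le>k. norm (shifted \<mu> T (f i m))) \<le> C * (K * (3 * \<epsilon>))"
    using C(1) by (intro mult_left_mono) (simp_all add: K_def)
  also have "\<dots> = 3 * C * (K * \<epsilon>)" by simp
  also have "K * \<epsilon> = 1 / (12 * (C + 1))" using K by (simp add: \<epsilon>_def)
  also have "3 * C * (1 / (12 * (C + 1))) \<le> 1 / 4"
    using C(1) by (simp add: divide_le_eq)
  finally have up: "norm (\<Sum>i\<le>k. a i *\<^sub>C f i m) \<le> 1 / 4" using a(3) by simp
  have "cmod (\<Sum>i\<in>{..k} - {j}. a i * apply_bidisc (f i m) (y j)) \<le> (\<Sum>i\<in>{..k} - {j}. 1 * (1 / (4 * K)))"
  proof (rule order_trans[OF norm_sum sum_mono])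
    fix i assume "i \<in> {..k} - {j}"
    then show "cmod (a i * apply_bidisc (f i m) (y j)) \<le> 1 * (1 / (4 * K))"
      unfolding norm_mult using a(1)[of i] m(3)[of i j] j by (intro mult_mono) auto
  qed
  also have "\<dots> \<le> K * (1 / (4 * K))"
    using j K by (simp add: K_def field_simps)
  also have "\<dots> = 1 / 4" using K by simp
  finally have rest: "cmod (\<Sum>i\<in>{..k} - {j}. a i * apply_bidisc (f i m) (y j)) \<le> 1 / 4" .
  have "apply_bidisc (\<Sum>i\<le>k. a i *\<^sub>C f i m) (y j) =
      a j * apply_bidisc (f j m) (y j) + (\<Sum>i\<in>{..k} - {j}. a i * apply_bidisc (f i m) (y j))"
    using j by (simp add: apply_bidisc_sum apply_simps sum.remove)
  then have "cmod (a j * apply_bidisc (f j m) (y j)) \<le> cmod (apply_bidisc (\<Sum>i\<le>k. a i *\<^sub>C f i m) (y j)) + 1 / 4"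
    using rest norm_triangle_ineq4[of "apply_bidisc (\<Sum>i\<le>k. a i *\<^sub>C f i m) (y j)"
      "\<Sum>i\<in>{..k} - {j}. a i * apply_bidisc (f i m) (y j)"] by simp
  also have "\<dots> \<le> 1 / 4 + 1 / 4"
    using norm_apply_le[OF yc, of "\<Sum>i\<le>k. a i *\<^sub>C f i m" j] up by linarith
  finally show False using m(2)[OF j(1)] j(2) by (simp add: norm_mult)
qed

end

section \<open>The annulus, and zeros of the weight on the torus\<close>

lemma eventually_notin_finite:
  assumes "finite G"
  shows "\<forall>\<^sub>F x in at a within S. (x::'a::t1_space) \<notin> G"
proof -
  have "open (- (G - {a}))" using assms by (intro open_Compl finite_imp_closed) simp
  then show ?thesis
    unfolding eventually_at_topological by (intro exI[of _ "- (G - {a})"]) simp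
qed

lemma periodic_positive_bounds:
  fixes x :: "nat \<Rightarrow> real"
  assumes "p > 0" "\<And>n. x (n + p) = x n" "\<And>n. x n > 0"
  obtains K where "K \<ge> 1" "\<And>n. x n \<le> K" "\<And>n. 1 / x n \<le> K"
proof -
  have per: "x (n + p * k) = x n" for n k
  proof (induction k)
    case (Suc k)
    then show ?case using assms(2)[of "n + p * k"] by (simp add: algebra_simps)
  qed simp
  have red: "x n = x (n mod p)" for n
    using per[of "n mod p" "n div p"] by simp
  define K where "K = Max (insert 1 (x ` {..<p} \<union> (\<lambda>n. 1 / x n) ` {..<p}))"
  have fin: "finite (insert 1 (x ` {..<p} \<union> (\<lambda>n. 1 / x n) ` {..<p}))" by simp
  have "x n \<le> K" "1 / x n \<le> K" for n
    unfolding red[of n] K_def using assms(1) by (auto intro!: Max_ge[OF fin])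
  moreover have "K \<ge> 1" unfolding K_def by (intro Max_ge[OF fin]) simp
  ultimately show ?thesis using that by blast
qed

context weighted_rotation
begin

text \<open>A segment that starts at any point of the torus, possibly on the circle over \<open>\<zeta>\<close>, is moved slightly in the second
  coordinate, so as to leave that circle and to avoid a given finite set.\<close>

lemma perturb_orbit_segment:
  assumes z: "z \<in> torus" and d: "d > 0" and F: "finite F"
  obtains u where "u \<in> torus" "snd u \<noteq> \<zeta>" "\<And>n. n \<le> N \<Longrightarrow> snd (\<Phi> (int n) u) \<notin> F"
    "\<And>n. n \<le> N \<Longrightarrow> cmod (apply_bidisc w (\<Phi> (int n) u) - apply_bidisc w (\<Phi> (int n) z)) \<le> d"
proof -
  obtain x y0 where xy: "z = (x, y0)" "x \<in> sphere 0 1" "y0 \<in> sphere 0 1" using z by auto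
  let ?fil = "at y0 within sphere 0 1"
  define G where "G = insert \<zeta> (\<Union>n\<in>{..N}. parabolic \<zeta> (- (of_int (int n) * b)) ` F)"
  have G: "finite G" using F by (simp add: G_def)
  have ev1: "\<forall>\<^sub>F y in ?fil. y \<notin> G" by (rule eventually_notin_finite[OF G])
  have ev2: "\<forall>\<^sub>F y in ?fil. \<forall>n\<in>{..N}. cmod (apply_bidisc w (\<Phi> (int n) (x, y)) - apply_bidisc w (\<Phi> (int n) (x, y0))) < d"
  proof (intro eventually_ball_finite ballI)
    fix n
    have "continuous_on (sphere 0 1) (\<lambda>y. apply_bidisc w (\<Phi> (int n) (x, y)))"
    proof (rule continuous_on_compose2[OF continuous_on_apply_bidisc])
      show "continuous_on (sphere 0 1) (\<lambda>y. \<Phi> (int n) (x, y))"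
        by (rule continuous_on_compose2[OF continuous_on_Phi]) (use xy in \<open>auto intro!: continuous_intros\<close>)
      show "(\<lambda>y. \<Phi> (int n) (x, y)) ` sphere 0 1 \<subseteq> closed_bidisc"
        by (rule image_subsetI, rule Phi_in_closed_bidisc) (use xy in auto)
    qed
    then have "((\<lambda>y. apply_bidisc w (\<Phi> (int n) (x, y))) \<longlongrightarrow> apply_bidisc w (\<Phi> (int n) (x, y0))) ?fil"
      using xy by (auto simp: continuous_on_def)
    from tendstoD[OF this d]
    show "\<forall>\<^sub>F y in ?fil. cmod (apply_bidisc w (\<Phi> (int n) (x, y)) - apply_bidisc w (\<Phi> (int n) (x, y0))) < d"
      by (simp add: dist_norm)
  qed simp
  have ev3: "\<forall>\<^sub>F y in ?fil. y \<in> sphere 0 1"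
    by (auto simp: eventually_at_filter)
  have "y0 islimpt sphere 0 1"
  proof (rule connected_imp_perfect)
    show "connected (sphere (0::complex) 1)" by (rule connected_sphere) simp
    show "sphere (0::complex) 1 \<noteq> {a}" for a
    proof
      assume "sphere (0::complex) 1 = {a}"
      moreover have "(1::complex) \<in> sphere 0 1" "(-1::complex) \<in> sphere 0 1" by simp_all
      ultimately show False by simp
    qed
  qed (use xy in simp)
  then have "?fil \<noteq> bot" by (simp add: trivial_limit_within)
  moreover from ev1 ev2 ev3 have "\<forall>\<^sub>F y in ?fil. y \<notin> G \<and> y \<in> sphere 0 1 \<and>
     (\<forall>n\<in>{..N}. cmod (apply_bidisc w (\<Phi> (int n) (x, y)) - apply_bidisc w (\<Phi> (int n) (x, y0))) < d)"
    by eventually_elim blast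
  ultimately have "\<exists>y. y \<notin> G \<and> y \<in> sphere 0 1 \<and>
     (\<forall>n\<in>{..N}. cmod (apply_bidisc w (\<Phi> (int n) (x, y)) - apply_bidisc w (\<Phi> (int n) (x, y0))) < d)"
    by (rule eventually_happens')
  then obtain y where y: "y \<notin> G" "y \<in> sphere 0 1"
     "\<forall>n\<in>{..N}. cmod (apply_bidisc w (\<Phi> (int n) (x, y)) - apply_bidisc w (\<Phi> (int n) (x, y0))) < d" by blast
  show ?thesis
  proof (rule that[of "(x, y)"])
    show "(x, y) \<in> torus" using xy y by simp
    show "snd (x, y) \<noteq> \<zeta>" using y(1) by (auto simp: G_def)
    fix n assume n: "n \<le> N"
    show "cmod (apply_bidisc w (\<Phi> (int n) (x, y)) - apply_bidisc w (\<Phi> (int n) z)) \<le> d"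
      using y(3) n by (simp add: xy(1) less_imp_le)
    show "snd (\<Phi> (int n) (x, y)) \<notin> F"
    proof
      assume "snd (\<Phi> (int n) (x, y)) \<in> F"
      moreover have "parabolic \<zeta> (- (of_int (int n) * b)) (snd (\<Phi> (int n) (x, y))) = y"
        using y(2) by (simp add: \<Phi>_def parabolic_add[OF norm_zeta] parabolic_0[OF norm_zeta])
      ultimately have "y \<in> G" unfolding G_def using n by force
      with y(1) show False by simp
    qed
  qed
qed

lemma cocycle_on_cycle:
  assumes x: "x \<in> sphere 0 1"
  shows "apply_bidisc w (\<Phi> (int (n + p)) (x, \<zeta>)) = apply_bidisc w (\<Phi> (int n) (x, \<zeta>))"
    and "cocycle w (n + p) (x, \<zeta>) = cocycle w n (x, \<zeta>) * cocycle w p (x, \<zeta>)"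
proof -
  show per: "apply_bidisc w (\<Phi> (int (n + p)) (x, \<zeta>)) = apply_bidisc w (\<Phi> (int n) (x, \<zeta>))" for n
    by (simp add: Phi_zeta power_int_add alpha_nonzero alpha_power)
  show "cocycle w (n + p) (x, \<zeta>) = cocycle w n (x, \<zeta>) * cocycle w p (x, \<zeta>)"
  proof (induction n)
    case (Suc n)
    then show ?case using per[of n] by (simp add: cocycle_Suc mult_ac)
  qed simp
qed

text \<open>The quotients have \<open>p\<close>-periodic modulus.\<close>

lemma cocycle_on_cycle_bounds:
  assumes x: "x \<in> sphere 0 1" and mu: "\<mu> \<noteq> 0" and eq: "cmod (cocycle w p (x, \<zeta>)) = cmod \<mu> ^ p"
  obtains K where "K \<ge> 1" "\<And>n. cmod (\<mu> ^ n / cocycle w n (x, \<zeta>)) \<le> K"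
    "\<And>n. cmod (cocycle w n (x, \<zeta>) / \<mu> ^ n) \<le> K" "\<And>n. cocycle w n (x, \<zeta>) \<noteq> 0"
proof -
  have nz: "cocycle w n (x, \<zeta>) \<noteq> 0" for n
  proof -
    have "cocycle w p (x, \<zeta>) \<noteq> 0" using eq mu by auto
    then have w0: "apply_bidisc w (\<Phi> (int j) (x, \<zeta>)) \<noteq> 0" if "j < p" for j
      using that unfolding cocycle_def by (meson lessThan_iff prod_zero finite_lessThan)
    have "apply_bidisc w (\<Phi> (int j) (x, \<zeta>)) \<noteq> 0" for j
    proof (induction j rule: less_induct)
      case (less j)
      show ?case
      proof (cases "j < p")
        case False
        then show ?thesis
          using less[of "j - p"] cocycle_on_cycle(1)[OF x, of "j - p"] p_pos by simp
      qed (use w0 in simp)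
    qed
    then show ?thesis unfolding cocycle_def by simp
  qed
  define X where "X n = cmod (cocycle w n (x, \<zeta>)) / cmod \<mu> ^ n" for n
  have "X (n + p) = X n" for n
    using mu by (simp add: X_def cocycle_on_cycle(2)[OF x] norm_mult eq power_add)
  moreover have "X n > 0" for n using nz mu by (simp add: X_def)
  ultimately obtain K where K: "K \<ge> 1" "\<And>n. X n \<le> K" "\<And>n. 1 / X n \<le> K"
    using periodic_positive_bounds[of p X] p_pos by metis
  show ?thesis
    by (rule that[of K]) (use K nz in \<open>auto simp: X_def norm_divide norm_power\<close>)
qed

text \<open>With coefficients \<open>w\<^sub>n(x, \<zeta>) / \<mu>\<^sup>n\<close>, whose moduli lie between positive constants, the recursion
  along the limit cycle holds exactly, except at the two ends. The ends contribute a bounded error,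
  while the sum of the moduli grows like \<open>N\<close>.\<close>

lemma functional_segment_on_circle:
  assumes x: "x \<in> sphere 0 1" and mu: "\<mu> \<noteq> 0" and eq: "cmod (cocycle w p (x, \<zeta>)) = cmod \<mu> ^ p"
    and e: "\<epsilon> > 0" and F: "finite F"
  shows "\<exists>z N c. functional_segment \<mu> \<epsilon> z N c \<and> (\<forall>n\<le>N. snd (\<Phi> (int n) z) \<notin> F)"
proof -
  let ?z0 = "(x, \<zeta>)"
  let ?\<omega> = "\<lambda>n. apply_bidisc w (\<Phi> (int n) ?z0)"
  obtain K where K: "K \<ge> 1" "\<And>n. cmod (\<mu> ^ n / cocycle w n ?z0) \<le> K"
    "\<And>n. cmod (cocycle w n ?z0 / \<mu> ^ n) \<le> K" "\<And>n. cocycle w n ?z0 \<noteq> 0"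
    using cocycle_on_cycle_bounds[OF x mu eq] by metis
  define e' where "e' n = cocycle w n ?z0 / \<mu> ^ n" for n
  have e'0: "e' 0 = 1" and e'S: "\<mu> * e' (Suc n) = e' n * ?\<omega> n" for n
    using mu by (simp_all add: e'_def cocycle_Suc field_simps)
  have e'le: "cmod (e' n) \<le> K" and e'ge: "1 \<le> K * cmod (e' n)" for n
    using K(2)[of n] K(3)[of n] K(4)[of n] mu by (auto simp: e'_def norm_divide norm_mult divide_simps mult_ac)
  have K0: "K > 0" using K(1) by simp
  obtain N :: nat where N: "2 * (K * cmod \<mu> * (1 + K)) / \<epsilon> \<le> real N"
    using real_arch_simple by blast
  \<comment> \<open>The normalisation makes the sum of the moduli at least one.\<close>
  define s where "s = K / real (Suc N)"
  have s: "s > 0" using K0 by (simp add: s_def)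
  have sN: "real (Suc N) * s = K" by (simp add: s_def)
  define d where "d = \<epsilon> / (2 * K\<^sup>2)"
  have d: "d > 0" using e K0 by (simp add: d_def)
  have z0: "?z0 \<in> torus" using x zeta_in by simp
  obtain u where u: "u \<in> torus" "snd u \<noteq> \<zeta>" "\<And>n. n \<le> N \<Longrightarrow> snd (\<Phi> (int n) u) \<notin> F"
    "\<And>n. n \<le> N \<Longrightarrow> cmod (apply_bidisc w (\<Phi> (int n) u) - ?\<omega> n) \<le> d"
    using perturb_orbit_segment[OF z0 d F, of N] by metis
  define c where "c n = of_real s * e' n" for n
  have mass: "1 \<le> (\<Sum>n\<le>N. cmod (c n))"
  proof -
    have "(1::real) = (\<Sum>n\<le>N. s * (1 / K))" using sN K0 by simp
    also have "\<dots> \<le> (\<Sum>n\<le>N. cmod (c n))"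
      using e'ge K0 s by (intro sum_mono) (simp add: c_def norm_mult field_simps)
    finally show ?thesis .
  qed
  have "cmod (\<mu> * c 0) = cmod \<mu> * s" using s by (simp add: c_def e'0 norm_mult)
  moreover have "(\<Sum>n<N. cmod (\<mu> * c (Suc n) - c n * apply_bidisc w (\<Phi> (int n) u))) \<le> (\<Sum>n<N. s * K * d)"
  proof (rule sum_mono)
    fix n assume n: "n \<in> {..<N}"
    have "\<mu> * c (Suc n) = c n * ?\<omega> n" using e'S[of n] by (simp add: c_def)
    then have "\<mu> * c (Suc n) - c n * apply_bidisc w (\<Phi> (int n) u)
        = - (c n * (apply_bidisc w (\<Phi> (int n) u) - ?\<omega> n))" by (simp add: algebra_simps)
    then have "cmod (\<mu> * c (Suc n) - c n * apply_bidisc w (\<Phi> (int n) u))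
        = s * cmod (e' n) * cmod (apply_bidisc w (\<Phi> (int n) u) - ?\<omega> n)"
      using s by (simp add: c_def norm_mult)
    also have "\<dots> \<le> s * K * d"
      using n s e'le[of n] u(4)[of n] K0 by (intro mult_mono) auto
    finally show "cmod (\<mu> * c (Suc n) - c n * apply_bidisc w (\<Phi> (int n) u)) \<le> s * K * d" .
  qed
  moreover have "cmod (c N * apply_bidisc w (\<Phi> (int N) u)) \<le> cmod \<mu> * s * K + s * K * d"
  proof -
    have "c N * apply_bidisc w (\<Phi> (int N) u) = \<mu> * c (Suc N) + c N * (apply_bidisc w (\<Phi> (int N) u) - ?\<omega> N)"
      using e'S[of N] by (simp add: c_def algebra_simps)
    also have "cmod \<dots> \<le> cmod (\<mu> * c (Suc N)) + cmod (c N * (apply_bidisc w (\<Phi> (int N) u) - ?\<omega> N))"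
      by (rule norm_triangle_ineq)
    also have "cmod (\<mu> * c (Suc N)) \<le> cmod \<mu> * s * K"
      using s e'le[of "Suc N"] by (simp add: c_def norm_mult mult.assoc mult_left_mono)
    also have "cmod (c N * (apply_bidisc w (\<Phi> (int N) u) - ?\<omega> N)) \<le> s * K * d"
      unfolding norm_mult using s e'le[of N] u(4)[of N] K0
      by (intro mult_mono) (auto simp: c_def norm_mult)
    finally show ?thesis by simp
  qed
  ultimately have "cmod (\<mu> * c 0) + (\<Sum>n<N. cmod (\<mu> * c (Suc n) - c n * apply_bidisc w (\<Phi> (int n) u)))
      + cmod (c N * apply_bidisc w (\<Phi> (int N) u))
    \<le> cmod \<mu> * s + (\<Sum>n<N. s * K * d) + (cmod \<mu> * s * K + s * K * d)" by linarith
  also have "\<dots> = cmod \<mu> * (1 + K) * s + (real (Suc N) * s) * K * d"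
    by (simp add: algebra_simps)
  also have "(real (Suc N) * s) * K * d = \<epsilon> / 2"
    unfolding sN using K0 by (simp add: d_def power2_eq_square)
  also have "cmod \<mu> * (1 + K) * s \<le> \<epsilon> / 2"
  proof -
    have "2 * (K * cmod \<mu> * (1 + K)) \<le> \<epsilon> * real N" using N e by (simp add: field_simps)
    also have "\<dots> \<le> \<epsilon> * real (Suc N)" using e by simp
    finally show ?thesis by (simp add: s_def field_simps)
  qed
  finally have "functional_segment \<mu> \<epsilon> u N c"
    unfolding functional_segment_def using u mass by simp
  then show ?thesis using u(3) by blast
qed

text \<open>In the supremum norm the ends cannot be neglected. So the exact solution \<open>\<mu>\<^sup>n / w\<^sub>n(x, \<zeta>)\<close> is
  multiplied by a tent function of small slope.\<close>

lemma vector_segment_on_circle: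
  assumes x: "x \<in> sphere 0 1" and mu: "\<mu> \<noteq> 0" and eq: "cmod (cocycle w p (x, \<zeta>)) = cmod \<mu> ^ p"
    and e: "\<epsilon> > 0" and F: "finite F"
  shows "\<exists>z N c. vector_segment \<mu> \<epsilon> z N c \<and> (\<forall>n\<le>N. snd (\<Phi> (int n) z) \<notin> F)"
proof -
  let ?z0 = "(x, \<zeta>)"
  let ?\<omega> = "\<lambda>n. apply_bidisc w (\<Phi> (int n) ?z0)"
  obtain K where K: "K \<ge> 1" "\<And>n. cmod (\<mu> ^ n / cocycle w n ?z0) \<le> K"
    "\<And>n. cmod (cocycle w n ?z0 / \<mu> ^ n) \<le> K" "\<And>n. cocycle w n ?z0 \<noteq> 0"
    using cocycle_on_cycle_bounds[OF x mu eq] by metis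
  define e' where "e' n = \<mu> ^ n / cocycle w n ?z0" for n
  have nzw: "?\<omega> n \<noteq> 0" for n using K(4)[of "Suc n"] by (simp add: cocycle_Suc)
  have e'S: "\<mu> * e' n = e' (Suc n) * ?\<omega> n" for n
    using nzw[of n] by (simp add: e'_def cocycle_Suc)
  have e'le: "cmod (e' n) \<le> K" and e'ge: "1 \<le> K * cmod (e' n)" for n
    using K(2)[of n] K(3)[of n] K(4)[of n] mu by (auto simp: e'_def norm_divide norm_mult divide_simps mult_ac)
  have K0: "K > 0" using K(1) by simp
  obtain L0 :: nat where L0: "2 * (K * K * cmod \<mu>) / \<epsilon> \<le> real L0"
    using real_arch_simple by blast
  define L where "L = Suc L0"
  have L: "real L > 0" "2 * (K * K * cmod \<mu>) \<le> \<epsilon> * real L"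
    using L0 e by (auto simp: L_def field_simps)
  define N where "N = 2 * L"
  \<comment> \<open>A tent of height one at \<open>L\<close>, which vanishes at both ends of the segment.\<close>
  define \<tau> where "\<tau> n = max 0 (1 - \<bar>real n - real L\<bar> / real L)" for n
  have t0: "\<tau> 0 = 0" and tN: "\<tau> (Suc N) = 0" and tL: "\<tau> L = 1"
    using L(1) by (auto simp: \<tau>_def N_def max_def field_simps)
  have t1: "0 \<le> \<tau> n" "\<tau> n \<le> 1" for n using L(1) by (auto simp: \<tau>_def)
  have lip: "\<bar>\<tau> n - \<tau> (Suc n)\<bar> \<le> 1 / real L" for n
  proof -
    have "\<bar>\<bar>real n - real L\<bar> / real L - \<bar>real (Suc n) - real L\<bar> / real L\<bar> \<le> 1 / real L"
      using L(1) by (simp add: diff_divide_distrib[symmetric] divide_right_mono)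
    moreover have "\<bar>max 0 (1 - u) - max 0 (1 - v)\<bar> \<le> \<bar>u - v\<bar>" for u v :: real
      by (auto simp: max_def)
    ultimately show ?thesis unfolding \<tau>_def by (rule order_trans[rotated])
  qed
  define d where "d = \<epsilon> / (2 * K\<^sup>2)"
  have d: "d > 0" using e K0 by (simp add: d_def)
  have z0: "?z0 \<in> torus" using x zeta_in by simp
  obtain u where u: "u \<in> torus" "snd u \<noteq> \<zeta>" "\<And>n. n \<le> N \<Longrightarrow> snd (\<Phi> (int n) u) \<notin> F"
    "\<And>n. n \<le> N \<Longrightarrow> cmod (apply_bidisc w (\<Phi> (int n) u) - ?\<omega> n) \<le> d"
    using perturb_orbit_segment[OF z0 d F, of N] by metis
  define c where "c n = of_real (K * \<tau> n) * e' n" for n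
  have "cmod (\<mu> * c n - c (Suc n) * apply_bidisc w (\<Phi> (int n) u)) \<le> \<epsilon>" if n: "n \<le> N" for n
  proof -
    let ?W = "apply_bidisc w (\<Phi> (int n) u)"
    have "\<mu> * c n - c (Suc n) * ?W =
        of_real (K * (\<tau> n - \<tau> (Suc n))) * (\<mu> * e' n) - of_real (K * \<tau> (Suc n)) * e' (Suc n) * (?W - ?\<omega> n)"
      using e'S[of n] by (simp add: c_def algebra_simps)
    also have "cmod \<dots> \<le> cmod (of_real (K * (\<tau> n - \<tau> (Suc n))) * (\<mu> * e' n))
        + cmod (of_real (K * \<tau> (Suc n)) * e' (Suc n) * (?W - ?\<omega> n))"
      by (rule norm_triangle_ineq4)
    also have "cmod (of_real (K * (\<tau> n - \<tau> (Suc n))) * (\<mu> * e' n)) = K * \<bar>\<tau> n - \<tau> (Suc n)\<bar> * (cmod \<mu> * cmod (e' n))"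
      using K0 by (simp add: norm_mult abs_mult del: of_real_mult of_real_diff)
    also have "\<dots> \<le> K * (1 / real L) * (cmod \<mu> * K)"
      using K0 lip[of n] e'le[of n] L(1) by (intro mult_mono) auto
    also have "\<dots> \<le> \<epsilon> / 2"
      using L by (simp add: field_simps)
    also have "cmod (of_real (K * \<tau> (Suc n)) * e' (Suc n) * (?W - ?\<omega> n))
        = K * \<tau> (Suc n) * cmod (e' (Suc n)) * cmod (?W - ?\<omega> n)"
      using K0 t1[of "Suc n"] by (simp add: norm_mult abs_mult del: of_real_mult)
    also have "\<dots> \<le> K * 1 * K * d"
      using K0 t1[of "Suc n"] e'le[of "Suc n"] u(4)[OF n] by (intro mult_mono) auto
    also have "\<dots> = \<epsilon> / 2" using K0 by (simp add: d_def power2_eq_square)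
    finally show ?thesis by simp
  qed
  moreover have "\<exists>n\<le>N. 1 \<le> cmod (c n)"
    by (rule exI[of _ L]) (use e'ge[of L] K0 in \<open>simp add: N_def c_def tL norm_mult\<close>)
  ultimately have "vector_segment \<mu> \<epsilon> u N c"
    unfolding vector_segment_def using u t0 tN by (simp add: c_def)
  then show ?thesis using u(3) by blast
qed

lemma not_semi_Fredholm_on_circle:
  assumes x: "x \<in> sphere 0 1" and mu: "\<mu> \<noteq> 0" and eq: "cmod (cocycle w p (x, \<zeta>)) = cmod \<mu> ^ p"
  shows "\<mu> \<in> semi_Fredholm_spectrum T" "\<mu> \<in> approx_point_spectrum T"
proof -
  have "\<not> upper_semi_Fredholm (shifted \<mu> T)"
    by (rule not_upper_semi_Fredholm_if_vector_segments) (rule vector_segment_on_circle[OF assms])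
  moreover have "\<not> lower_semi_Fredholm (shifted \<mu> T)"
    by (rule not_lower_semi_Fredholm_if_functional_segments) (rule functional_segment_on_circle[OF assms])
  ultimately show "\<mu> \<in> semi_Fredholm_spectrum T"
    by (simp add: semi_Fredholm_spectrum_def semi_Fredholm_def)
  show "\<mu> \<in> approx_point_spectrum T"
    by (rule approx_point_spectrum_if_vector_segments)
      (use vector_segment_on_circle[OF assms _ finite.emptyI] in blast)
qed

lemma zero_in_semi_Fredholm_spectrum:
  assumes z: "z \<in> torus" "apply_bidisc w z = 0"
  shows "0 \<in> semi_Fredholm_spectrum T"
proof -
  have "\<exists>z N c. vector_segment 0 \<epsilon> z N c \<and> (\<forall>n\<le>N. snd (\<Phi> (int n) z) \<notin> F)"
    "\<exists>z N c. functional_segment 0 \<epsilon> z N c \<and> (\<forall>n\<le>N. snd (\<Phi> (int n) z) \<notin> F)"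
    if e: "\<epsilon> > 0" and F: "finite F" for \<epsilon> F
  proof -
    obtain u where u: "u \<in> torus" "snd u \<noteq> \<zeta>" "\<And>n. n \<le> 1 \<Longrightarrow> snd (\<Phi> (int n) u) \<notin> F"
      "\<And>n. n \<le> 1 \<Longrightarrow> cmod (apply_bidisc w (\<Phi> (int n) u) - apply_bidisc w (\<Phi> (int n) z)) \<le> \<epsilon>"
      using perturb_orbit_segment[OF z(1) e F, of 1] by metis
    have le: "cmod (apply_bidisc w (\<Phi> (int 0) u)) \<le> \<epsilon>"
      using u(4)[of 0] z(2) by (simp add: Phi_0)
    have "vector_segment 0 \<epsilon> u 1 (\<lambda>n. if n = 1 then 1 else 0)"
      unfolding vector_segment_def using u(1,2) le e by (auto simp: le_Suc_eq)
    then show "\<exists>z N c. vector_segment 0 \<epsilon> z N c \<and> (\<forall>n\<le>N. snd (\<Phi> (int n) z) \<notin> F)"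
      using u(3) by blast
    have "functional_segment 0 \<epsilon> u 0 (\<lambda>_. 1)"
      unfolding functional_segment_def using u(1,2) le by simp
    then show "\<exists>z N c. functional_segment 0 \<epsilon> z N c \<and> (\<forall>n\<le>N. snd (\<Phi> (int n) z) \<notin> F)"
      using u(3) by (metis le_zero_eq zero_le)
  qed
  from not_upper_semi_Fredholm_if_vector_segments[OF this(1)]
    not_lower_semi_Fredholm_if_functional_segments[OF this(2)]
  show ?thesis by (simp add: semi_Fredholm_spectrum_def semi_Fredholm_def)
qed

text \<open>At the last zero of \<open>w\<close> on the orbit the recursion \<open>\<mu> c\<^sub>n = c\<^sub>n\<^sub>+\<^sub>1 w(z\<^sub>n)\<close> allows \<open>c\<close> to
  start with \<open>0\<close> and to continue with \<open>1\<close>. Afterwards the solution is \<open>\<mu>\<^sup>n / w\<^sub>n\<close>, which decays since \<open>|\<mu>| < \<rho>\<close>.\<close>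

lemma vector_segment_after_zero:
  assumes r: "\<rho> > 0" "\<And>x. x \<in> sphere 0 1 \<Longrightarrow> \<rho> ^ p < cmod (cocycle w p (x, \<zeta>))"
    and mu: "cmod \<mu> < \<rho>" and z: "z \<in> torus" "apply_bidisc w z = 0" and e: "\<epsilon> > 0" and F: "finite F"
  shows "\<exists>z N c. vector_segment \<mu> \<epsilon> z N c \<and> (\<forall>n\<le>N. snd (\<Phi> (int n) z) \<notin> F)"
proof -
  have zc: "z \<in> closed_bidisc" and zy: "z \<in> sphere 0 1 \<times> cball 0 1" using z by auto
  obtain C where C: "C > 0" and fin: "finite {n. apply_bidisc w (\<Phi> n z) = 0}" and
    bd: "\<And>k n. (\<And>j. j < n \<Longrightarrow> apply_bidisc w (\<Phi> (k + int j) z) \<noteq> 0) \<Longrightarrow>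
       1 / cmod (cocycle w n (\<Phi> k z)) \<le> C * (1 / \<rho>) ^ n"
    using inverse_cocycle_bound_orbit[OF r zy] by metis
  let ?Z = "{n. apply_bidisc w (\<Phi> n z) = 0}"
  have ne: "?Z \<noteq> {}" using z(2) Phi_0[of z] by (metis (mono_tags, lifting) empty_Collect_eq)
  define M where "M = Max ?Z"
  have M: "apply_bidisc w (\<Phi> M z) = 0" using Max_in[OF fin ne] by (simp add: M_def)
  have after: "apply_bidisc w (\<Phi> n z) \<noteq> 0" if "n > M" for n
    using Max_ge[OF fin, of n] that by (auto simp: M_def)
  define z' where "z' = \<Phi> M z"
  have z't: "z' \<in> torus" unfolding z'_def by (rule Phi_in_torus[OF z(1)])
  have z'c: "z' \<in> closed_bidisc" using z't by auto
  have wn: "apply_bidisc w (\<Phi> (int (Suc n)) z') \<noteq> 0" for n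
    unfolding z'_def Phi_add[OF zc] by (rule after) simp
  define W where "W n = cocycle w n (\<Phi> 1 z')" for n
  have Wn: "1 / cmod (W n) \<le> C * (1 / \<rho>) ^ n" for n
    unfolding W_def z'_def Phi_add[OF zc] by (rule bd) (rule after, simp)
  have WS: "W (Suc n) = W n * apply_bidisc w (\<Phi> (int (Suc n)) z')" for n
    unfolding W_def cocycle_Suc Phi_add[OF z'c] by (simp add: add.commute)
  have W0: "W n \<noteq> 0" for n
  proof (induction n)
    case (Suc n)
    then show ?case using wn by (simp add: WS del: of_nat_Suc)
  qed (simp add: W_def)
  define e' where "e' n = \<mu> ^ n / W n" for n
  have e'S: "\<mu> * e' n = e' (Suc n) * apply_bidisc w (\<Phi> (int (Suc n)) z')" for n
    using W0 wn[of n] by (simp add: e'_def WS del: of_nat_Suc)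
  have e'le: "cmod (e' n) \<le> C * (cmod \<mu> / \<rho>) ^ n" for n
    using mult_left_mono[OF Wn[of n], of "cmod \<mu> ^ n"]
    by (simp add: e'_def norm_divide norm_power power_divide mult_ac)
  have q: "cmod \<mu> / \<rho> \<ge> 0" "cmod \<mu> / \<rho> < 1" using mu r(1) by auto
  have e'C: "cmod (e' n) \<le> C" for n
    using order_trans[OF e'le[of n] mult_left_mono[OF power_le_one[OF q(1) less_imp_le[OF q(2)], of n] less_imp_le[OF C]]]
    by simp
  have "(\<lambda>n. cmod \<mu> * (C * (cmod \<mu> / \<rho>) ^ n)) \<longlonglongrightarrow> cmod \<mu> * (C * 0)"
    using q by (intro tendsto_intros LIMSEQ_power_zero) auto
  then have "\<forall>\<^sub>F n in sequentially. cmod \<mu> * (C * (cmod \<mu> / \<rho>) ^ n) < \<epsilon>"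
    using e by (intro order_tendstoD(2)) auto
  then obtain n0 where n0: "cmod \<mu> * (C * (cmod \<mu> / \<rho>) ^ n0) < \<epsilon>"
    by (meson eventually_happens' sequentially_bot)
  define N where "N = Suc n0"
  define d where "d = \<epsilon> / C"
  have d: "d > 0" using e C by (simp add: d_def)
  obtain u where u: "u \<in> torus" "snd u \<noteq> \<zeta>" "\<And>n. n \<le> N \<Longrightarrow> snd (\<Phi> (int n) u) \<notin> F"
    "\<And>n. n \<le> N \<Longrightarrow> cmod (apply_bidisc w (\<Phi> (int n) u) - apply_bidisc w (\<Phi> (int n) z')) \<le> d"
    using perturb_orbit_segment[OF z't d F, of N] by metis
  define c where "c n = (if n = 0 \<or> n > N then 0 else e' (n - 1))" for n
  have "cmod (\<mu> * c n - c (Suc n) * apply_bidisc w (\<Phi> (int n) u)) \<le> \<epsilon>" if n: "n \<le> N" for n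
  proof (cases "n = N")
    case True
    have "cmod \<mu> * cmod (e' n0) \<le> cmod \<mu> * (C * (cmod \<mu> / \<rho>) ^ n0)"
      by (rule mult_left_mono[OF e'le]) simp
    then show ?thesis using n0 by (simp add: True c_def N_def norm_mult)
  next
    case False
    have "\<mu> * c n = c (Suc n) * apply_bidisc w (\<Phi> (int n) z')"
    proof (cases n)
      case 0
      then show ?thesis using M by (simp add: c_def Phi_0 z'_def)
    next
      case (Suc m)
      then show ?thesis using e'S[of m] n False by (simp add: c_def)
    qed
    then have "\<mu> * c n - c (Suc n) * apply_bidisc w (\<Phi> (int n) u)
        = - (c (Suc n) * (apply_bidisc w (\<Phi> (int n) u) - apply_bidisc w (\<Phi> (int n) z')))"
      by (simp add: algebra_simps)
    then have "cmod (\<mu> * c n - c (Suc n) * apply_bidisc w (\<Phi> (int n) u))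
        = cmod (c (Suc n)) * cmod (apply_bidisc w (\<Phi> (int n) u) - apply_bidisc w (\<Phi> (int n) z'))"
      by (simp add: norm_mult)
    also have "\<dots> \<le> C * d"
      using e'C[of n] C u(4)[OF n] by (intro mult_mono) (auto simp: c_def)
    also have "\<dots> = \<epsilon>" using C by (simp add: d_def)
    finally show ?thesis .
  qed
  moreover have "\<exists>n\<le>N. 1 \<le> cmod (c n)"
    by (rule exI[of _ 1]) (simp add: N_def c_def e'_def W_def)
  ultimately have "vector_segment \<mu> \<epsilon> u N c"
    unfolding vector_segment_def using u by (simp add: c_def)
  then show ?thesis using u(3) by blast
qed

text \<open>Before the first zero, the cocycle of length \<open>n\<close> that leads up to it is as large as \<open>\<rho>\<^sup>n\<close>.\<close>

lemma first_zero_on_orbit: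
  assumes r: "\<rho> > 0" "\<And>x. x \<in> sphere 0 1 \<Longrightarrow> \<rho> ^ p < cmod (cocycle w p (x, \<zeta>))"
    and z: "z \<in> sphere 0 1 \<times> cball 0 1" "apply_bidisc w z = 0"
  obtains M C where "C > 0" "apply_bidisc w (\<Phi> M z) = 0"
    "\<And>n. cocycle w n (\<Phi> (M - int n) z) \<noteq> 0"
    "\<And>n. 1 / cmod (cocycle w n (\<Phi> (M - int n) z)) \<le> C * (1 / \<rho>) ^ n"
proof -
  have zc: "z \<in> closed_bidisc" using z by auto
  obtain C where C: "C > 0" and fin: "finite {n. apply_bidisc w (\<Phi> n z) = 0}" and
    bd: "\<And>k n. (\<And>j. j < n \<Longrightarrow> apply_bidisc w (\<Phi> (k + int j) z) \<noteq> 0) \<Longrightarrow>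
       1 / cmod (cocycle w n (\<Phi> k z)) \<le> C * (1 / \<rho>) ^ n"
    using inverse_cocycle_bound_orbit[OF r z(1)] by metis
  let ?Z = "{n. apply_bidisc w (\<Phi> n z) = 0}"
  have ne: "?Z \<noteq> {}" using z(2) Phi_0[of z] by (metis (mono_tags, lifting) empty_Collect_eq)
  define M where "M = Min ?Z"
  have M: "apply_bidisc w (\<Phi> M z) = 0" using Min_in[OF fin ne] by (simp add: M_def)
  have before: "apply_bidisc w (\<Phi> n z) \<noteq> 0" if "n < M" for n
    using Min_le[OF fin, of n] that by (auto simp: M_def)
  show ?thesis
  proof (rule that[OF C M])
    show "1 / cmod (cocycle w n (\<Phi> (M - int n) z)) \<le> C * (1 / \<rho>) ^ n" for n
      by (rule bd) (rule before, simp)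
    show "cocycle w n (\<Phi> (M - int n) z) \<noteq> 0" for n
      unfolding cocycle_def by (simp add: Phi_add[OF zc]) (auto intro!: before)
  qed
qed

text \<open>The recursion \<open>\<mu> c\<^sub>n\<^sub>+\<^sub>1 = c\<^sub>n w(z\<^sub>n)\<close> of the transpose can be stopped without an error at
  the first zero of \<open>w\<close> on the orbit, and its solution decays in the backward direction.\<close>

lemma functional_segment_before_zero:
  assumes r: "\<rho> > 0" "\<And>x. x \<in> sphere 0 1 \<Longrightarrow> \<rho> ^ p < cmod (cocycle w p (x, \<zeta>))"
    and mu: "cmod \<mu> < \<rho>" and z: "z \<in> torus" "apply_bidisc w z = 0" and e: "\<epsilon> > 0" and F: "finite F"
  shows "\<exists>z N c. functional_segment \<mu> \<epsilon> z N c \<and> (\<forall>n\<le>N. snd (\<Phi> (int n) z) \<notin> F)"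
proof -
  have zc: "z \<in> closed_bidisc" and zy: "z \<in> sphere 0 1 \<times> cball 0 1" using z by auto
  obtain M C where C: "C > 0" and M: "apply_bidisc w (\<Phi> M z) = 0" and
    nz: "\<And>n. cocycle w n (\<Phi> (M - int n) z) \<noteq> 0" and
    bd: "\<And>n. 1 / cmod (cocycle w n (\<Phi> (M - int n) z)) \<le> C * (1 / \<rho>) ^ n"
    using first_zero_on_orbit[OF r zy z(2)] by metis
  define W where "W n = cocycle w n (\<Phi> (M - int n) z)" for n
  have Wn: "1 / cmod (W n) \<le> C * (1 / \<rho>) ^ n" and W0: "W n \<noteq> 0" for n
    unfolding W_def by (rule bd, rule nz)
  have WS: "W (Suc n) = apply_bidisc w (\<Phi> (M - int (Suc n)) z) * W n" for n
    unfolding W_def cocycle_Suc_shift[OF Phi_in_closed_bidisc[OF zc]] by (simp add: Phi_add[OF zc])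
  define e' where "e' n = \<mu> ^ n / W n" for n
  have e'S: "\<mu> * e' n = e' (Suc n) * apply_bidisc w (\<Phi> (M - int (Suc n)) z)" for n
    using W0[of n] W0[of "Suc n"] unfolding WS by (simp add: e'_def WS del: of_nat_Suc)
  have e'le: "cmod (e' n) \<le> C * (cmod \<mu> / \<rho>) ^ n" for n
    using mult_left_mono[OF Wn[of n], of "cmod \<mu> ^ n"]
    by (simp add: e'_def norm_divide norm_power power_divide mult_ac)
  have q: "cmod \<mu> / \<rho> \<ge> 0" "cmod \<mu> / \<rho> < 1" using mu r(1) by auto
  have e'C: "cmod (e' n) \<le> C" for n
    using order_trans[OF e'le[of n] mult_left_mono[OF power_le_one[OF q(1) less_imp_le[OF q(2)], of n] less_imp_le[OF C]]]
    by simp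
  have "(\<lambda>n. cmod \<mu> * (C * (cmod \<mu> / \<rho>) ^ n)) \<longlonglongrightarrow> cmod \<mu> * (C * 0)"
    using q by (intro tendsto_intros LIMSEQ_power_zero) auto
  then have "\<forall>\<^sub>F n in sequentially. cmod \<mu> * (C * (cmod \<mu> / \<rho>) ^ n) < \<epsilon> / 2"
    using e by (intro order_tendstoD(2)) auto
  then obtain N where N: "cmod \<mu> * (C * (cmod \<mu> / \<rho>) ^ N) < \<epsilon> / 2"
    by (meson eventually_happens' sequentially_bot)
  define d where "d = \<epsilon> / (2 * real (Suc N) * C)"
  have d: "d > 0" using e C by (simp add: d_def)
  define z' where "z' = \<Phi> (M - int N) z"
  have z't: "z' \<in> torus" unfolding z'_def by (rule Phi_in_torus[OF z(1)])
  have z'n: "\<Phi> (int n) z' = \<Phi> (M - int (N - n)) z" if "n \<le> N" for n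
    using that by (simp add: z'_def Phi_add[OF zc] of_nat_diff algebra_simps)
  obtain u where u: "u \<in> torus" "snd u \<noteq> \<zeta>" "\<And>n. n \<le> N \<Longrightarrow> snd (\<Phi> (int n) u) \<notin> F"
    "\<And>n. n \<le> N \<Longrightarrow> cmod (apply_bidisc w (\<Phi> (int n) u) - apply_bidisc w (\<Phi> (int n) z')) \<le> d"
    using perturb_orbit_segment[OF z't d F, of N] by metis
  define c where "c n = e' (N - n)" for n
  have mid: "cmod (\<mu> * c (Suc n) - c n * apply_bidisc w (\<Phi> (int n) u)) \<le> C * d" if n: "n < N" for n
  proof -
    have "N - n = Suc (N - Suc n)" using n by simp
    then have "\<mu> * c (Suc n) = c n * apply_bidisc w (\<Phi> (int n) z')"
      using e'S[of "N - Suc n"] n z'n[of n] by (simp add: c_def del: of_nat_Suc)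
    then have "\<mu> * c (Suc n) - c n * apply_bidisc w (\<Phi> (int n) u)
        = - (c n * (apply_bidisc w (\<Phi> (int n) u) - apply_bidisc w (\<Phi> (int n) z')))"
      by (simp add: algebra_simps)
    then have "cmod (\<mu> * c (Suc n) - c n * apply_bidisc w (\<Phi> (int n) u))
        = cmod (c n) * cmod (apply_bidisc w (\<Phi> (int n) u) - apply_bidisc w (\<Phi> (int n) z'))"
      by (simp add: norm_mult)
    also have "\<dots> \<le> C * d"
      using e'C C u(4)[of n] n by (intro mult_mono) (auto simp: c_def)
    finally show ?thesis .
  qed
  have last: "cmod (c N * apply_bidisc w (\<Phi> (int N) u)) \<le> C * d"
  proof -
    have "apply_bidisc w (\<Phi> (int N) z') = 0" using z'n[of N] M by simp
    then have "cmod (apply_bidisc w (\<Phi> (int N) u)) \<le> d" using u(4)[of N] by simp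
    then show ?thesis
      unfolding norm_mult using e'C[of 0] C by (intro mult_mono) (auto simp: c_def)
  qed
  have "cmod (\<mu> * c 0) \<le> \<epsilon> / 2"
    using mult_left_mono[OF e'le[of N], of "cmod \<mu>"] N by (simp add: c_def norm_mult)
  moreover have "(\<Sum>n<N. cmod (\<mu> * c (Suc n) - c n * apply_bidisc w (\<Phi> (int n) u))) \<le> (\<Sum>n<N. C * d)"
    using mid by (intro sum_mono) auto
  moreover have "(\<Sum>n<N. C * d) + C * d = \<epsilon> / 2"
  proof -
    have "(\<Sum>n<N. C * d) + C * d = real (Suc N) * (C * d)" by (simp add: algebra_simps)
    also have "\<dots> = \<epsilon> / 2" using C by (simp add: d_def del: of_nat_Suc)
    finally show ?thesis .
  qed
  ultimately have "cmod (\<mu> * c 0) + (\<Sum>n<N. cmod (\<mu> * c (Suc n) - c n * apply_bidisc w (\<Phi> (int n) u)))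
      + cmod (c N * apply_bidisc w (\<Phi> (int N) u)) \<le> \<epsilon>"
    using last by linarith
  moreover have "1 \<le> (\<Sum>n\<le>N. cmod (c n))"
  proof -
    have "1 = cmod (c N)" by (simp add: c_def e'_def W_def)
    also have "\<dots> \<le> (\<Sum>n\<le>N. cmod (c n))" by (rule member_le_sum) auto
    finally show ?thesis .
  qed
  ultimately have "functional_segment \<mu> \<epsilon> u N c"
    unfolding functional_segment_def using u by simp
  then show ?thesis using u(3) by blast
qed

lemma torus_zero_imp_small_in_semi_Fredholm_spectrum:
  assumes r: "\<rho> > 0" "\<And>x. x \<in> sphere 0 1 \<Longrightarrow> \<rho> ^ p < cmod (cocycle w p (x, \<zeta>))"
    and mu: "cmod \<mu> < \<rho>" and z: "z \<in> torus" "apply_bidisc w z = 0"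
  shows "\<mu> \<in> semi_Fredholm_spectrum T"
proof -
  have "\<not> upper_semi_Fredholm (shifted \<mu> T)"
    by (rule not_upper_semi_Fredholm_if_vector_segments) (rule vector_segment_after_zero[OF assms])
  moreover have "\<not> lower_semi_Fredholm (shifted \<mu> T)"
    by (rule not_lower_semi_Fredholm_if_functional_segments) (rule functional_segment_before_zero[OF assms])
  ultimately show ?thesis by (simp add: semi_Fredholm_spectrum_def semi_Fredholm_def)
qed

end

section \<open>Zeros of the weight off the torus\<close>

text \<open>The parameters for which a zero exists form a closed set by compactness and an open set by Hurwitz'
  theorem; zeros cannot escape through the circle.\<close>

lemma zeros_persist_in_disc:
  fixes H :: "'x::metric_space \<Rightarrow> complex \<Rightarrow> complex"
  assumes X: "compact X" "connected X"
    and cont: "continuous_on (X \<times> cball 0 1) (\<lambda>(x, y). H x y)"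
    and hol: "\<And>x. x \<in> X \<Longrightarrow> H x holomorphic_on ball 0 1"
    and nz: "\<And>x y. x \<in> X \<Longrightarrow> y \<in> sphere 0 1 \<Longrightarrow> H x y \<noteq> 0"
    and zero: "x0 \<in> X" "y0 \<in> cball 0 1" "H x0 y0 = 0"
    and x: "x \<in> X"
  shows "\<exists>y\<in>ball 0 1. H x y = 0"
proof -
  define S where "S = {x \<in> X. \<exists>y\<in>cball 0 1. H x y = 0}"
  have comp: "compact (X \<times> cball (0::complex) 1)" using X by (intro compact_Times) auto
  have Sfst: "S = fst ` {z \<in> X \<times> cball 0 1. (\<lambda>(x, y). H x y) z = 0}"
    unfolding S_def by force
  have "compact {z \<in> X \<times> cball 0 1. (\<lambda>(x, y). H x y) z = 0}"
    using continuous_closedin_preimage_constant[OF cont, of 0] comp by (rule closedin_compact[rotated])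
  then have "compact S" unfolding Sfst by (intro compact_continuous_image continuous_intros)
  then have cl: "closedin (top_of_set X) S"
    by (intro closed_subset compact_imp_closed) (auto simp: S_def)
  have unif: "uniformly_continuous_on (X \<times> cball 0 1) (\<lambda>(x, y). H x y)"
    by (rule compact_uniformly_continuous[OF cont comp])
  have sub: "closedin (top_of_set X) (X - S)"
    unfolding closedin_limpt
  proof (intro conjI allI impI)
    fix l assume l: "l islimpt (X - S) \<and> l \<in> X"
    then obtain u where u: "\<And>n::nat. u n \<in> X - S" "u \<longlonglongrightarrow> l"
      unfolding islimpt_sequential by blast
    have lX: "l \<in> X" using l by blast
    have "l \<notin> S"
    proof
      assume "l \<in> S"
      then obtain y where y: "y \<in> cball 0 1" "H l y = 0" by (auto simp: S_def)
      then have yb: "y \<in> ball 0 1" using nz[OF lX, of y] by (cases "cmod y = 1") auto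
      have "H l y \<noteq> 0"
      proof (rule Hurwitz_no_zeros[of "ball 0 1" "\<lambda>n. H (u n)" "H l"])
        show "H (u n) holomorphic_on ball 0 1" for n using hol u(1) by blast
        show "H l holomorphic_on ball 0 1" by (rule hol[OF lX])
        show "H (u n) z \<noteq> 0" if "z \<in> ball 0 1" for n z
          using u(1)[of n] that unfolding S_def by auto
        show "uniform_limit K (\<lambda>n. H (u n)) (H l) sequentially" if "compact K" "K \<subseteq> ball 0 1" for K
        proof (rule uniform_limitI)
          fix e :: real assume "e > 0"
          then obtain d where d: "d > 0"
            "\<And>p q. p \<in> X \<times> cball 0 1 \<Longrightarrow> q \<in> X \<times> cball 0 1 \<Longrightarrow> dist p q < d \<Longrightarrow>
               dist ((\<lambda>(x, y). H x y) p) ((\<lambda>(x, y). H x y) q) < e"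
            using unif unfolding uniformly_continuous_on_def by metis
          from tendstoD[OF u(2) d(1)]
          show "\<forall>\<^sub>F n in sequentially. \<forall>z\<in>K. dist (H (u n) z) (H l z) < e"
          proof eventually_elim
            case (elim n)
            show ?case
            proof
              fix z assume "z \<in> K"
              then have "z \<in> cball 0 1" using that(2) by auto
              then show "dist (H (u n) z) (H l z) < e"
                using d(2)[of "(u n, z)" "(l, z)"] u(1)[of n] lX elim by (simp add: dist_Pair_Pair)
            qed
          qed
        qed
        show "\<not> H l constant_on ball 0 1"
        proof
          assume "H l constant_on ball 0 1"
          then have const: "H l z = 0" if "z \<in> ball 0 1" for z
            using that yb y(2) unfolding constant_on_def by metis
          have "H l 1 = 0"
          proof (rule continuous_constant_on_closure[of "ball 0 1" "H l" 0])
            have "continuous_on (cball 0 1) (\<lambda>z. (\<lambda>(x, y). H x y) (l, z))"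
              by (rule continuous_on_compose2[OF cont]) (use lX in \<open>auto intro!: continuous_intros\<close>)
            then show "continuous_on (closure (ball 0 1)) (H l)" by simp
          qed (use const in auto)
          with nz[OF lX, of 1] show False by simp
        qed
      qed (use yb in auto)
      then show False using y by blast
    qed
    then show "l \<in> X - S" using lX by blast
  qed auto
  have op: "openin (top_of_set X) S"
    unfolding openin_closedin_eq using sub by (auto simp: S_def)
  have "S = {} \<or> S = X"
    using X(2) op cl unfolding connected_clopen by blast
  moreover have "x0 \<in> S" using zero by (auto simp: S_def)
  ultimately have "x \<in> S" using x by auto
  then obtain y where "y \<in> cball 0 1" "H x y = 0" by (auto simp: S_def)
  then show ?thesis using nz[OF x, of y] by (cases "cmod y = 1") auto
qed

text \<open>A functional on continuous functions on the circle that extends evaluation at \<open>a\<close> from the disc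
  algebra; the Cauchy kernel serves as well as the Poisson kernel here.\<close>

definition cauchy_mean :: "complex \<Rightarrow> (complex \<Rightarrow> complex) \<Rightarrow> complex" where
  "cauchy_mean a F = contour_integral (circlepath 0 1) (\<lambda>u. F u / (u - a)) / (2 * of_real pi * \<i>)"

lemma cauchy_mean_integrable:
  assumes "a \<in> ball 0 1" "continuous_on (sphere 0 1) F"
  shows "(\<lambda>u. F u / (u - a)) contour_integrable_on circlepath 0 1"
  by (rule contour_integrable_continuous_circlepath) (use assms in \<open>auto intro!: continuous_intros\<close>)

lemma cauchy_mean_holomorphic:
  assumes "a \<in> ball 0 1" "continuous_on (cball 0 1) F" "F holomorphic_on ball 0 1"
  shows "cauchy_mean a F = F a"
proof -
  have "((\<lambda>u. F u / (u - a)) has_contour_integral (2 * of_real pi * \<i> * F a)) (circlepath 0 1)"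
    by (rule Cauchy_integral_circlepath) (use assms in auto)
  then show ?thesis by (simp add: cauchy_mean_def contour_integral_unique)
qed

lemma cauchy_mean_cong:
  assumes "\<And>u. u \<in> sphere 0 1 \<Longrightarrow> F u = G u"
  shows "cauchy_mean a F = cauchy_mean a G"
  unfolding cauchy_mean_def
  by (intro arg_cong2[of _ _ _ _ "(/)"] contour_integral_cong) (use assms in auto)

lemma cauchy_mean_add:
  assumes "a \<in> ball 0 1" "continuous_on (sphere 0 1) F" "continuous_on (sphere 0 1) G"
  shows "cauchy_mean a (\<lambda>u. F u + G u) = cauchy_mean a F + cauchy_mean a G"
  unfolding cauchy_mean_def
  using contour_integral_add[OF cauchy_mean_integrable[OF assms(1,2)] cauchy_mean_integrable[OF assms(1,3)]]
  by (simp add: add_divide_distrib)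

lemma cauchy_mean_cmult:
  assumes "a \<in> ball 0 1" "continuous_on (sphere 0 1) F"
  shows "cauchy_mean a (\<lambda>u. c * F u) = c * cauchy_mean a F"
  unfolding cauchy_mean_def
  using contour_integral_lmul[OF cauchy_mean_integrable[OF assms], of c] by simp

lemma cauchy_mean_norm_le:
  assumes "a \<in> ball 0 1" "continuous_on (sphere 0 1) F" "\<And>u. u \<in> sphere 0 1 \<Longrightarrow> cmod (F u) \<le> B"
  shows "cmod (cauchy_mean a F) \<le> B / (1 - cmod a)"
proof -
  have B: "B \<ge> 0" using assms(3)[of 1] by (auto intro: order_trans[OF norm_ge_zero])
  have a: "1 - cmod a > 0" using assms(1) by simp
  have "cmod (contour_integral (circlepath 0 1) (\<lambda>u. F u / (u - a))) \<le> B / (1 - cmod a) * (2 * pi * 1)"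
  proof (rule has_contour_integral_bound_circlepath[OF has_contour_integral_integral[OF cauchy_mean_integrable[OF assms(1,2)]]])
    fix u :: complex assume u: "cmod (u - 0) = 1"
    have "1 - cmod a \<le> cmod (u - a)" using u norm_triangle_ineq2[of u a] by simp
    then show "cmod (F u / (u - a)) \<le> B / (1 - cmod a)"
      unfolding norm_divide using assms(3)[of u] u B a by (intro frac_le) auto
  qed (use B a in auto)
  then show ?thesis
    by (simp add: cauchy_mean_def norm_divide norm_mult field_simps)
qed

context weighted_rotation
begin

text \<open>If \<open>w\<close> has a zero with first coordinate on the circle, zeros persist over that circle.
  Otherwise the slices with fixed second coordinate have no zeros on the circle, and zeros persist as the second
  coordinate varies in the whole closed disc.\<close>

lemma interior_zero_on_cylinder:
  assumes nzT: "\<And>z. z \<in> torus \<Longrightarrow> apply_bidisc w z \<noteq> 0"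
    and z: "z \<in> closed_bidisc" "apply_bidisc w z = 0"
  shows "(\<forall>x\<in>sphere 0 1. \<exists>y\<in>ball 0 1. apply_bidisc w (x, y) = 0) \<or>
         (\<forall>y\<in>sphere 0 1. \<exists>x\<in>ball 0 1. apply_bidisc w (x, y) = 0)"
proof (cases "\<exists>x\<in>sphere 0 1. \<exists>y\<in>cball 0 1. apply_bidisc w (x, y) = 0")
  case True
  then obtain x0 y0 where z0: "x0 \<in> sphere 0 1" "y0 \<in> cball 0 1" "apply_bidisc w (x0, y0) = 0" by blast
  have "\<exists>y\<in>ball 0 1. apply_bidisc w (x, y) = 0" if x: "x \<in> sphere 0 1" for x
  proof (rule zeros_persist_in_disc[where H="\<lambda>x y. apply_bidisc w (x, y)" and X="sphere 0 1"])
    show "connected (sphere (0::complex) 1)" by (rule connected_sphere) simp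
    show "continuous_on (sphere 0 1 \<times> cball 0 1) (\<lambda>(x, y). apply_bidisc w (x, y))"
      by (simp add: case_prod_unfold) (rule continuous_on_subset[OF continuous_on_apply_bidisc], auto)
    show "(\<lambda>y. apply_bidisc w (x, y)) holomorphic_on ball 0 1" if "x \<in> sphere 0 1" for x
      using that by (intro holomorphic_slice_snd) auto
  qed (use z0 x nzT in auto)
  then show ?thesis by blast
next
  case False
  obtain x0 y0 where z0: "x0 \<in> cball 0 1" "y0 \<in> cball 0 1" "apply_bidisc w (x0, y0) = 0" using z by auto
  have "\<exists>x\<in>ball 0 1. apply_bidisc w (x, y) = 0" if y: "y \<in> sphere 0 1" for y
  proof (rule zeros_persist_in_disc[where H="\<lambda>y x. apply_bidisc w (x, y)" and X="cball 0 1"])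
    show "continuous_on (cball 0 1 \<times> cball 0 1) (\<lambda>(y, x). apply_bidisc w (x, y))"
      unfolding case_prod_unfold
      by (rule continuous_on_compose2[OF continuous_on_apply_bidisc]) (auto intro!: continuous_intros)
    show "(\<lambda>x. apply_bidisc w (x, y)) holomorphic_on ball 0 1" if "y \<in> cball 0 1" for y
      using that by (intro holomorphic_slice_fst) auto
    show "apply_bidisc w (x, y) \<noteq> 0" if "y \<in> cball 0 1" "x \<in> sphere 0 1" for x y
      using False that by blast
  qed (use z0 y in \<open>auto simp: convex_connected\<close>)
  then show ?thesis by blast
qed

end

lemma infinite_sphere: "infinite (sphere (0::complex) 1)"
proof
  assume f: "finite (sphere (0::complex) 1)"
  have "connected (sphere (0::complex) 1)" by (rule connected_sphere) simp
  then obtain a where "sphere (0::complex) 1 = {a}"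
    using f connected_finite_iff_sing[of "sphere (0::complex) 1"] by force
  moreover have "(1::complex) \<in> sphere 0 1" "(-1::complex) \<in> sphere 0 1" by simp_all
  ultimately show False by simp
qed

text \<open>Dominated convergence for a series of powers. The condition \<open>P\<close> tells whether \<open>g 0\<close> is the peak
  value; no other term survives.\<close>

lemma suminf_powers_tendsto:
  fixes a g :: "nat \<Rightarrow> complex"
  assumes sm: "summable (\<lambda>n. norm (a n))" and g: "\<And>n. cmod (g n) \<le> 1"
    and lim: "\<And>n. (\<lambda>m. g n ^ m) \<longlonglongrightarrow> (if P \<and> n = 0 then 1 else 0)"
  shows "(\<lambda>m. \<Sum>n. a n * g n ^ m) \<longlonglongrightarrow> (if P then a 0 else 0)"
proof -
  have "(\<lambda>m. \<Sum>n. a n * g n ^ m) \<longlonglongrightarrow> (\<Sum>n. a n * (if P \<and> n = 0 then 1 else 0))"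
  proof (rule tannerys_theorem[THEN conjunct2, THEN conjunct2])
    show "(\<lambda>m. a n * g n ^ m) \<longlonglongrightarrow> a n * (if P \<and> n = 0 then 1 else 0)" for n
      by (intro tendsto_mult tendsto_const lim)
    show "\<forall>\<^sub>F (n, m) in at_top \<times>\<^sub>F sequentially. norm (a n * g n ^ m) \<le> norm (a n)"
      using g by (intro always_eventually) (auto simp: norm_mult norm_power intro!: mult_right_le_one_le power_le_one)
  qed (use sm in auto)
  also have "(\<Sum>n. a n * (if P \<and> n = 0 then 1 else 0)) = (\<Sum>n\<in>{0}. a n * (if P \<and> n = 0 then 1 else 0))"
    by (rule suminf_finite) auto
  also have "\<dots> = (if P then a 0 else 0)" by simp
  finally show ?thesis .
qed

lemma exists_unimodular_root:
  assumes "p > 0" "cmod \<theta> = 1"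
  obtains x where "cmod x = 1" "x ^ p = \<theta>"
proof (rule that[of "cis (Arg \<theta> / real p)"])
  have "\<theta> \<noteq> 0" using assms by auto
  then have "cis (Arg \<theta>) = \<theta>" using assms(2) by (simp add: cis_Arg sgn_eq)
  then show "cis (Arg \<theta> / real p) ^ p = \<theta>" using assms(1) by (simp add: Complex.DeMoivre)
qed simp

context weighted_rotation
begin

lemma Im_height_coord_gt_1:
  assumes "y \<in> ball 0 1"
  shows "Im (height_coord \<zeta> y) > 1"
proof -
  have "y \<noteq> \<zeta>" using assms norm_zeta by auto
  moreover have "(cmod y)\<^sup>2 < 1" using assms by (simp add: abs_square_less_1)
  ultimately show ?thesis by (simp add: Im_height_coord[OF norm_zeta])
qed

lemma Im_height_coord_ge_1:
  assumes "y \<in> cball 0 1" "y \<noteq> \<zeta>"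
  shows "Im (height_coord \<zeta> y) \<ge> 1"
proof -
  have "(cmod y)\<^sup>2 \<le> 1" using assms by (simp add: power_le_one)
  then show ?thesis using assms(2) by (simp add: Im_height_coord[OF norm_zeta])
qed

text \<open>A point of the open disc is not a peak point, but a kernel function attains its maximum over
  the horizontal orbit of \<open>y0\<close> only at \<open>y0\<close>: in the coordinate it is \<open>\<kappa> \<mapsto> c / (\<kappa> - \<kappa>')\<close>, with the
  pole \<open>\<kappa>'\<close> vertically below the coordinate of \<open>y0\<close>.\<close>

lemma kernel_peak:
  assumes y0: "y0 \<in> ball 0 1"
  obtains g where "g holomorphic_on cball 0 1" "g y0 = 1"
    "\<And>n::nat. cmod (g (parabolic \<zeta> (- (real n * b)) y0)) \<le> 1"
    "\<And>n::nat. n > 0 \<Longrightarrow> cmod (g (parabolic \<zeta> (- (real n * b)) y0)) < 1"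
proof -
  define \<kappa> where "\<kappa> = height_coord \<zeta> y0"
  define h where "h = Im \<kappa> - 1"
  have h: "h > 0" using Im_height_coord_gt_1[OF y0] by (simp add: h_def \<kappa>_def)
  \<comment> \<open>The mirror image of \<open>\<kappa>\<close> in the line at height one, hence a pole outside the closed disc.\<close>
  define \<kappa>' where "\<kappa>' = \<kappa> - 2 * \<i> * of_real h"
  have Imk': "Im \<kappa>' < 1" using h by (simp add: \<kappa>'_def h_def)
  define g where "g y = 2 * \<i> * of_real h * (\<zeta> - y) / (2 * \<i> * \<zeta> - \<kappa>' * (\<zeta> - y))" for y
  have z0: "\<zeta> \<noteq> 0" using norm_zeta by auto
  have eq: "2 * \<i> * \<zeta> - \<kappa>' * (\<zeta> - y) = (\<zeta> - y) * (height_coord \<zeta> y - \<kappa>')" if "y \<noteq> \<zeta>" for y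
    using that by (simp add: height_coord_def field_simps)
  have nz: "2 * \<i> * \<zeta> - \<kappa>' * (\<zeta> - y) \<noteq> 0" if y: "y \<in> cball 0 1" for y
  proof (cases "y = \<zeta>")
    case False
    have "height_coord \<zeta> y - \<kappa>' \<noteq> 0"
      using Im_height_coord_ge_1[OF y False] Imk' by (metis eq_iff_diff_eq_0 not_le)
    then show ?thesis unfolding eq[OF False] using False by simp
  qed (use z0 in simp)
  have gk: "g y = 2 * \<i> * of_real h / (height_coord \<zeta> y - \<kappa>')" if "y \<noteq> \<zeta>" for y
    unfolding g_def eq[OF that] using that by simp
  have yc: "y0 \<in> cball 0 1" and ne: "y0 \<noteq> \<zeta>" using y0 norm_zeta by auto
  have val: "g (parabolic \<zeta> (- (real n * b)) y0) = 2 * \<i> * of_real h / (2 * \<i> * of_real h - of_real (real n * b))" for n :: nat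
    by (simp add: gk[OF parabolic_neq_fixed_point[OF norm_zeta yc ne]] height_coord_parabolic[OF norm_zeta yc ne]
        \<kappa>_def[symmetric] \<kappa>'_def)
  have sq: "(cmod (2 * \<i> * of_real h - of_real (real n * b)))\<^sup>2 = (2 * h)\<^sup>2 + (real n * b)\<^sup>2" for n :: nat
    unfolding cmod_power2 by simp
  have n2: "cmod (2 * \<i> * of_real h) = 2 * h" using h by (simp add: norm_mult)
  have le: "2 * h \<le> cmod (2 * \<i> * of_real h - of_real (real n * b))" for n :: nat
    by (rule power2_le_imp_le, unfold sq) simp_all
  show ?thesis
  proof (rule that[of g])
    show "g holomorphic_on cball 0 1"
      unfolding g_def[abs_def] using nz by (intro holomorphic_intros) auto
    show "g y0 = 1" unfolding gk[OF ne] using h by (simp add: \<kappa>_def[symmetric] \<kappa>'_def)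
    show "cmod (g (parabolic \<zeta> (- (real n * b)) y0)) \<le> 1" for n :: nat
      unfolding val norm_divide n2 using le[of n] h by (simp add: divide_le_eq)
    show "cmod (g (parabolic \<zeta> (- (real n * b)) y0)) < 1" if "n > 0" for n :: nat
    proof -
      have "2 * h < cmod (2 * \<i> * of_real h - of_real (real n * b))"
        by (rule power2_less_imp_less, unfold sq) (use that b_nonzero in simp_all)
      then show ?thesis unfolding val norm_divide n2 using h by (simp add: divide_less_eq)
    qed
  qed
qed

text \<open>The chain consists of evaluations along the backward orbit of the first zero, divided by the
  cocycle. The orbit stays over the \<open>p\<close>-th roots of \<open>x\<^sup>p\<close>, so functions of the \<open>p\<close>-th power of the first
  coordinate act on the functional as scalars. It does not vanish, since powers of a kernel function isolate
  the term at the zero itself.\<close>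

lemma functional_at_cylinder_zero:
  assumes r: "\<rho> > 0" "\<And>x. x \<in> sphere 0 1 \<Longrightarrow> \<rho> ^ p < cmod (cocycle w p (x, \<zeta>))"
    and mu: "cmod \<mu> < \<rho>" and x: "x \<in> sphere 0 1" and y: "y \<in> ball 0 1" and zero: "apply_bidisc w (x, y) = 0"
  obtains \<nu> where "bounded_cfunctional \<nu>" "\<And>f. \<nu> (shifted \<mu> T f) = 0" "\<exists>f. \<nu> f \<noteq> 0"
    "\<And>f g h. (\<And>z. z \<in> closed_bidisc \<Longrightarrow> apply_bidisc g z = h (fst z ^ p) * apply_bidisc f z) \<Longrightarrow> \<nu> g = h (x ^ p) * \<nu> f"
proof -
  have zy: "(x, y) \<in> sphere 0 1 \<times> cball 0 1" and zc: "(x, y) \<in> closed_bidisc" using x y by auto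
  obtain M C where C: "C > 0" and M: "apply_bidisc w (\<Phi> M (x, y)) = 0" and
    nz: "\<And>n. cocycle w n (\<Phi> (M - int n) (x, y)) \<noteq> 0" and
    bd: "\<And>n. 1 / cmod (cocycle w n (\<Phi> (M - int n) (x, y))) \<le> C * (1 / \<rho>) ^ n"
    using first_zero_on_orbit[OF r zy zero] by metis
  define u where "u n = \<Phi> (M - int n) (x, y)" for n
  have uc: "u n \<in> closed_bidisc" for n unfolding u_def by (rule Phi_in_closed_bidisc[OF zc])
  have u1: "\<Phi> 1 (u (Suc n)) = u n" for n by (simp add: u_def Phi_add[OF zc])
  define W where "W n = cocycle w n (u n)" for n
  have W0: "W n \<noteq> 0" and Wn: "1 / cmod (W n) \<le> C * (1 / \<rho>) ^ n" for n
    unfolding W_def u_def by (rule nz, rule bd)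
  have WS: "W (Suc n) = apply_bidisc w (u (Suc n)) * W n" for n
    unfolding W_def cocycle_Suc_shift[OF uc] u1 ..
  define \<tau> where "\<tau> n f = (1 / W n) * apply_bidisc f (u n)" for n f
  have \<tau>b: "bounded_cfunctional (\<tau> n)" for n
    using bounded_cfunctional_sum[of "{()}" "\<lambda>_ f. apply_bidisc f (u n)" "\<lambda>_. 1 / W n"]
      bounded_cfunctional_eval[OF uc] unfolding \<tau>_def[abs_def] by simp
  have \<tau>0: "\<tau> 0 (T f) = 0" for f
    using M by (simp add: \<tau>_def apply_T[OF uc]) (simp add: u_def)
  have \<tau>S: "\<tau> (Suc n) (T f) = \<tau> n f" for n f
  proof -
    have "apply_bidisc w (u (Suc n)) \<noteq> 0" using W0[of "Suc n"] WS[of n] by auto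
    then show ?thesis by (simp add: \<tau>_def apply_T[OF uc] u1 WS)
  qed
  have \<tau>le: "cmod (\<tau> n f) \<le> C * (1 / \<rho>) ^ n * norm f" for n f
  proof -
    have "cmod (\<tau> n f) = (1 / cmod (W n)) * cmod (apply_bidisc f (u n))" by (simp add: \<tau>_def norm_mult norm_divide)
    also have "\<dots> \<le> C * (1 / \<rho>) ^ n * norm f"
      using Wn[of n] norm_apply_le[OF uc] C r(1) by (intro mult_mono) auto
    finally show ?thesis .
  qed
  note chain = bounded_cfunctional_backward_chain[OF bounded_clinear_T \<tau>b \<tau>0 \<tau>S \<tau>le mu]
  define \<nu> where "\<nu> f = (\<Sum>n. \<mu> ^ n * \<tau> n f)" for f
  have orb: "fst (u n) ^ p = x ^ p" for n
  proof -
    have "(\<alpha> powi k) ^ p = 1" for k :: int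
      by (metis alpha_power mult.commute power_int_mult power_int_of_nat power_int_1_left)
    then show ?thesis by (simp add: u_def \<Phi>_def power_mult_distrib)
  qed
  show ?thesis
  proof (rule that[of \<nu>])
    show "bounded_cfunctional \<nu>" unfolding \<nu>_def[abs_def] by (rule chain(1))
    show "\<nu> (shifted \<mu> T f) = 0" for f unfolding \<nu>_def by (rule chain(2))
    show "\<nu> g = h (x ^ p) * \<nu> f"
      if "\<And>z. z \<in> closed_bidisc \<Longrightarrow> apply_bidisc g z = h (fst z ^ p) * apply_bidisc f z" for f g h
    proof -
      have "\<tau> n g = h (x ^ p) * \<tau> n f" for n
        using that[OF uc[of n]] by (simp add: \<tau>_def orb)
      then have "\<nu> g = (\<Sum>n. h (x ^ p) * (\<mu> ^ n * \<tau> n f))"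
        unfolding \<nu>_def by (intro suminf_cong) (simp add: mult_ac)
      then show ?thesis unfolding \<nu>_def by (simp add: suminf_mult[OF chain(3)])
    qed
    show "\<exists>f. \<nu> f \<noteq> 0"
    proof (rule ccontr)
      assume "\<not> ?thesis"
      then have \<nu>0: "\<nu> f = 0" for f by blast
      define y0 where "y0 = snd (u 0)"
      have y0: "y0 \<in> ball 0 1"
        using parabolic_in_disc(2)[OF norm_zeta y] by (simp add: y0_def u_def \<Phi>_def)
      have yn: "snd (u n) = parabolic \<zeta> (- (real n * b)) y0" for n
        using y by (simp add: y0_def u_def \<Phi>_def parabolic_add[OF norm_zeta] algebra_simps)
      obtain g where g: "g holomorphic_on cball 0 1" "g y0 = 1"
        "\<And>n::nat. cmod (g (parabolic \<zeta> (- (real n * b)) y0)) \<le> 1"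
        "\<And>n::nat. n > 0 \<Longrightarrow> cmod (g (parabolic \<zeta> (- (real n * b)) y0)) < 1"
        using kernel_peak[OF y0] by metis
      define f where "f m = bidisc_of (\<lambda>z. g (snd z) ^ m)" for m
      have f: "apply_bidisc (f m) z = g (snd z) ^ m" if "z \<in> closed_bidisc" for m z
        unfolding f_def
      proof (rule apply_bidisc_of[OF _ _ _ that])
        show "continuous_on closed_bidisc (\<lambda>z. g (snd z) ^ m)"
          by (intro continuous_intros continuous_on_compose2[OF holomorphic_on_imp_continuous_on[OF g(1)]]) auto
        show "(\<lambda>y. g (snd (x, y)) ^ m) holomorphic_on ball 0 1" for x :: complex
          using holomorphic_on_subset[OF g(1) ball_subset_cball] by (auto intro!: holomorphic_intros)
      qed auto
      define a where "a n = \<mu> ^ n * (1 / W n)" for n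
      have q: "0 \<le> cmod \<mu> / \<rho>" "cmod \<mu> / \<rho> < 1" using mu r(1) by auto
      have "summable (\<lambda>n. C * (cmod \<mu> / \<rho>) ^ n)"
        using q by (intro summable_mult summable_geometric) simp
      then have "summable (\<lambda>n. norm (a n))"
      proof (rule summable_comparison_test'[of _ 0])
        fix n :: nat
        have "norm (norm (a n)) = cmod \<mu> ^ n * (1 / cmod (W n))" by (simp add: a_def norm_mult norm_power norm_divide)
        also have "\<dots> \<le> cmod \<mu> ^ n * (C * (1 / \<rho>) ^ n)" by (intro mult_left_mono Wn) auto
        finally show "norm (norm (a n)) \<le> C * (cmod \<mu> / \<rho>) ^ n" by (simp add: power_divide mult_ac)
      qed
      moreover have "(\<lambda>m. g (snd (u n)) ^ m) \<longlonglongrightarrow> (if True \<and> n = 0 then 1 else 0)" for n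
      proof (cases "n = 0")
        case True
        then show ?thesis using g(2) by (simp add: y0_def)
      next
        case False
        then show ?thesis using LIMSEQ_power_zero[OF g(4)[of n]] by (simp add: yn)
      qed
      ultimately have "(\<lambda>m. \<Sum>n. a n * g (snd (u n)) ^ m) \<longlonglongrightarrow> (if True then a 0 else 0)"
        using g(3) by (intro suminf_powers_tendsto) (simp_all add: yn)
      moreover have "(\<Sum>n. a n * g (snd (u n)) ^ m) = \<nu> (f m)" for m
        unfolding \<nu>_def a_def \<tau>_def f[OF uc] by (simp add: mult.assoc)
      ultimately have "a 0 = 0" by (simp add: \<nu>0 LIMSEQ_const_iff)
      then show False by (simp add: a_def W_def)
    qed
  qed
qed

text \<open>Zeros over points with different \<open>p\<close>-th powers are separated by peak functions of that power.\<close>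

lemma not_lower_semi_Fredholm_cylinder_zeros:
  assumes r: "\<rho> > 0" "\<And>x. x \<in> sphere 0 1 \<Longrightarrow> \<rho> ^ p < cmod (cocycle w p (x, \<zeta>))"
    and mu: "cmod \<mu> < \<rho>" and zeros: "\<forall>x\<in>sphere 0 1. \<exists>y\<in>ball 0 1. apply_bidisc w (x, y) = 0"
  shows "\<not> lower_semi_Fredholm (shifted \<mu> T)"
proof (rule not_lower_semi_Fredholm_if_independent_functionals[OF bounded_clinear_shifted[OF bounded_clinear_T]])
  fix k :: nat
  obtain \<theta> :: "nat \<Rightarrow> complex" where \<theta>: "inj \<theta>" "range \<theta> \<subseteq> sphere 0 1"
    using infinite_countable_subset[OF infinite_sphere] by blast
  have th: "\<theta> i \<in> sphere 0 1" for i using \<theta>(2) by blast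
  have "\<exists>x. cmod x = 1 \<and> x ^ p = \<theta> i" for i
    using exists_unimodular_root[OF p_pos, of "\<theta> i"] th[of i] by (metis dist_0_norm mem_sphere)
  then obtain x where x: "\<And>i. cmod (x i) = 1" "\<And>i. x i ^ p = \<theta> i" by metis
  have "\<exists>\<nu>. bounded_cfunctional \<nu> \<and> (\<forall>f. \<nu> (shifted \<mu> T f) = 0) \<and> (\<exists>f. \<nu> f \<noteq> 0) \<and>
    (\<forall>f g h. (\<forall>z\<in>closed_bidisc. apply_bidisc g z = h (fst z ^ p) * apply_bidisc f z) \<longrightarrow> \<nu> g = h (\<theta> i) * \<nu> f)" for i
  proof -
    have xi: "x i \<in> sphere 0 1" using x(1)[of i] by simp
    obtain y where y: "y \<in> ball 0 1" "apply_bidisc w (x i, y) = 0" using zeros xi by blast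
    obtain \<nu> where "bounded_cfunctional \<nu>" "\<And>f. \<nu> (shifted \<mu> T f) = 0" "\<exists>f. \<nu> f \<noteq> 0"
      "\<And>f g h. (\<And>z. z \<in> closed_bidisc \<Longrightarrow> apply_bidisc g z = h (fst z ^ p) * apply_bidisc f z) \<Longrightarrow> \<nu> g = h (x i ^ p) * \<nu> f"
      using functional_at_cylinder_zero[OF r mu xi y] by metis
    then show ?thesis unfolding x(2) by blast
  qed
  then obtain \<nu> where \<nu>: "\<And>i. bounded_cfunctional (\<nu> i)" "\<And>i f. \<nu> i (shifted \<mu> T f) = 0" "\<And>i. \<exists>f. \<nu> i f \<noteq> 0"
    and mult: "\<And>i f g h. (\<forall>z\<in>closed_bidisc. apply_bidisc g z = h (fst z ^ p) * apply_bidisc f z) \<Longrightarrow> \<nu> i g = h (\<theta> i) * \<nu> i f"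
    by metis
  have "\<exists>F L. L \<noteq> 0 \<and> (\<forall>i\<le>k. (\<lambda>m::nat. \<nu> i (F m)) \<longlonglongrightarrow> (if i = j then L else 0))" for j
  proof -
    obtain f where f: "\<nu> j f \<noteq> 0" using \<nu>(3) by blast
    define q where "q v = (1 + cnj (\<theta> j) * v) / 2" for v
    define F where "F m = bidisc_of (\<lambda>z. q (fst z ^ p) ^ m * apply_bidisc f z)" for m :: nat
    have "apply_bidisc (F m) z = q (fst z ^ p) ^ m * apply_bidisc f z" if "z \<in> closed_bidisc" for m z
      unfolding F_def q_def
      by (rule apply_bidisc_of[OF _ _ _ that])
        (auto intro!: continuous_intros holomorphic_intros holomorphic_slice_fst holomorphic_slice_snd continuous_on_apply_bidisc)
    then have \<nu>F: "\<nu> i (F m) = q (\<theta> i) ^ m * \<nu> i f" for i m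
      by (intro mult[where h="\<lambda>v. q v ^ m"]) blast
    have "(\<lambda>m. q (\<theta> i) ^ m * \<nu> i f) \<longlonglongrightarrow> (if i = j then \<nu> j f else 0)" for i
    proof (cases "i = j")
      case True
      have "q (\<theta> j) = 1" using th[of j] by (simp add: q_def mult.commute complex_norm_square[symmetric])
      then show ?thesis by (simp add: True)
    next
      case False
      have tc: "\<theta> i \<in> cball 0 1" using th[of i] by simp
      have "cmod (1 + cnj (\<theta> j) * \<theta> i) \<noteq> 2"
        using one_plus_cnj_mult_eq_2_imp[OF th[of j] tc] False injD[OF \<theta>(1), of i j] by blast
      then have "cmod (q (\<theta> i)) < 1"
        using one_plus_cnj_mult_le_2[OF th[of j] tc] by (simp add: q_def norm_divide)
      from tendsto_mult_left_zero[OF LIMSEQ_power_zero[OF this]] False show ?thesis by simp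
    qed
    then show ?thesis using f unfolding \<nu>F[symmetric] by blast
  qed
  then show "\<exists>\<nu>. (\<forall>i\<le>k. bounded_cfunctional (\<nu> i) \<and> (\<forall>f. \<nu> i (shifted \<mu> T f) = 0)) \<and>
      (\<forall>j\<le>k. \<exists>F L. L \<noteq> 0 \<and> (\<forall>i\<le>k. (\<lambda>m::nat. \<nu> i (F m)) \<longlonglongrightarrow> (if i = j then L else 0)))"
    using \<nu>(1,2) by blast
qed

text \<open>In the slice of \<open>y\<close> the weight may be small on the backward orbit of \<open>(a, y)\<close> itself. But evaluation
  at \<open>(a, y)\<close> is a mean over the part of the torus in this slice, and on the torus the cocycle is bounded
  below; the chain transports the mean instead of the point. On functions of the second
  coordinate the functional is a sum of evaluations.\<close>

lemma functional_at_slice_zero: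
  assumes r: "\<rho> > 0" "\<And>x. x \<in> sphere 0 1 \<Longrightarrow> \<rho> ^ p < cmod (cocycle w p (x, \<zeta>))"
    and mu: "cmod \<mu> < \<rho>" and nzT: "\<And>z. z \<in> torus \<Longrightarrow> apply_bidisc w z \<noteq> 0"
    and a: "a \<in> ball 0 1" and y: "y \<in> sphere 0 1" and zero: "apply_bidisc w (a, y) = 0"
  obtains \<nu> \<kappa> where "bounded_cfunctional \<nu>" "\<And>f. \<nu> (shifted \<mu> T f) = 0"
    "summable (\<lambda>n. norm (\<kappa> n))" "\<kappa> 0 = 1"
    "\<And>f h. (\<And>z. z \<in> closed_bidisc \<Longrightarrow> apply_bidisc f z = h (snd z)) \<Longrightarrow>
       \<nu> f = (\<Sum>n. \<kappa> n * h (parabolic \<zeta> (- (real n * b)) y))"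
proof -
  obtain C where C: "C > 0" "\<And>z n. z \<in> torus \<Longrightarrow> 1 / cmod (cocycle w n z) \<le> C * (1 / \<rho>) ^ n"
    using inverse_cocycle_bound_torus[OF r nzT] by metis
  define u where "u n x = \<Phi> (- int n) (x, y)" for n :: nat and x
  have ut: "u n x \<in> torus" if "x \<in> sphere 0 1" for n x
    unfolding u_def by (rule Phi_in_torus) (use that y in simp)
  have uc: "u n x \<in> closed_bidisc" if "x \<in> sphere 0 1" for n x
    using ut[OF that] torus_subset_closed_bidisc by blast
  have u1: "\<Phi> 1 (u (Suc n) x) = u n x" if "x \<in> sphere 0 1" for n x
  proof -
    have "(x, y) \<in> closed_bidisc" using that y by simp
    then show ?thesis by (simp add: u_def Phi_add)
  qed
  define W where "W n x = cocycle w n (u n x)" for n x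
  have W0: "W n x \<noteq> 0" if "x \<in> sphere 0 1" for n x
    unfolding W_def cocycle_def using nzT Phi_in_torus[OF ut[OF that]] by (simp del: mem_Times_iff)
  have WS: "W (Suc n) x = apply_bidisc w (u (Suc n) x) * W n x" if "x \<in> sphere 0 1" for n x
    unfolding W_def cocycle_Suc_shift[OF uc[OF that]] u1[OF that] ..
  have contu: "continuous_on (sphere 0 1) (u n)" for n
    unfolding u_def[abs_def]
    by (rule continuous_on_compose2[OF continuous_on_Phi]) (use y in \<open>auto intro!: continuous_intros\<close>)
  have contW: "continuous_on (sphere 0 1) (W n)" for n
    unfolding W_def[abs_def]
    by (rule continuous_on_compose2[OF continuous_on_cocycle contu]) (use uc in blast)
  define G where "G f n x = apply_bidisc f (u n x) / W n x" for f n x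
  have contG: "continuous_on (sphere 0 1) (G f n)" for f n
    unfolding G_def[abs_def]
    by (intro continuous_on_divide continuous_on_compose2[OF continuous_on_apply_bidisc contu] contW)
      (use uc W0 in blast)+
  define \<tau> where "\<tau> n f = cauchy_mean a (G f n)" for n f
  have Gle: "cmod (G f n x) \<le> C * (1 / \<rho>) ^ n * norm f" if x: "x \<in> sphere 0 1" for f n x
  proof -
    have "cmod (G f n x) = (1 / cmod (W n x)) * cmod (apply_bidisc f (u n x))" by (simp add: G_def norm_divide)
    also have "\<dots> \<le> C * (1 / \<rho>) ^ n * norm f"
      unfolding W_def using C(2)[OF ut[OF x]] norm_apply_le[OF uc[OF x]] C(1) r(1) by (intro mult_mono) auto
    finally show ?thesis .
  qed
  define C' where "C' = C / (1 - cmod a)"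
  have \<tau>le: "cmod (\<tau> n f) \<le> C' * (1 / \<rho>) ^ n * norm f" for n f
    using cauchy_mean_norm_le[OF a contG Gle] by (simp add: \<tau>_def C'_def)
  have \<tau>b: "bounded_cfunctional (\<tau> n)" for n
  proof (rule bounded_cfunctionalI)
    show "\<tau> n (f + g) = \<tau> n f + \<tau> n g" for f g
      unfolding \<tau>_def cauchy_mean_add[OF a contG contG, symmetric]
      by (rule cauchy_mean_cong) (simp add: G_def apply_simps add_divide_distrib)
    show "\<tau> n (c *\<^sub>C f) = c * \<tau> n f" for c f
      unfolding \<tau>_def cauchy_mean_cmult[OF a contG, symmetric]
      by (rule cauchy_mean_cong) (simp add: G_def apply_simps)
    show "cmod (\<tau> n f) \<le> norm f * (C' * (1 / \<rho>) ^ n)" for f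
      using \<tau>le[of n f] by (simp add: mult_ac)
  qed
  have \<tau>0f: "\<tau> 0 f = apply_bidisc f (a, y)" for f
  proof -
    have yc: "y \<in> cball 0 1" using y by simp
    have "\<tau> 0 f = cauchy_mean a (\<lambda>x. apply_bidisc f (x, y))"
      unfolding \<tau>_def by (rule cauchy_mean_cong) (simp add: G_def W_def u_def Phi_0)
    also have "\<dots> = apply_bidisc f (a, y)"
      by (rule cauchy_mean_holomorphic[OF a continuous_on_slice_fst[OF yc] holomorphic_slice_fst[OF yc]])
    finally show ?thesis .
  qed
  have \<tau>0: "\<tau> 0 (T f) = 0" for f
    unfolding \<tau>0f by (subst apply_T) (use a y zero in auto)
  have \<tau>S: "\<tau> (Suc n) (T f) = \<tau> n f" for n f
    unfolding \<tau>_def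
  proof (rule cauchy_mean_cong)
    fix x :: complex assume x: "x \<in> sphere 0 1"
    have "apply_bidisc w (u (Suc n) x) \<noteq> 0" by (rule nzT[OF ut[OF x]])
    then show "G (T f) (Suc n) x = G f n x"
      by (simp add: G_def apply_T[OF uc[OF x]] u1[OF x] WS[OF x])
  qed
  note chain = bounded_cfunctional_backward_chain[OF bounded_clinear_T \<tau>b \<tau>0 \<tau>S \<tau>le mu]
  define one where "one = bidisc_of (\<lambda>_. 1)"
  have one: "apply_bidisc one z = 1" if "z \<in> closed_bidisc" for z
    unfolding one_def by (rule apply_bidisc_of[OF _ _ _ that]) auto
  define \<nu> where "\<nu> f = (\<Sum>n. \<mu> ^ n * \<tau> n f)" for f
  define \<kappa> where "\<kappa> n = \<mu> ^ n * \<tau> n one" for n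
  show ?thesis
  proof (rule that[of \<nu> \<kappa>])
    show "bounded_cfunctional \<nu>" unfolding \<nu>_def[abs_def] by (rule chain(1))
    show "\<nu> (shifted \<mu> T f) = 0" for f unfolding \<nu>_def by (rule chain(2))
    show "\<kappa> 0 = 1" using a y by (simp add: \<kappa>_def \<tau>0f one)
    have q: "0 \<le> cmod \<mu> / \<rho>" "cmod \<mu> / \<rho> < 1" using mu r(1) by auto
    have "summable (\<lambda>n. C' * norm one * (cmod \<mu> / \<rho>) ^ n)"
      using q by (intro summable_mult summable_geometric) simp
    then show "summable (\<lambda>n. norm (\<kappa> n))"
    proof (rule summable_comparison_test'[of _ 0])
      fix n :: nat
      have "norm (norm (\<kappa> n)) = cmod \<mu> ^ n * cmod (\<tau> n one)" by (simp add: \<kappa>_def norm_mult norm_power)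
      also have "\<dots> \<le> cmod \<mu> ^ n * (C' * (1 / \<rho>) ^ n * norm one)" by (intro mult_left_mono \<tau>le) auto
      finally show "norm (norm (\<kappa> n)) \<le> C' * norm one * (cmod \<mu> / \<rho>) ^ n" by (simp add: power_divide mult_ac)
    qed
    show "\<nu> f = (\<Sum>n. \<kappa> n * h (parabolic \<zeta> (- (real n * b)) y))"
      if f: "\<And>z. z \<in> closed_bidisc \<Longrightarrow> apply_bidisc f z = h (snd z)" for f h
    proof -
      have "\<tau> n f = h (parabolic \<zeta> (- (real n * b)) y) * \<tau> n one" for n
        unfolding \<tau>_def cauchy_mean_cmult[OF a contG, symmetric]
      proof (rule cauchy_mean_cong)
        fix x :: complex assume x: "x \<in> sphere 0 1"
        show "G f n x = h (parabolic \<zeta> (- (real n * b)) y) * G one n x"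
          by (simp add: G_def f[OF uc[OF x]] one[OF uc[OF x]]) (simp add: u_def \<Phi>_def)
      qed
      then show ?thesis unfolding \<nu>_def \<kappa>_def by (intro suminf_cong) (simp add: mult_ac)
    qed
  qed
qed

text \<open>Points on different orbits of the circle are separated by peak functions of the second coordinate.\<close>

lemma not_lower_semi_Fredholm_slice_zeros:
  assumes r: "\<rho> > 0" "\<And>x. x \<in> sphere 0 1 \<Longrightarrow> \<rho> ^ p < cmod (cocycle w p (x, \<zeta>))"
    and mu: "cmod \<mu> < \<rho>" and nzT: "\<And>z. z \<in> torus \<Longrightarrow> apply_bidisc w z \<noteq> 0"
    and zeros: "\<forall>y\<in>sphere 0 1. \<exists>x\<in>ball 0 1. apply_bidisc w (x, y) = 0"
  shows "\<not> lower_semi_Fredholm (shifted \<mu> T)"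
proof (rule not_lower_semi_Fredholm_if_independent_functionals[OF bounded_clinear_shifted[OF bounded_clinear_T]])
  fix k :: nat
  \<comment> \<open>Different fractions of a translation step give points on different orbits.\<close>
  define t where "t i = 1 / (real i + 2)" for i :: nat
  have t: "0 < t i" "t i < 1" for i by (simp_all add: t_def)
  have "\<exists>y. y \<in> sphere 0 1 \<and> y \<noteq> \<zeta> \<and> height_coord \<zeta> y = \<i> + of_real (t i * b)" for i
    using height_coord_on_line[OF norm_zeta, of "\<i> + of_real (t i * b)"] by auto
  then obtain y where y: "\<And>i. y i \<in> sphere 0 1" "\<And>i. y i \<noteq> \<zeta>" "\<And>i. height_coord \<zeta> (y i) = \<i> + of_real (t i * b)"
    by metis
  have yc: "y i \<in> cball 0 1" for i using y(1)[of i] by simp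
  have orbit: "i = j \<and> n = 0" if "parabolic \<zeta> (- (real n * b)) (y i) = y j" for i j n
  proof -
    have "(of_real (t i * b - real n * b) :: complex) = of_real (t j * b)"
      using height_coord_parabolic[OF norm_zeta yc y(2), of "- (real n * b)" i] unfolding that y(3) by simp
    then have "t i * b - real n * b = t j * b" by (simp only: of_real_eq_iff)
    then have "(t i - real n - t j) * b = 0" by (simp add: algebra_simps)
    then have eq: "t i - real n = t j" using b_nonzero by simp
    then have "real n < 1" using t[of i] t[of j] by linarith
    then have n: "n = 0" by simp
    then show ?thesis using eq by (simp add: t_def)
  qed
  define good where "good i \<nu> \<kappa> \<longleftrightarrow> bounded_cfunctional \<nu> \<and> (\<forall>f. \<nu> (shifted \<mu> T f) = 0) \<and>
    summable (\<lambda>n. norm (\<kappa> n)) \<and> \<kappa> 0 = 1 \<and>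
    (\<forall>f h. (\<forall>z\<in>closed_bidisc. apply_bidisc f z = h (snd z)) \<longrightarrow>
       \<nu> f = (\<Sum>n. \<kappa> n * h (parabolic \<zeta> (- (real n * b)) (y i))))"
    for i and \<nu> :: "bidisc_algebra \<Rightarrow> complex" and \<kappa> :: "nat \<Rightarrow> complex"
  have "\<exists>\<nu> \<kappa>. good i \<nu> \<kappa>" for i
  proof -
    obtain a where a: "a \<in> ball 0 1" "apply_bidisc w (a, y i) = 0" using zeros y(1) by blast
    show ?thesis
    proof (rule functional_at_slice_zero[OF r mu nzT a(1) y(1) a(2)])
      fix \<nu> \<kappa>
      assume \<nu>: "bounded_cfunctional \<nu>" "\<And>f. \<nu> (shifted \<mu> T f) = 0"
        "summable (\<lambda>n. norm (\<kappa> n))" "\<kappa> 0 = 1"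
        "\<And>f h. (\<And>z. z \<in> closed_bidisc \<Longrightarrow> apply_bidisc f z = h (snd z)) \<Longrightarrow>
           \<nu> f = (\<Sum>n. \<kappa> n * h (parabolic \<zeta> (- (real n * b)) (y i)))"
      show ?thesis
        by (rule exI[of _ \<nu>], rule exI[of _ \<kappa>], unfold good_def) (intro conjI allI impI \<nu>, blast)
    qed
  qed
  then obtain \<nu> \<kappa> where good: "\<And>i. good i (\<nu> i) (\<kappa> i)" by metis
  have \<nu>: "\<And>i. bounded_cfunctional (\<nu> i)" "\<And>i f. \<nu> i (shifted \<mu> T f) = 0"
    and \<kappa>: "\<And>i. summable (\<lambda>n. norm (\<kappa> i n))" "\<And>i. \<kappa> i 0 = 1"
    and \<nu>f: "\<And>i f h. (\<forall>z\<in>closed_bidisc. apply_bidisc f z = h (snd z)) \<Longrightarrow>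
       \<nu> i f = (\<Sum>n. \<kappa> i n * h (parabolic \<zeta> (- (real n * b)) (y i)))"
    using good unfolding good_def by blast+
  have "\<exists>F L. L \<noteq> 0 \<and> (\<forall>i\<le>k. (\<lambda>m::nat. \<nu> i (F m)) \<longlonglongrightarrow> (if i = j then L else 0))" for j
  proof -
    define q where "q v = (1 + cnj (y j) * v) / 2" for v
    define F where "F m = bidisc_of (\<lambda>z. q (snd z) ^ m)" for m :: nat
    have "apply_bidisc (F m) z = q (snd z) ^ m" if "z \<in> closed_bidisc" for m z
      unfolding F_def q_def
      by (rule apply_bidisc_of[OF _ _ _ that]) (auto intro!: continuous_intros holomorphic_intros)
    then have \<nu>F: "\<nu> i (F m) = (\<Sum>n. \<kappa> i n * q (parabolic \<zeta> (- (real n * b)) (y i)) ^ m)" for i m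
      by (intro \<nu>f[where h="\<lambda>v. q v ^ m"]) blast
    have "(\<lambda>m. \<Sum>n. \<kappa> i n * q (parabolic \<zeta> (- (real n * b)) (y i)) ^ m) \<longlonglongrightarrow> (if i = j then \<kappa> i 0 else 0)" for i
    proof (rule suminf_powers_tendsto[OF \<kappa>(1)])
      fix n
      let ?v = "parabolic \<zeta> (- (real n * b)) (y i)"
      have vc: "?v \<in> cball 0 1" by (rule parabolic_in_disc(1)[OF norm_zeta yc])
      have le: "cmod (1 + cnj (y j) * ?v) \<le> 2" by (rule one_plus_cnj_mult_le_2[OF y(1) vc])
      then show "cmod (q ?v) \<le> 1" by (simp add: q_def norm_divide)
      show "(\<lambda>m. q ?v ^ m) \<longlonglongrightarrow> (if i = j \<and> n = 0 then 1 else 0)"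
      proof (cases "i = j \<and> n = 0")
        case True
        then have "q ?v = 1"
          using y(1)[of j] by (simp add: q_def parabolic_0[OF norm_zeta] mult.commute complex_norm_square[symmetric])
        then show ?thesis using True by simp
      next
        case False
        then have "?v \<noteq> y j" using orbit by blast
        then have "cmod (1 + cnj (y j) * ?v) \<noteq> 2"
          using one_plus_cnj_mult_eq_2_imp[OF y(1) vc] by blast
        then have "cmod (q ?v) < 1" using le by (simp add: q_def norm_divide)
        then show ?thesis unfolding if_not_P[OF False] by (rule LIMSEQ_power_zero)
      qed
    qed
    then show ?thesis unfolding \<nu>F[symmetric] \<kappa>(2) by (intro exI[of _ F] exI[of _ 1]) simp
  qed
  then show "\<exists>\<nu>. (\<forall>i\<le>k. bounded_cfunctional (\<nu> i) \<and> (\<forall>f. \<nu> i (shifted \<mu> T f) = 0)) \<and>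
      (\<forall>j\<le>k. \<exists>F L. L \<noteq> 0 \<and> (\<forall>i\<le>k. (\<lambda>m::nat. \<nu> i (F m)) \<longlonglongrightarrow> (if i = j then L else 0)))"
    using \<nu>(1,2) by blast
qed

end

section \<open>Assembling the spectra\<close>

context weighted_rotation
begin

lemma funpow_eq_Phi:
  assumes phi: "\<And>z. z \<in> closed_bidisc \<Longrightarrow> \<phi> z = \<Phi> 1 z" and z: "z \<in> closed_bidisc"
  shows "(\<phi> ^^ n) z = \<Phi> (int n) z"
proof (induction n)
  case (Suc n)
  then show ?case using phi[OF Phi_in_closed_bidisc[OF z]] by (simp add: Phi_add[OF z])
qed (simp add: Phi_0)

lemma weight_iter_eq_cocycle:
  assumes phi: "\<And>z. z \<in> closed_bidisc \<Longrightarrow> \<phi> z = \<Phi> 1 z" and z: "z \<in> closed_bidisc"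
  shows "weight_iter (apply_bidisc w) \<phi> n z = cocycle w n z"
  by (induction n) (simp_all add: cocycle_Suc funpow_eq_Phi[OF phi z])

end

lemma image_scaled_disc:
  assumes "R \<ge> 0"
  shows "(\<lambda>s. complex_of_real R * s) ` cball 0 1 = {\<mu>. cmod \<mu> \<le> R}"
proof (intro equalityI subsetI)
  fix \<mu> assume "\<mu> \<in> (\<lambda>s. complex_of_real R * s) ` cball 0 1"
  then show "\<mu> \<in> {\<mu>. cmod \<mu> \<le> R}" using assms by (auto simp: norm_mult mult_left_le)
next
  fix \<mu> assume mu: "\<mu> \<in> {\<mu>. cmod \<mu> \<le> R}"
  show "\<mu> \<in> (\<lambda>s. complex_of_real R * s) ` cball 0 1"
  proof (cases "R = 0")
    case True
    then show ?thesis using mu by (intro image_eqI[of _ _ 0]) auto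
  next
    case False
    then show ?thesis using mu assms
      by (intro image_eqI[of _ _ "\<mu> / complex_of_real R"]) (auto simp: norm_divide divide_le_eq)
  qed
qed

theorem proposition4p6:
  fixes \<alpha> \<zeta> :: complex and p :: nat and \<psi> :: "complex \<Rightarrow> complex"
    and \<phi> :: "complex \<times> complex \<Rightarrow> complex \<times> complex"
    and w :: bidisc_algebra and T :: "bidisc_algebra \<Rightarrow> bidisc_algebra"
    and r R :: real
  assumes "primitive_root_of_unity p \<alpha>"
    and "parabolic_disc_moebius \<psi>"
    and "\<zeta> \<in> cball 0 1" and "\<psi> \<zeta> = \<zeta>"
    and "\<phi> = (\<lambda>(z1, z2). (\<alpha> * z1, \<psi> z2))"
    and "\<And>f z. z \<in> closed_bidisc \<Longrightarrow> apply_bidisc (T f) z = apply_bidisc w z * apply_bidisc f (\<phi> z)"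
    and "r = (LEAST x. x \<in> (\<lambda>\<xi>. root p (cmod (weight_iter w \<phi> p (\<xi>, \<zeta>)))) ` sphere 0 1)"
    and "R = (GREATEST x. x \<in> (\<lambda>\<xi>. root p (cmod (weight_iter w \<phi> p (\<xi>, \<zeta>)))) ` sphere 0 1)"
  shows
    "(invertible_bidisc w \<longrightarrow>
        spectrum T = annulus r R \<and> semi_Fredholm_spectrum T = annulus r R) \<and>
     (\<not> invertible_torus w \<longrightarrow>
        spectrum T = (\<lambda>s. complex_of_real R * s) ` cball 0 1 \<and>
        semi_Fredholm_spectrum T = (\<lambda>s. complex_of_real R * s) ` cball 0 1) \<and>
     (\<not> invertible_bidisc w \<and> invertible_torus w \<longrightarrow>
        approx_point_spectrum T = annulus r R \<and> semi_Fredholm_spectrum T = annulus r R \<and>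
        spectrum T = (\<lambda>s. complex_of_real R * s) ` cball 0 1 \<and>
        lower_semi_Fredholm_spectrum T = (\<lambda>s. complex_of_real R * s) ` cball 0 1)"
proof -
  obtain b where b: "b \<noteq> 0" "cmod \<zeta> = 1" "\<And>z. z \<in> cball 0 1 \<Longrightarrow> \<psi> z = parabolic \<zeta> b z"
    using parabolic_disc_moebius_normal_form[OF assms(2-4)] by metis
  have p: "p > 0" "\<alpha> ^ p = 1" using assms(1) by (simp_all add: primitive_root_of_unity_def)
  interpret P: parabolic_rotation \<alpha> \<zeta> p b
    using b p by unfold_locales auto
  have phi: "\<phi> z = P.\<Phi> 1 z" if "z \<in> closed_bidisc" for z
  proof -
    have "snd z \<in> cball 0 1" using that by auto
    then show ?thesis by (simp add: assms(5) P.\<Phi>_def b(3) case_prod_unfold)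
  qed
  interpret Q: weighted_rotation \<alpha> \<zeta> p b w T
    by unfold_locales (simp add: assms(6) phi del: mem_Times_iff)
  have zc: "(x, \<zeta>) \<in> closed_bidisc" if "x \<in> sphere 0 1" for x
    using that b(2) by simp
  define m where "m x = root p (cmod (P.cocycle w p (x, \<zeta>)))" for x
  have img: "(\<lambda>\<xi>. root p (cmod (weight_iter w \<phi> p (\<xi>, \<zeta>)))) ` sphere 0 1 = m ` sphere 0 1"
    unfolding m_def by (intro image_cong refl) (simp add: Q.weight_iter_eq_cocycle[OF phi zc])
  have m_pow: "m x ^ p = cmod (P.cocycle w p (x, \<zeta>))" for x
    unfolding m_def using p(1) by (simp add: real_root_pow_pos2)
  have m0: "m x \<ge> 0" for x using p(1) by (simp add: m_def)
  have contm: "continuous_on (sphere 0 1) m"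
    unfolding m_def[abs_def]
    by (intro continuous_intros continuous_on_compose2[OF P.continuous_on_cocycle]) (use b(2) in auto)
  have ne: "sphere (0::complex) 1 \<noteq> {}" using P.zeta_in by blast
  obtain x1 where x1: "x1 \<in> sphere 0 1" "\<And>x. x \<in> sphere 0 1 \<Longrightarrow> m x1 \<le> m x"
    using continuous_attains_inf[OF compact_sphere ne contm] by blast
  obtain x2 where x2: "x2 \<in> sphere 0 1" "\<And>x. x \<in> sphere 0 1 \<Longrightarrow> m x \<le> m x2"
    using continuous_attains_sup[OF compact_sphere ne contm] by blast
  have r: "r = m x1"
    unfolding assms(7) img by (rule Least_equality) (use x1 in auto)
  have R: "R = m x2"
    unfolding assms(8) img by (rule Greatest_equality) (use x2 in auto)
  have r0: "r \<ge> 0" and R0: "R \<ge> 0" using m0 by (simp_all add: r R)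
  have "connected (sphere (0::complex) 1)" by (rule connected_sphere) simp
  then have conn: "connected (m ` sphere 0 1)" by (rule connected_continuous_image[OF contm])
  have attained: "\<exists>x\<in>sphere 0 1. cmod (P.cocycle w p (x, \<zeta>)) = cmod \<mu> ^ p" if "r \<le> cmod \<mu>" "cmod \<mu> \<le> R" for \<mu>
  proof -
    have "cmod \<mu> \<in> m ` sphere 0 1"
      using connectedD_interval[OF conn, of r R "cmod \<mu>"] x1(1) x2(1) that by (auto simp: r R)
    then obtain x where "x \<in> sphere 0 1" "cmod \<mu> = m x" by blast
    then show ?thesis using m_pow[of x] by auto
  qed
  have large: "\<mu> \<notin> spectrum T" if lt: "R < cmod \<mu>" for \<mu>
  proof -
    obtain \<rho> where \<rho>: "R < \<rho>" "\<rho> < cmod \<mu>" using dense[OF lt] by blast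
    have "cmod (P.cocycle w p (x, \<zeta>)) < \<rho> ^ p" if "x \<in> sphere 0 1" for x
      unfolding m_pow[symmetric] using x2(2)[OF that] \<rho>(1) m0 p(1) R by (intro power_strict_mono) auto
    then show ?thesis using \<rho> R0 by (intro Q.notin_spectrum_if_large[of \<rho>]) auto
  qed
  have small: "\<exists>\<rho>>0. cmod \<mu> < \<rho> \<and> (\<forall>x\<in>sphere 0 1. \<rho> ^ p < cmod (P.cocycle w p (x, \<zeta>)))" if lt: "cmod \<mu> < r" for \<mu>
  proof -
    obtain \<rho> where \<rho>: "cmod \<mu> < \<rho>" "\<rho> < r" using dense[OF lt] by blast
    then have \<rho>0: "\<rho> > 0" using norm_ge_zero[of \<mu>] by linarith
    have "\<rho> ^ p < cmod (P.cocycle w p (x, \<zeta>))" if "x \<in> sphere 0 1" for x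
      unfolding m_pow[symmetric] using x1(2)[OF that] \<rho>(2) \<rho>0 p(1) r by (intro power_strict_mono) auto
    then show ?thesis using \<rho> \<rho>0 by blast
  qed
  have circle: "\<mu> \<in> semi_Fredholm_spectrum T" "\<mu> \<in> approx_point_spectrum T"
    if "\<mu> \<noteq> 0" "r \<le> cmod \<mu>" "cmod \<mu> \<le> R" for \<mu>
    using attained[OF that(2,3)] Q.not_semi_Fredholm_on_circle[OF _ that(1)] by blast+
  have sub: "semi_Fredholm_spectrum T \<subseteq> lower_semi_Fredholm_spectrum T"
    "lower_semi_Fredholm_spectrum T \<subseteq> spectrum T"
    by (rule semi_Fredholm_spectrum_subset_lower, rule lower_semi_Fredholm_spectrum_subset_spectrum)
  have r_pos: "r > 0" if "\<forall>z\<in>torus. apply_bidisc w z \<noteq> 0"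
  proof -
    have "(x1, \<zeta>) \<in> torus" using x1(1) P.zeta_in by simp
    then have "apply_bidisc w (P.\<Phi> n (x1, \<zeta>)) \<noteq> 0" for n
      using that P.Phi_in_torus by blast
    then have "P.cocycle w p (x1, \<zeta>) \<noteq> 0" by (simp add: P.cocycle_def)
    then have "m x1 ^ p \<noteq> 0" unfolding m_pow by simp
    then have "m x1 \<noteq> 0" using p(1) by auto
    then show ?thesis using r0 by (simp add: r)
  qed
  have annulus: "\<mu> \<in> semi_Fredholm_spectrum T" "\<mu> \<in> approx_point_spectrum T"
    if "r > 0" "\<mu> \<in> annulus r R" for \<mu>
  proof -
    have "\<mu> \<noteq> 0" "r \<le> cmod \<mu>" "cmod \<mu> \<le> R" using that by (auto simp: annulus_def)
    then show "\<mu> \<in> semi_Fredholm_spectrum T" "\<mu> \<in> approx_point_spectrum T" by (rule circle)+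
  qed
  have part1: "spectrum T = annulus r R \<and> semi_Fredholm_spectrum T = annulus r R" if inv: "invertible_bidisc w"
  proof -
    obtain v where v: "\<And>z. z \<in> closed_bidisc \<Longrightarrow> apply_bidisc w z * apply_bidisc v z = 1"
      using inv unfolding invertible_bidisc_def by blast
    have "\<forall>z\<in>torus. apply_bidisc w z \<noteq> 0"
      using inv torus_subset_closed_bidisc unfolding invertible_bidisc_iff by blast
    then have rp: "r > 0" by (rule r_pos)
    have "\<mu> \<notin> spectrum T" if "cmod \<mu> < r" for \<mu>
      using small[OF that] Q.notin_spectrum_if_small_invertible[OF _ _ _ v] by blast
    then have "spectrum T \<subseteq> annulus r R"
      using large unfolding annulus_def by (auto simp: not_less[symmetric])
    moreover have "annulus r R \<subseteq> semi_Fredholm_spectrum T"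
      using annulus(1)[OF rp] by blast
    ultimately show ?thesis using sub by blast
  qed
  have part2: "spectrum T = {\<mu>. cmod \<mu> \<le> R} \<and> semi_Fredholm_spectrum T = {\<mu>. cmod \<mu> \<le> R}"
    if ninv: "\<not> invertible_torus w"
  proof -
    obtain z where z: "z \<in> torus" "apply_bidisc w z = 0" using ninv unfolding invertible_torus_iff by blast
    have "\<mu> \<in> semi_Fredholm_spectrum T" if "cmod \<mu> \<le> R" for \<mu>
    proof (cases "cmod \<mu> < r")
      case True
      then show ?thesis
        using small[OF True] Q.torus_zero_imp_small_in_semi_Fredholm_spectrum[OF _ _ _ z] by blast
    next
      case False
      then show ?thesis
        using circle(1)[of \<mu>] that Q.zero_in_semi_Fredholm_spectrum[OF z] by (cases "\<mu> = 0") auto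
    qed
    moreover have "spectrum T \<subseteq> {\<mu>. cmod \<mu> \<le> R}" using large by (auto simp: not_less[symmetric])
    ultimately show ?thesis using sub by blast
  qed
  have part3: "approx_point_spectrum T = annulus r R \<and> semi_Fredholm_spectrum T = annulus r R \<and>
      spectrum T = {\<mu>. cmod \<mu> \<le> R} \<and> lower_semi_Fredholm_spectrum T = {\<mu>. cmod \<mu> \<le> R}"
    if "\<not> invertible_bidisc w" "invertible_torus w"
  proof -
    have nzT: "apply_bidisc w z \<noteq> 0" if "z \<in> torus" for z
      using \<open>invertible_torus w\<close> that unfolding invertible_torus_iff by blast
    obtain z where z: "z \<in> closed_bidisc" "apply_bidisc w z = 0"
      using \<open>\<not> invertible_bidisc w\<close> unfolding invertible_bidisc_iff by blast
    have rp: "r > 0" using nzT by (intro r_pos) blast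
    note ann = annulus[OF rp]
    have below: "\<exists>c>0. \<forall>f. c * norm f \<le> norm (shifted \<mu> T f)" if mu: "cmod \<mu> < r" for \<mu>
    proof -
      obtain \<rho> where \<rho>: "\<rho> > 0" "cmod \<mu> < \<rho>" "\<And>x. x \<in> sphere 0 1 \<Longrightarrow> \<rho> ^ p < cmod (P.cocycle w p (x, \<zeta>))"
        using small[OF mu] by blast
      obtain c where "c > 0" "\<And>f. c * norm f \<le> norm (shifted \<mu> T f)"
        using Q.bounded_below_if_small[OF \<rho> nzT] by blast
      then show ?thesis by blast
    qed
    have notlsf: "\<mu> \<in> lower_semi_Fredholm_spectrum T" if mu: "cmod \<mu> < r" for \<mu>
    proof -
      obtain \<rho> where \<rho>: "\<rho> > 0" "cmod \<mu> < \<rho>" "\<And>x. x \<in> sphere 0 1 \<Longrightarrow> \<rho> ^ p < cmod (P.cocycle w p (x, \<zeta>))"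
        using small[OF mu] by blast
      from Q.interior_zero_on_cylinder[OF nzT z]
      have "\<not> lower_semi_Fredholm (shifted \<mu> T)"
        using Q.not_lower_semi_Fredholm_cylinder_zeros[OF \<rho>(1,3,2)]
          Q.not_lower_semi_Fredholm_slice_zeros[OF \<rho>(1,3,2) nzT] by blast
      then show ?thesis by (simp add: lower_semi_Fredholm_spectrum_def)
    qed
    have usf: "\<mu> \<notin> semi_Fredholm_spectrum T" "\<mu> \<notin> approx_point_spectrum T" if mu: "cmod \<mu> < r" for \<mu>
    proof -
      obtain c where c: "c > 0" "\<And>f. c * norm f \<le> norm (shifted \<mu> T f)" using below[OF mu] by blast
      show "\<mu> \<notin> semi_Fredholm_spectrum T"
        using bounded_below_imp_upper_semi_Fredholm[OF bounded_clinear_shifted[OF Q.bounded_clinear_T] c]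
        by (simp add: semi_Fredholm_spectrum_def semi_Fredholm_def)
      show "\<mu> \<notin> approx_point_spectrum T" by (rule bounded_below_notin_approx_point_spectrum[OF c])
    qed
    have disc: "\<mu> \<in> lower_semi_Fredholm_spectrum T" if "cmod \<mu> \<le> R" for \<mu>
    proof (cases "cmod \<mu> < r")
      case True
      then show ?thesis by (rule notlsf)
    next
      case False
      then have "\<mu> \<in> annulus r R" using that by (simp add: annulus_def)
      then show ?thesis using ann(1) sub by blast
    qed
    have out: "\<mu> \<notin> semi_Fredholm_spectrum T" "\<mu> \<notin> approx_point_spectrum T" if "\<mu> \<notin> annulus r R" for \<mu>
    proof -
      have "cmod \<mu> < r \<or> R < cmod \<mu>" using that by (auto simp: annulus_def)
      then show "\<mu> \<notin> semi_Fredholm_spectrum T" "\<mu> \<notin> approx_point_spectrum T"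
        using usf large sub approx_point_spectrum_disjoint_resolvent by blast+
    qed
    have "spectrum T \<subseteq> {\<mu>. cmod \<mu> \<le> R}" using large by (auto simp: not_less[symmetric])
    then show ?thesis using ann out disc sub by blast
  qed
  show ?thesis
    unfolding image_scaled_disc[OF R0] using part1 part2 part3 by blast
qed

end
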